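(* Let $\varepsilon>0$ be fixed. Suppose that $\xi\in\mathcal{D}_{1/2}$, $|\sinh \xi| \ge \varepsilon$ and that $\nu\in \mathbb{C}$ is bounded. Then, as $\Re \mu\to+\infty$ with $\Im \mu$ bounded, the associated Legendre functions have the inverse factorial expansions $$\begin{aligned}P_\nu ^\mu (\coth \xi ) \sim \; & \frac{\sin(\pi\mu)}{\pi} e^{\mu\xi} \sum_{n = 0}^{\infty} a_n \left(\nu+\tfrac12\right) \Gamma ( \mu-n) \left( \frac{-e^{ - \xi } }{\sinh \xi } \right)^n \\ & +C\left(\xi,-\mu-\tfrac12\right)\frac{\sin(\pi\nu)}{\pi}e^{-\mu\xi}\sum_{n = 0}^{\infty} a_n \left(\nu+\tfrac12\right) \Gamma ( \mu-n) \left( \frac{e^{\xi } }{\sinh \xi } \right)^n,\end{aligned}$$ $$\begin{aligned} e^{-\pi i\mu}Q_\nu ^\mu (\coth \xi ) \sim \; & \tfrac12 e^{\mu\xi} \sum_{n = 0}^{\infty} a_n \left(\nu+\tfrac12\right) \Gamma ( \mu-n) \left( \frac{-e^{ - \xi } }{\sinh \xi } \right)^n \\ & +C\left(\xi,-\nu-\tfrac12\right)\tfrac{1}{2}e^{-\mu\xi}\sum_{n = 0}^{\infty} a_n \left(\nu+\tfrac12\right) \Gamma ( \mu-n) \left( \frac{e^{\xi } }{\sinh \xi } \right)^n. \end{aligned}$$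
   Context: $\mathcal{D}_{1/2}=\{\xi\in\mathbb{C} : \Re \xi>0,\ |\Im \xi |<\frac{\pi}{2}\}$; $\coth$ maps $\mathcal{D}_{1/2}$ biholomorphically onto $\{z:\Re z>0,\ z\notin(0,1]\}$. Meaning of $\sim$: an expansion $f\sim A\sum_{n\ge0} s_n + B\sum_{n\ge0} t_n$ with $s_n=a_n(\nu+\frac12)\Gamma(\mu-n)X^n$, $t_n=a_n(\nu+\frac12)\Gamma(\mu-n)Y^n$ means that for all fixed non-negative integers $N,M$ one can write $f=A\left(\sum_{n=0}^{N-1}s_n+\mathcal{O}(|\Gamma(\mu-N)||X|^N)\right)+B\left(\sum_{m=0}^{M-1}t_m+\mathcal{O}(|\Gamma(\mu-M)||Y|^M)\right)$ in the stated limit, with implied constants uniform over the allowed $\xi$, $\nu$ (in a fixed bounded set) and $\Im\mu$ (in a fixed bounded set). Associated Legendre functions, for $z\in\mathbb{C}\setminus(-\infty,1]$ (powers positive-based for $z>1$, continued by analyticity): $P_\nu ^\mu (z) = \left(\frac{z + 1}{z - 1}\right)^{\mu /2}\mathbf{F}\left(\nu+1,-\nu;1-\mu;\frac{1-z}{2}\right)$ and, for $\nu+\mu\notin\mathbb{Z}_{<0}$, $e^{-\pi i\mu }Q_\nu ^\mu (z) = \frac{\pi ^{1/2} \Gamma (\nu +\mu + 1)(z^2 - 1)^{\mu /2} }{2^{\nu + 1} z^{\nu +\mu + 1}}\mathbf{F}\left(\tfrac{\nu+\mu+2}{2},\tfrac{\nu+\mu+1}{2};\nu+\tfrac32;\tfrac{1}{z^2}\right)$,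 where $\mathbf{F}(a,b;c;w)=\sum_{n\ge 0}\frac{(a)_n(b)_n}{\Gamma(c+n)\,n!}w^n$ ($|w|<1$), continued analytically to $\mathbb{C}\setminus[1,+\infty)$. $a_n (\mu ) = \frac{(4\mu ^2 - 1^2 )(4\mu ^2 - 3^2 ) \cdots (4\mu ^2 - (2n - 1)^2 )}{8^n n!}$. $C(\xi ,\mu ) = \sin (\pi \mu )$ if $\xi > 0$, and $C(\xi,\mu)=\pm i\, e^{ \mp \pi i\mu }$ if $0<\pm \Im\xi < \pi$. *)

theory Defs
  imports "HOL-Analysis.Analysis"
begin

definition D_half :: "complex set" where
  "D_half = {\<xi>. 0 < Re \<xi> \<and> \<bar>Im \<xi>\<bar> < pi / 2}"

definition coth :: "complex \<Rightarrow> complex" where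
  "coth \<xi> = cosh \<xi> / sinh \<xi>"

text \<open>
  The regularized hypergeometric function on the plane cut along \<open>[1, \<infinity>)\<close>. The cut plane is
  connected, so by the identity theorem any two functions satisfying the description agree on it;
  values on the cut are unspecified.
\<close>

definition hyperF_reg :: "complex \<Rightarrow> complex \<Rightarrow> complex \<Rightarrow> complex \<Rightarrow> complex" where
  "hyperF_reg a b c = (SOME g.
     g holomorphic_on (- (complex_of_real ` {1..})) \<and>
     (\<forall>w. norm w < 1 \<longrightarrow>
        (\<lambda>n. pochhammer a n * pochhammer b n * rGamma (c + of_nat n) / fact n * w ^ n) sums g w))"

text \<open>
  Both functions are meant for \<open>z\<close> outside \<open>(-\<infinity>, 1]\<close>. There \<open>(z + 1) / (z - 1)\<close>, \<open>z - 1\<close>, \<open>z + 1\<close>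
  and \<open>z\<close> avoid \<open>(-\<infinity>, 0]\<close>, so the principal powers below are the analytic continuations of the
  powers with positive base for \<open>z > 1\<close>. For the same reason \<open>(z\<^sup>2 - 1)\<^bsup>\<mu>/2\<^esup>\<close> is split into two
  factors: the principal power of \<open>z\<^sup>2 - 1\<close> itself jumps across the imaginary axis.
\<close>

definition legendre_P :: "complex \<Rightarrow> complex \<Rightarrow> complex \<Rightarrow> complex" where
  "legendre_P \<nu> \<mu> z =
     ((z + 1) / (z - 1)) powr (\<mu> / 2) * hyperF_reg (\<nu> + 1) (- \<nu>) (1 - \<mu>) ((1 - z) / 2)"

text \<open>Meaningful only if \<open>\<nu> + \<mu>\<close> is not a negative integer.\<close>

definition legendre_Q :: "complex \<Rightarrow> complex \<Rightarrow> complex \<Rightarrow> complex" where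
  "legendre_Q \<nu> \<mu> z =
     exp (of_real pi * \<i> * \<mu>) *
     (of_real (sqrt pi) * Gamma (\<nu> + \<mu> + 1) * ((z - 1) powr (\<mu> / 2) * (z + 1) powr (\<mu> / 2)) /
        (2 powr (\<nu> + 1) * z powr (\<nu> + \<mu> + 1)) *
      hyperF_reg ((\<nu> + \<mu> + 2) / 2) ((\<nu> + \<mu> + 1) / 2) (\<nu> + 3 / 2) (1 / z\<^sup>2))"

definition a_coeff :: "nat \<Rightarrow> complex \<Rightarrow> complex" where
  "a_coeff n \<mu> = (\<Prod>k=1..n. 4 * \<mu>\<^sup>2 - (2 * of_nat k - 1)\<^sup>2) / (8 ^ n * fact n)"

text \<open>Used only for \<open>\<xi> > 0\<close> or \<open>0 < \<bar>Im \<xi>\<bar> < \<pi>\<close>.\<close>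

definition C_coeff :: "complex \<Rightarrow> complex \<Rightarrow> complex" where
  "C_coeff \<xi> \<mu> =
     (if Im \<xi> > 0 then \<i> * exp (- (of_real pi * \<i> * \<mu>))
      else if Im \<xi> < 0 then - \<i> * exp (of_real pi * \<i> * \<mu>)
      else sin (of_real pi * \<mu>))"

text \<open>
  \<open>f \<sim> A \<Sum>\<^sub>n s\<^sub>n + B \<Sum>\<^sub>n t\<^sub>n\<close> as \<open>Re \<mu> \<rightarrow> +\<infinity>\<close>, uniformly for \<open>(\<xi>, \<nu>, \<mu>)\<close> in the parameter set \<open>S\<close>, where
  \<open>s\<^sub>n = a\<^sub>n(\<nu> + 1/2) \<Gamma>(\<mu> - n) X\<^sup>n\<close> and \<open>t\<^sub>n = a\<^sub>n(\<nu> + 1/2) \<Gamma>(\<mu> - n) Y\<^sup>n\<close>. The two truncation orders are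
  independent, and \<open>r\<close>, \<open>s\<close> are the two error terms.
\<close>

definition inverse_factorial_expansion ::
  "(complex \<times> complex \<times> complex) set \<Rightarrow>
   (complex \<Rightarrow> complex \<Rightarrow> complex \<Rightarrow> complex) \<Rightarrow>
   (complex \<Rightarrow> complex \<Rightarrow> complex \<Rightarrow> complex) \<Rightarrow> (complex \<Rightarrow> complex) \<Rightarrow>
   (complex \<Rightarrow> complex \<Rightarrow> complex \<Rightarrow> complex) \<Rightarrow> (complex \<Rightarrow> complex) \<Rightarrow> bool" where
  "inverse_factorial_expansion S f A X B Y \<longleftrightarrow>
     (\<forall>N M. \<exists>K R::real. \<forall>\<xi> \<nu> \<mu>. (\<xi>, \<nu>, \<mu>) \<in> S \<longrightarrow> R \<le> Re \<mu> \<longrightarrow>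
        (\<exists>r s. norm r \<le> K * (norm (Gamma (\<mu> - of_nat N)) * norm (X \<xi>) ^ N) \<and>
               norm s \<le> K * (norm (Gamma (\<mu> - of_nat M)) * norm (Y \<xi>) ^ M) \<and>
               f \<xi> \<nu> \<mu> =
                 A \<xi> \<nu> \<mu> * ((\<Sum>n<N. a_coeff n (\<nu> + 1 / 2) * Gamma (\<mu> - of_nat n) * X \<xi> ^ n) + r) +
                 B \<xi> \<nu> \<mu> * ((\<Sum>m<M. a_coeff m (\<nu> + 1 / 2) * Gamma (\<mu> - of_nat m) * Y \<xi> ^ m) + s)))"

end

theory Submission
  imports Defs "HOL-Complex_Analysis.Complex_Analysis"
begin

text \<open>
  Put \<open>w = (1 - coth \<xi>) / 2\<close>. The two series are formally \<open>\<Gamma>(\<mu>) F(\<nu> + 1, -\<nu>; 1 - \<mu>; p)\<close> at \<open>p = w\<close> and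
  \<open>p = 1 - w\<close>. Both are the asymptotic expansion of one function,
  \<open>E(p) = \<Gamma>(\<mu> + 3/2) \<integral>\<^sub>0\<^sup>1 \<^bold>F(\<nu> + 1, -\<nu>; 3/2; -p t / (1 - t)) t\<^bsup>1/2\<^esup> (1 - t)\<^bsup>\<mu> - 1\<^esup> dt\<close>,
  defined for \<open>p\<close> off the negative axis. Its kernel is elementary and stays bounded up to the cut, with
  polynomial growth, so inserting the Taylor polynomial of the kernel gives the expansion with an error
  that is uniform up to the cut. Moreover \<open>E(w)\<close> and \<open>w\<^sup>\<mu> (1 - w)\<^bsup>-\<mu>\<^esup> E(1 - w)\<close> form a basis of solutions of the
  differential equation satisfied by the Legendre functions divided by \<open>e\<^bsup>\<mu>\<xi>\<^esup>\<close>. The coefficients of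
  \<open>P\<close> and \<open>Q\<close> in this basis follow from their behaviour at the singular points \<open>w = 0\<close> and \<open>w = 1\<close>, which
  an Abelian theorem reads off from the hypergeometric coefficients.
\<close>

section \<open>Integrals depending holomorphically on a parameter\<close>

text \<open>The origin of 3/2: with \<open>c\<close> in its place the Beta integral of
  \<open>t^(c - 1 + n) * (1 - t)^(\<mu> - 1 - n)\<close> is \<Gamma>(c + n) \<Gamma>(\<mu> - n) /
  \<Gamma>(\<mu> + c), so every \<open>c\<close> with positive real part reproduces the same formal
  series. The exponents of the kernel at its singular point 1 are 0 and c - 1. The choice 3/2 makes
  the second one 1/2, so the kernel stays bounded there, and it is a case that reduces to hyperbolic
  functions. The obstacle is uniformity: for real \<xi> the point w is negative, hence on the cut of
  E, and nearby \<xi> approach it from both sides. An estimate deteriorating with the distance to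
  the cut would be useless. The exponents of the differential equation are 0 and \<mu> at w = 0, and
  0 and -\<mu> at w = 1. E is a solution holomorphic at 1, and its reflected partner vanishes like a
  multiple of the power \<mu> at 0. As Re \<mu> > 0, the leading behaviour at each singular point
  sees only one of the two.\<close>

lemma continuous_on_deriv_param:
  fixes f :: "complex \<Rightarrow> real \<Rightarrow> complex"
  assumes U: "open U"
    and cont: "continuous_on (U \<times> {a..b}) (\<lambda>(z, t). f z t)"
    and hol: "\<And>t. t \<in> {a..b} \<Longrightarrow> (\<lambda>z. f z t) holomorphic_on U"
  shows "continuous_on (U \<times> {a..b}) (\<lambda>(z, t). deriv (\<lambda>z. f z t) z)"
  unfolding continuous_on_eq_continuous_within
proof (intro ballI, clarify)
  fix z0 t0 assume z0: "z0 \<in> U" and t0: "t0 \<in> {a..b}"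
  obtain r where r: "r > 0" "cball z0 r \<subseteq> U"
    using U z0 open_contains_cball by blast
  let ?g = "\<lambda>t z. f z t"
  have uc: "uniformly_continuous_on (cball z0 r \<times> {a..b}) (\<lambda>(z, t). f z t)"
    by (intro compact_uniformly_continuous continuous_on_subset[OF cont])
       (use r in \<open>auto intro: compact_Times\<close>)
  have dcont: "isCont (deriv (?g t0)) z0"
    using holomorphic_deriv[OF hol[OF t0] U] U z0
      holomorphic_on_imp_continuous_on continuous_on_eq_continuous_at by blast
  show "continuous (at (z0, t0) within U \<times> {a..b}) (\<lambda>(z, t). deriv (?g t) z)"
    unfolding continuous_within_eps_delta
  proof (intro allI impI)
    fix e :: real assume e: "e > 0"
    \<comment> \<open>The bound e * r / 8 on a circle of radius r/2 becomes e/4 in Cauchy's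
      inequality. The closed disc of radius r contains all such circles about points within r/2 of
      \<open>z0\<close>.\<close>
    obtain d1 where d1: "d1 > 0"
      "\<And>x y. x \<in> cball z0 r \<times> {a..b} \<Longrightarrow> y \<in> cball z0 r \<times> {a..b} \<Longrightarrow> dist y x < d1 \<Longrightarrow>
        dist (f (fst y) (snd y)) (f (fst x) (snd x)) < e * r / 8"
    proof -
      have "e * r / 8 > 0" using e r by simp
      with uc obtain d where "d > 0" "\<forall>x\<in>cball z0 r \<times> {a..b}. \<forall>y\<in>cball z0 r \<times> {a..b}. dist y x < d \<longrightarrow>
          dist (f (fst y) (snd y)) (f (fst x) (snd x)) < e * r / 8"
        unfolding uniformly_continuous_on_def split_beta by meson
      thus ?thesis by (intro that[of d]) auto
    qed
    obtain d2 where d2: "d2 > 0" "\<And>z. dist z z0 < d2 \<Longrightarrow> dist (deriv (?g t0) z) (deriv (?g t0) z0) < e/2"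
    proof -
      have "e / 2 > 0" using e by simp
      thus ?thesis using that dcont unfolding continuous_at_eps_delta by blast
    qed
    show "\<exists>d>0. \<forall>x'\<in>U \<times> {a..b}. dist x' (z0, t0) < d \<longrightarrow>
        dist (case x' of (z, t) \<Rightarrow> deriv (?g t) z) (case (z0, t0) of (z, t) \<Rightarrow> deriv (?g t) z) < e"
    proof (intro exI[of _ "min (min d1 d2) (r/2)"] conjI ballI impI, goal_cases)
      case 1 show ?case using d1 d2 r by simp
    next
      case (2 x')
      obtain z t where x': "x' = (z, t)" by force
      from 2 x' have z: "z \<in> U" "dist z z0 < d2" "dist z z0 < r/2" and t: "t \<in> {a..b}" "dist t t0 < d1"
        using dist_fst_le[of x' "(z0,t0)"] dist_snd_le[of x' "(z0,t0)"] by auto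
      have sub: "cball z (r/2) \<subseteq> cball z0 r" using z(3) r
        by (intro subsetI) (auto simp: dist_commute intro: order.trans[OF dist_triangle[of _ _ z]])
      have subU: "cball z (r/2) \<subseteq> U" using sub r by blast
      have holt: "?g t holomorphic_on U" and holt0: "?g t0 holomorphic_on U" using hol t t0 by auto
      have "norm ((deriv ^^ 1) (\<lambda>z. f z t - f z t0) z) \<le> fact 1 * (e * r / 8) / (r/2)^1"
      proof (rule Cauchy_inequality)
        show "(\<lambda>z. f z t - f z t0) holomorphic_on ball z (r/2)"
          using subU by (intro holomorphic_intros holomorphic_on_subset[OF holt] holomorphic_on_subset[OF holt0]) auto
        show "continuous_on (cball z (r/2)) (\<lambda>z. f z t - f z t0)"
          using subU by (intro holomorphic_on_imp_continuous_on holomorphic_intros holomorphic_on_subset[OF holt] holomorphic_on_subset[OF holt0]) auto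
        fix x assume "norm (z - x) = r/2"
        hence "x \<in> cball z0 r" using sub by (auto simp: dist_norm)
        hence "dist (f x t) (f x t0) < e * r / 8"
          using d1(2)[of "(x,t0)" "(x,t)"] t t0 by (auto simp: dist_Pair_Pair)
        thus "norm (f x t - f x t0) \<le> e * r / 8" by (simp add: dist_norm)
      qed (use r in auto)
      moreover have "deriv (\<lambda>z. f z t - f z t0) z = deriv (?g t) z - deriv (?g t0) z"
        using holt holt0 z U by (intro deriv_diff) (auto simp: holomorphic_on_imp_differentiable_at)
      ultimately have "norm (deriv (?g t) z - deriv (?g t0) z) \<le> e/4"
        using r by simp
      with d2(2)[OF z(2)] e have "dist (deriv (?g t) z) (deriv (?g t0) z0) < e"
        using dist_triangle[of "deriv (?g t) z" "deriv (?g t0) z0" "deriv (?g t0) z"] by (simp add: dist_norm)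
      thus ?case by (simp add: x')
    qed
  qed
qed

lemma continuous_on_param_slice:
  assumes "continuous_on (U \<times> T) (\<lambda>(z, t). f z t)" "z \<in> U"
  shows "continuous_on T (f z)"
proof -
  have "continuous_on T (\<lambda>t. (z, t))" "(\<lambda>t. (z, t)) ` T \<subseteq> U \<times> T"
    using assms(2) by (auto intro!: continuous_intros)
  from continuous_on_compose2[OF assms(1) this] show ?thesis by simp
qed

text \<open>The Leibniz rule asks for joint continuity of the derivative. The Cauchy estimate above
  supplies it from joint continuity of the integrand, so the rule can be iterated to reach second
  derivatives.\<close>

lemma has_field_derivative_integral_param:
  fixes f :: "complex \<Rightarrow> real \<Rightarrow> complex"
  assumes U: "open U"
    and cont: "continuous_on (U \<times> {a..b}) (\<lambda>(z, t). f z t)"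
    and hol: "\<And>t. t \<in> {a..b} \<Longrightarrow> (\<lambda>z. f z t) holomorphic_on U"
    and z: "z \<in> U"
  shows "((\<lambda>z. integral {a..b} (f z)) has_field_derivative
            integral {a..b} (\<lambda>t. deriv (\<lambda>z. f z t) z)) (at z)"
proof -
  obtain r where r: "r > 0" "ball z r \<subseteq> U"
    using U z open_contains_ball by blast
  have "((\<lambda>z. integral (cbox a b) (f z)) has_field_derivative
            integral (cbox a b) ((\<lambda>z t. deriv (\<lambda>z. f z t) z) z)) (at z within ball z r)"
  proof (rule leibniz_rule_field_derivative)
    fix x t assume "x \<in> ball z r" "t \<in> cbox a b"
    thus "((\<lambda>z. f z t) has_field_derivative deriv (\<lambda>z. f z t) x) (at x within ball z r)"
      using hol[of t] r U holomorphic_derivI[of "\<lambda>z. f z t" U x] by auto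
  next
    fix x assume "x \<in> ball z r"
    thus "f x integrable_on cbox a b"
      using continuous_on_param_slice[OF cont] r by (auto intro!: integrable_continuous_real)
  next
    show "continuous_on (ball z r \<times> cbox a b) (\<lambda>(z, t). deriv (\<lambda>z. f z t) z)"
      using r by (intro continuous_on_subset[OF continuous_on_deriv_param[OF U cont hol]]) auto
  qed (use r in auto)
  moreover have "at z within ball z r = at z" using r by (intro at_within_open) auto
  ultimately show ?thesis by (simp only: cbox_interval)
qed

corollary holomorphic_on_integral_param:
  fixes f :: "complex \<Rightarrow> real \<Rightarrow> complex"
  assumes "open U"
    and "continuous_on (U \<times> {a..b}) (\<lambda>(z, t). f z t)"
    and "\<And>t. t \<in> {a..b} \<Longrightarrow> (\<lambda>z. f z t) holomorphic_on U"
  shows "(\<lambda>z. integral {a..b} (f z)) holomorphic_on U"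
  using has_field_derivative_integral_param[OF assms]
  unfolding holomorphic_on_def field_differentiable_def
  by (blast intro: has_field_derivative_at_within)

section \<open>The Beta integral with complex parameters\<close>

lemma continuous_on_Beta_integrand:
  "continuous_on ({z. Re z > 1} \<times> {0..1}) (\<lambda>(z, t). complex_of_real t powr (z - 1))"
  "continuous_on ({z. Re z > 1} \<times> {0..1}) (\<lambda>(z, t). complex_of_real (1 - t) powr (z - 1))"
  unfolding split_beta
  by (rule continuous_on_powr_complex; (auto intro!: continuous_intros)[])+

lemma holomorphic_on_powr_const_base:
  assumes "x \<ge> 0"
  shows "(\<lambda>z. complex_of_real x powr (z - 1)) holomorphic_on {z. Re z > 1}"
  by (cases "x = 0") (auto simp: powr_def intro!: holomorphic_intros)

text \<open>The ray x > 1 accumulates at 2, an interior point of the half-plane, so the identity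
  theorem applies.\<close>

lemma analytic_continuation_from_reals:
  assumes "f holomorphic_on {z. Re z > 1}" "g holomorphic_on {z. Re z > 1}"
    and eq: "\<And>x::real. x > 1 \<Longrightarrow> f (of_real x) = g (of_real x)" and z: "Re z > 1"
  shows "f z = g z"
proof -
  have lim: "(2::complex) islimpt complex_of_real ` {1<..}"
  proof (rule islimpt_approachable[THEN iffD2], intro allI impI)
    fix e :: real assume e: "e > 0"
    show "\<exists>x'\<in>complex_of_real ` {1<..}. x' \<noteq> 2 \<and> dist x' 2 < e"
    proof (intro bexI[of _ "complex_of_real (2 + e/2)"] conjI)
      show "complex_of_real (2 + e/2) \<noteq> 2" using e by (simp add: complex_eq_iff)
      have "complex_of_real (2 + e/2) - 2 = complex_of_real (e/2)" by simp
      thus "dist (complex_of_real (2 + e/2)) 2 < e" using e 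
        by (simp only: dist_norm norm_of_real)
      show "complex_of_real (2 + e/2) \<in> complex_of_real ` {1<..}" using e by (intro imageI) simp
    qed
  qed
  have "f z - g z = 0"
  proof (rule analytic_continuation[of "\<lambda>z. f z - g z" "{z. Re z > 1}" "complex_of_real ` {1<..}" 2])
    show "(\<lambda>z. f z - g z) holomorphic_on {z. Re z > 1}" using assms by (intro holomorphic_intros)
    show "open {z. Re z > 1}" by (simp add: open_halfspace_Re_gt)
    show "connected {z. Re z > 1}" by (intro convex_connected convex_halfspace_Re_gt)
  qed (use lim z eq in auto)
  thus ?thesis by simp
qed

text \<open>The real formula is continued in one variable at a time: in \<open>b\<close> for real
  \<open>a\<close>, then in \<open>a\<close> for the given complex \<open>b\<close>. Real parts
  above 1 rather than above 0 keep the integrand continuous on the closed interval, so no improper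
  integral arises.\<close>

lemma has_integral_Beta_complex:
  fixes a b :: complex
  assumes a: "Re a > 1" and b: "Re b > 1"
  shows "((\<lambda>t. of_real t powr (a - 1) * of_real (1 - t) powr (b - 1)) has_integral Beta a b) {0..1}"
proof -
  let ?h = "\<lambda>a b t. complex_of_real t powr (a - 1) * complex_of_real (1 - t) powr (b - 1)"
  let ?F = "\<lambda>a b. integral {0..1} (?h a b)"
  let ?H = "{z. Re z > 1}"
  have op: "open ?H" by (simp add: open_halfspace_Re_gt)
  have c1: "continuous_on {0..1} (\<lambda>t. complex_of_real t powr (z - 1))" if "Re z > 1" for z
    using continuous_on_param_slice[OF continuous_on_Beta_integrand(1), of z] that by simp
  have c2: "continuous_on {0..1} (\<lambda>t. complex_of_real (1 - t) powr (z - 1))" if "Re z > 1" for z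
    using continuous_on_param_slice[OF continuous_on_Beta_integrand(2), of z] that by simp
  have int: "?h a b integrable_on {0..1}" if "Re a > 1" "Re b > 1" for a b
    using that by (intro integrable_continuous_real continuous_on_mult c1 c2)
  have hol2: "?F a holomorphic_on ?H" if "Re a > 1" for a
  proof (rule holomorphic_on_integral_param[OF op])
    have "continuous_on (?H \<times> {0..1}) (\<lambda>p. complex_of_real (snd p) powr (a - 1))"
      by (rule continuous_on_compose2[OF c1[OF that]]) (auto intro!: continuous_intros)
    from continuous_on_mult[OF this continuous_on_Beta_integrand(2)]
    show "continuous_on (?H \<times> {0..1}) (\<lambda>(b, t). ?h a b t)" by (simp add: split_beta)
  qed (intro holomorphic_intros holomorphic_on_powr_const_base, auto)
  have hol1: "(\<lambda>a. ?F a b) holomorphic_on ?H" if "Re b > 1" for b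
  proof (rule holomorphic_on_integral_param[OF op])
    have "continuous_on (?H \<times> {0..1}) (\<lambda>p. complex_of_real (1 - snd p) powr (b - 1))"
      by (rule continuous_on_compose2[OF c2[OF that]]) (auto intro!: continuous_intros)
    from continuous_on_mult[OF continuous_on_Beta_integrand(1) this]
    show "continuous_on (?H \<times> {0..1}) (\<lambda>(a, t). ?h a b t)" by (simp add: split_beta)
  qed (intro holomorphic_intros holomorphic_on_powr_const_base, auto)
  have np: "z \<notin> \<int>\<^sub>\<le>\<^sub>0" if "Re z > 1" for z using that by (auto elim!: nonpos_Ints_cases)
  have real: "?F (of_real x) (of_real y) = Beta (of_real x) (of_real y)" if "x > 1" "y > 1" for x y :: real
  proof -
    have "((\<lambda>t. complex_of_real (t powr (x - 1) * (1 - t) powr (y - 1))) has_integral complex_of_real (Beta x y)) {0..1}"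
      using has_integral_Beta_real[of x y] that by (intro has_integral_of_real) auto
    hence "(?h (of_real x) (of_real y) has_integral complex_of_real (Beta x y)) {0..1}"
    proof (rule has_integral_eq[rotated])
      fix t :: real assume t: "t \<in> {0..1}"
      have "complex_of_real t powr (of_real x - 1) = of_real (t powr (x - 1))"
        using t powr_of_real[of t "x - 1"] by simp
      moreover have "complex_of_real (1 - t) powr (of_real y - 1) = of_real ((1 - t) powr (y - 1))"
        using t powr_of_real[of "1 - t" "y - 1"] by simp
      ultimately show "complex_of_real (t powr (x - 1) * (1 - t) powr (y - 1)) = ?h (of_real x) (of_real y) t"
        by (simp only: of_real_mult)
    qed
    thus ?thesis by (simp add: Beta_complex_of_real integral_unique)
  qed
  have "?F (of_real x) b = Beta (of_real x) b" if "x > 1" for x :: real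
    by (rule analytic_continuation_from_reals[OF hol2 _ _ b])
       (use that real np in \<open>auto intro!: holomorphic_intros\<close>)
  hence "?F a b = Beta a b"
    by (intro analytic_continuation_from_reals[OF hol1[OF b] _ _ a])
       (use b np in \<open>auto intro!: holomorphic_intros\<close>)
  thus ?thesis using int[OF a b] by (simp add: has_integral_iff)
qed

section \<open>The regularized hypergeometric function\<close>

definition slit_plane :: "complex set" where
  "slit_plane = - (complex_of_real ` {1..})"

lemma slit_plane_iff: "w \<in> slit_plane \<longleftrightarrow> Im w \<noteq> 0 \<or> Re w < 1"
proof -
  have "w \<in> complex_of_real ` {1..} \<longleftrightarrow> Im w = 0 \<and> Re w \<ge> 1"
    by (auto simp: image_iff complex_eq_iff)
  thus ?thesis by (auto simp: slit_plane_def)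
qed

lemma slit_plane_eq: "slit_plane = - {w. Im w = 0 \<and> Re w \<ge> 1}"
  by (auto simp: slit_plane_iff)

lemma open_slit_plane: "open slit_plane"
proof -
  have "closed {w. Im w = 0 \<and> Re w \<ge> 1}"
    by (intro closed_Collect_conj closed_Collect_eq closed_Collect_le continuous_intros)
  thus ?thesis by (simp add: slit_plane_eq open_closed)
qed

text \<open>Segments to 0 avoid the cut. Besides connectedness this gives global primitives, on
  which the simultaneous lowering of all three parameters rests.\<close>

lemma starlike_slit_plane: "starlike slit_plane"
  unfolding starlike_def
proof (intro bexI[of _ 0] ballI subsetI)
  fix x y assume x: "x \<in> slit_plane" and y: "y \<in> closed_segment 0 x"
  then obtain u where u: "0 \<le> u" "u \<le> 1" "y = of_real u * x"
    by (auto simp: closed_segment_def scaleR_conv_of_real)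
  have "u * Re x < 1" if "Re x < 1"
  proof (cases "Re x \<le> 0")
    case True thus ?thesis using u by (smt (verit) mult_nonneg_nonpos)
  next
    case False thus ?thesis using u that by (smt (verit) mult_left_le_one_le)
  qed
  moreover have "u = 0 \<or> Im y \<noteq> 0" if "Im x \<noteq> 0" using that u by auto
  ultimately show "y \<in> slit_plane" using x u by (auto simp: slit_plane_iff)
qed (auto simp: slit_plane_iff)

lemma connected_slit_plane: "connected slit_plane"
  using starlike_slit_plane by (rule starlike_imp_connected)

lemma norm_less_1_imp_slit_plane: "norm w < 1 \<Longrightarrow> w \<in> slit_plane"
  using complex_Re_le_cmod[of w] by (auto simp: slit_plane_iff)

definition hyp_coeff :: "complex \<Rightarrow> complex \<Rightarrow> complex \<Rightarrow> nat \<Rightarrow> complex" where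
  "hyp_coeff a b c n = pochhammer a n * pochhammer b n * rGamma (c + of_nat n) / fact n"

text \<open>The property of which \<open>hyperF_reg\<close> chooses a witness. Until existence is
  known the choice says nothing, so the lemmas leading to \<open>ex_hyperF_reg\<close> speak about
  an arbitrary \<open>g\<close>.\<close>

definition is_hyperF_reg :: "complex \<Rightarrow> complex \<Rightarrow> complex \<Rightarrow> (complex \<Rightarrow> complex) \<Rightarrow> bool" where
  "is_hyperF_reg a b c g \<longleftrightarrow> g holomorphic_on slit_plane \<and>
     (\<forall>w. norm w < 1 \<longrightarrow> (\<lambda>n. hyp_coeff a b c n * w ^ n) sums g w)"

lemma notin_nonpos_Ints_if_Re_pos: "Re z > 0 \<Longrightarrow> z \<notin> \<int>\<^sub>\<le>\<^sub>0"
  by (auto elim!: nonpos_Ints_cases)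

lemma one_minus_mult_notin_nonpos_Reals:
  assumes "w \<in> slit_plane" "0 \<le> t" "t \<le> 1"
  shows "1 - w * complex_of_real t \<notin> \<real>\<^sub>\<le>\<^sub>0"
proof
  assume "1 - w * complex_of_real t \<in> \<real>\<^sub>\<le>\<^sub>0"
  hence "1 \<le> Re w * t" "Im w * t = 0" by (auto simp: complex_nonpos_Reals_iff)
  moreover have "Re w * t < 1" if "Re w < 1"
    using that assms by (smt (verit) mult_left_le mult_nonneg_nonpos2)
  ultimately show False using assms by (auto simp: slit_plane_iff)
qed

section \<open>Existence: Euler's integral and the lowering of parameters\<close>

lemma binomial_series_pochhammer:
  assumes "norm w < 1"
  shows "(\<lambda>n. pochhammer a n / fact n * w ^ n) sums (1 - w) powr (- a :: complex)"
proof -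
  have "(\<lambda>n. ((-a) gchoose n) * (-w) ^ n) sums (1 + (-w)) powr (-a)"
    using assms by (intro gen_binomial_complex) auto
  moreover have "((-a) gchoose n) * (-w) ^ n = pochhammer a n / fact n * w ^ n" for n
    by (simp add: gbinomial_pochhammer power_mult_distrib[symmetric])
  ultimately show ?thesis by simp
qed

lemma summable_norm_binomial_series:
  assumes "norm w < 1"
  shows "summable (\<lambda>n. norm (pochhammer a n / fact n * w ^ n :: complex))"
proof -
  obtain r where r: "norm w < r" "r < 1" using assms dense by blast
  have "norm (complex_of_real r) < 1" using r norm_ge_zero[of w] by (simp del: norm_ge_zero)
  from sums_summable[OF binomial_series_pochhammer[OF this, of a]]
  show ?thesis by (rule powser_insidea) (use r norm_ge_zero[of w] in \<open>simp del: norm_ge_zero\<close>)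
qed

text \<open>Euler's integral: the binomial series of \<open>(1 - w * t) powr (- a)\<close> is
  integrated against the Beta weight term by term, and 1 / (\<Gamma>(b) \<Gamma>(c - b)) normalizes.
  The integral is holomorphic on the whole slit plane because 1 - w t never meets the branch cut of
  the power for t between 0 and 1.\<close>

lemma is_hyperF_reg_Euler:
  assumes b: "Re b > 1" and cb: "Re (c - b) > 1"
  shows "\<exists>g. is_hyperF_reg a b c g"
proof -
  define m where "m t = complex_of_real t powr (b - 1) * complex_of_real (1 - t) powr (c - b - 1)" for t
  have cm: "continuous_on {0..1} m"
    unfolding m_def using continuous_on_param_slice[OF continuous_on_Beta_integrand(1), of b] b
      continuous_on_param_slice[OF continuous_on_Beta_integrand(2), of "c-b"] cb
    by (intro continuous_on_mult) auto
  define I where "I w = integral {0..1} (\<lambda>t. m t * (1 - w * of_real t) powr (-a))" for w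
  have "I holomorphic_on slit_plane" unfolding I_def
  proof (rule holomorphic_on_integral_param[OF open_slit_plane])
    have "continuous_on (slit_plane \<times> {0..1}) (\<lambda>p. m (snd p))"
      by (rule continuous_on_compose2[OF cm]) (auto intro!: continuous_intros)
    moreover have "continuous_on (slit_plane \<times> {0..1}) (\<lambda>p. (1 - fst p * of_real (snd p)) powr (-a))"
    proof (rule continuous_on_powr_complex)
      show "slit_plane \<times> {0..1} \<subseteq> {p. 0 \<le> Re (1 - fst p * complex_of_real (snd p)) \<or>
          Im (1 - fst p * complex_of_real (snd p)) \<noteq> 0}"
      proof
        fix p assume "p \<in> slit_plane \<times> {0..1::real}"
        hence "1 - fst p * complex_of_real (snd p) \<notin> \<real>\<^sub>\<le>\<^sub>0"
          by (intro one_minus_mult_notin_nonpos_Reals) auto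
        thus "p \<in> {p. 0 \<le> Re (1 - fst p * complex_of_real (snd p)) \<or> Im (1 - fst p * complex_of_real (snd p)) \<noteq> 0}"
          by (auto simp: complex_nonpos_Reals_iff)
      qed
      fix p assume "p \<in> slit_plane \<times> {0..1::real}"
      hence "1 - fst p * complex_of_real (snd p) \<notin> \<real>\<^sub>\<le>\<^sub>0"
        by (intro one_minus_mult_notin_nonpos_Reals) auto
      moreover assume "1 - fst p * complex_of_real (snd p) = 0"
      ultimately show "0 < Re (- a)" by simp
    qed (intro continuous_intros)+
    ultimately show "continuous_on (slit_plane \<times> {0..1}) (\<lambda>(w, t). m t * (1 - w * of_real t) powr (-a))"
      unfolding split_beta by (intro continuous_on_mult) auto
  next
    fix t :: real assume "t \<in> {0..1}"
    thus "(\<lambda>w. m t * (1 - w * of_real t) powr (-a)) holomorphic_on slit_plane"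
      by (intro holomorphic_intros) (use one_minus_mult_notin_nonpos_Reals in force)
  qed
  moreover have "(\<lambda>n. hyp_coeff a b c n * w ^ n) sums (rGamma b * rGamma (c - b) * I w)" if w: "norm w < 1" for w
  proof -
    define p where "p n = pochhammer a n / fact n * w ^ n" for n
    have cp: "continuous_on {0..1} (\<lambda>t. m t * (p n * of_real t ^ n))" for n
      by (intro continuous_intros cm)
    have mb: "norm (m t) \<le> 1" if t: "t \<in> {0..1}" for t
    proof -
      have "norm (m t) = t powr (Re b - 1) * (1 - t) powr (Re (c - b) - 1)"
        using t by (simp add: m_def norm_mult norm_powr_real_powr)
      also have "\<dots> \<le> 1 * 1"
        using t b cb by (intro mult_mono powr_le1) auto
      finally show ?thesis by simp
    qed
    \<comment> \<open>The weight has modulus at most 1, so the binomial terms at t = 1 form a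
      majorant independent of t.\<close>
    have "uniform_limit {0..1} (\<lambda>n t. \<Sum>k<n. m t * (p k * of_real t ^ k)) (\<lambda>t. \<Sum>k. m t * (p k * of_real t ^ k)) sequentially"
    proof (rule Weierstrass_m_test)
      show "summable (\<lambda>n. norm (p n))" unfolding p_def by (rule summable_norm_binomial_series[OF w])
      fix n and t :: real assume t: "t \<in> {0..1}"
      have "norm (m t * (p n * of_real t ^ n)) \<le> 1 * (norm (p n) * 1)"
        unfolding norm_mult using t mb[OF t] by (intro mult_mono) (auto simp: norm_power power_le_one)
      thus "norm (m t * (p n * of_real t ^ n)) \<le> norm (p n)" by simp
    qed
    then obtain L J where L: "\<And>n. ((\<lambda>t. \<Sum>k<n. m t * (p k * of_real t ^ k)) has_integral L n) {0..1}"
      and J: "((\<lambda>t. \<Sum>k. m t * (p k * of_real t ^ k)) has_integral J) {0..1}" and LJ: "L \<longlonglongrightarrow> J"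
      by (rule uniform_limit_integral) (intro continuous_intros cm, auto)
    have "(\<Sum>k. m t * (p k * of_real t ^ k)) = m t * (1 - w * of_real t) powr (-a)" if t: "t \<in> {0..1}" for t
    proof -
      have "norm (w * of_real t) \<le> norm w" unfolding norm_mult using t by (intro mult_left_le) auto
      hence "norm (w * of_real t) < 1" using w by simp
      from sums_mult[OF binomial_series_pochhammer[OF this, of a], of "m t"] show ?thesis
        by (intro sums_unique[symmetric]) (simp add: p_def power_mult_distrib mult_ac)
    qed
    hence JI: "J = I w" using J unfolding I_def
      by (metis (no_types, lifting) integral_cong integral_unique)
    have trm: "((\<lambda>t. m t * (p k * of_real t ^ k)) has_integral p k * Beta (b + of_nat k) (c - b)) {0..1}" for k
    proof -
      have "((\<lambda>t. p k * (of_real t powr (b + of_nat k - 1) * of_real (1 - t) powr (c - b - 1))) has_integral p k * Beta (b + of_nat k) (c - b)) {0..1}"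
        using b cb by (intro has_integral_mult_right has_integral_Beta_complex) auto
      thus ?thesis
      proof (rule has_integral_eq[rotated])
        fix t :: real assume t: "t \<in> {0..1}"
        have "complex_of_real t powr (b + of_nat k - 1) = of_real t powr (b - 1) * of_real t ^ k"
        proof (cases "t = 0")
          case False
          have "complex_of_real t powr (b + of_nat k - 1) = of_real t powr (b - 1) * of_real t powr of_nat k"
            by (simp add: powr_add[symmetric] algebra_simps)
          thus ?thesis using False by (simp add: powr_nat)
        qed auto
        thus "p k * (of_real t powr (b + of_nat k - 1) * of_real (1 - t) powr (c - b - 1)) = m t * (p k * of_real t ^ k)"
          by (simp add: m_def mult_ac)
      qed
    qed
    have "L = (\<lambda>n. \<Sum>k<n. p k * Beta (b + of_nat k) (c - b))"
      by (intro ext, rule has_integral_unique[OF L]) (intro has_integral_sum trm, auto)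
    with LJ JI have "(\<lambda>k. p k * Beta (b + of_nat k) (c - b)) sums I w"
      by (simp add: sums_def)
    hence "(\<lambda>k. rGamma b * rGamma (c - b) * (p k * Beta (b + of_nat k) (c - b))) sums (rGamma b * rGamma (c - b) * I w)"
      by (rule sums_mult)
    moreover have "rGamma b * rGamma (c - b) * (p k * Beta (b + of_nat k) (c - b)) = hyp_coeff a b c k * w ^ k" for k
    proof -
      have "b \<notin> \<int>\<^sub>\<le>\<^sub>0" "c - b \<notin> \<int>\<^sub>\<le>\<^sub>0" using b cb by (auto intro!: notin_nonpos_Ints_if_Re_pos)
      hence g: "Gamma b \<noteq> 0" "Gamma (c - b) \<noteq> 0" "pochhammer b k = Gamma (b + of_nat k) / Gamma b"
        by (auto simp: Gamma_eq_zero_iff pochhammer_Gamma)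
      have i: "rGamma b = 1 / Gamma b" "rGamma (c - b) = 1 / Gamma (c - b)"
        by (simp_all add: rGamma_inverse_Gamma divide_inverse)
      show ?thesis
        unfolding hyp_coeff_def p_def Beta_altdef i g(3) using g(1,2) by (simp add: field_simps)
    qed
    ultimately show ?thesis by simp
  qed
  ultimately show ?thesis unfolding is_hyperF_reg_def
    by (intro exI[of _ "\<lambda>w. rGamma b * rGamma (c - b) * I w"]) (auto intro!: holomorphic_intros)
qed

text \<open>The Euler operator w d/dw acts on coefficients as multiplication by n, so relations
  between coefficients that are polynomial in n become differential relations. The lowering of
  \<open>c\<close> and the hypergeometric equation are obtained in this way.\<close>

lemma power_series_shift_deriv:
  fixes f :: "nat \<Rightarrow> complex"
  assumes sums: "\<And>w. norm w < 1 \<Longrightarrow> (\<lambda>n. f n * w ^ n) sums g w"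
    and hol: "g holomorphic_on slit_plane" and w: "norm w < 1"
  shows "(\<lambda>n. of_nat n * f n * w ^ n) sums (w * deriv g w)"
proof -
  have "(g has_field_derivative deriv g w) (at w)"
    using hol w open_slit_plane norm_less_1_imp_slit_plane by (intro holomorphic_derivI) auto
  hence "(\<lambda>n. diffs f n * w ^ n) sums deriv g w"
    using w by (intro termdiffs_sums_strong[OF sums])
  hence "(\<lambda>n. w * (diffs f n * w ^ n)) sums (w * deriv g w)" by (rule sums_mult)
  hence "(\<lambda>n. of_nat (Suc n) * f (Suc n) * w ^ Suc n) sums (w * deriv g w)"
    by (simp add: diffs_def mult_ac)
  hence "(\<lambda>n. of_nat n * f n * w ^ n) sums (w * deriv g w + of_nat 0 * f 0 * w ^ 0)"
    by (rule sums_Suc)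
  thus ?thesis by simp
qed

text \<open>Since 1/\<Gamma>(c + n) = (c + n)/\<Gamma>(c + 1 + n), also at the poles of \<Gamma>,
  the operator w d/dw + c lowers \<open>c\<close> by one.\<close>

lemma is_hyperF_reg_lower_c:
  assumes "is_hyperF_reg a b (c + 1) g"
  shows "is_hyperF_reg a b c (\<lambda>w. w * deriv g w + c * g w)"
  unfolding is_hyperF_reg_def
proof (intro conjI allI impI)
  have hol: "g holomorphic_on slit_plane"
    and sums: "\<And>w. norm w < 1 \<Longrightarrow> (\<lambda>n. hyp_coeff a b (c + 1) n * w ^ n) sums g w"
    using assms by (auto simp: is_hyperF_reg_def)
  show "(\<lambda>w. w * deriv g w + c * g w) holomorphic_on slit_plane"
    by (intro holomorphic_intros hol open_slit_plane)
  fix w :: complex assume w: "norm w < 1"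
  have "(\<lambda>n. of_nat n * hyp_coeff a b (c + 1) n * w ^ n + c * (hyp_coeff a b (c + 1) n * w ^ n)) sums (w * deriv g w + c * g w)"
    using w by (intro sums_add sums_mult sums power_series_shift_deriv[OF sums hol])
  moreover have "of_nat n * hyp_coeff a b (c + 1) n * w ^ n + c * (hyp_coeff a b (c + 1) n * w ^ n) = hyp_coeff a b c n * w ^ n" for n
  proof -
    have "rGamma (c + of_nat n) = (c + of_nat n) * rGamma (c + 1 + of_nat n)"
      using rGamma_plus1[of "c + of_nat n"] by (simp add: add_ac)
    thus ?thesis by (simp add: hyp_coeff_def field_simps)
  qed
  ultimately show "(\<lambda>n. hyp_coeff a b c n * w ^ n) sums (w * deriv g w + c * g w)" by simp
qed

lemma hyp_coeff_Suc_shift: "of_nat (Suc n) * hyp_coeff a b c (Suc n) = a * b * hyp_coeff (a + 1) (b + 1) (c + 1) n"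
proof -
  define k :: complex where "k = of_nat (Suc n)"
  have k0: "k \<noteq> 0" unfolding k_def by (simp only: of_nat_eq_0_iff)
  have c: "c + of_nat (Suc n) = c + 1 + of_nat n" by simp
  have f: "fact (Suc n) = k * fact n" by (simp add: k_def)
  show ?thesis unfolding hyp_coeff_def pochhammer_rec c f unfolding k_def[symmetric] using k0
    by (simp add: field_simps)
qed

text \<open>The derivative of the wanted series is a * b times the given function, so its
  continuation is obtained from a primitive on the starlike slit plane.\<close>

lemma is_hyperF_reg_lower_abc:
  assumes "is_hyperF_reg (a + 1) (b + 1) (c + 1) g"
  shows "\<exists>h. is_hyperF_reg a b c h"
proof -
  have hol: "g holomorphic_on slit_plane"
    and sums: "\<And>w. norm w < 1 \<Longrightarrow> (\<lambda>n. hyp_coeff (a + 1) (b + 1) (c + 1) n * w ^ n) sums g w"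
    using assms by (auto simp: is_hyperF_reg_def)
  let ?c = "hyp_coeff a b c"
  obtain G where G: "\<And>x. x \<in> slit_plane \<Longrightarrow> (G has_field_derivative g x) (at x)"
    using holomorphic_starlike_primitive[of slit_plane g "{}"] hol starlike_slit_plane open_slit_plane
    by (auto simp: holomorphic_on_imp_continuous_on holomorphic_on_imp_differentiable_at)
  have summ: "summable (\<lambda>n. ?c n * w ^ n)" if w: "norm w < 1" for w
  proof -
    obtain r where r: "norm w < r" "r < 1" using w dense by blast
    have "norm (complex_of_real r) < 1" using r norm_ge_zero[of w] by (simp del: norm_ge_zero)
    from sums_summable[OF sums[OF this]]
    have "summable (\<lambda>n. norm (hyp_coeff (a + 1) (b + 1) (c + 1) n * w ^ n))"
      by (rule powser_insidea) (use r norm_ge_zero[of w] in \<open>simp del: norm_ge_zero\<close>)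
    hence s: "summable (\<lambda>n. norm (a * b * w) * norm (hyp_coeff (a + 1) (b + 1) (c + 1) n * w ^ n))"
      by (rule summable_mult)
    \<comment> \<open>Integration divides by n + 1, which only helps: the series of \<open>g\<close>
      dominates.\<close>
    have "summable (\<lambda>n. ?c (Suc n) * w ^ Suc n)"
    proof (rule summable_comparison_test'[OF s, of 0])
      fix n :: nat
      have "norm (?c (Suc n) * w ^ Suc n) \<le> norm (of_nat (Suc n) * ?c (Suc n) * w ^ Suc n)"
        unfolding norm_mult norm_of_nat mult.assoc
        using mult_right_mono[of 1 "real (Suc n)" "norm (?c (Suc n)) * norm (w ^ Suc n)"] by simp
      also have "of_nat (Suc n) * ?c (Suc n) * w ^ Suc n = (a * b * w) * (hyp_coeff (a + 1) (b + 1) (c + 1) n * w ^ n)"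
        by (simp only: hyp_coeff_Suc_shift power_Suc mult_ac)
      finally show "norm (?c (Suc n) * w ^ Suc n) \<le> norm (a * b * w) * norm (hyp_coeff (a + 1) (b + 1) (c + 1) n * w ^ n)"
        by (simp only: norm_mult)
    qed
    thus ?thesis by (subst (asm) summable_Suc_iff)
  qed
  define f where "f w = (\<Sum>n. ?c n * w ^ n)" for w
  have fd: "(f has_field_derivative a * b * g w) (at w)" if w: "norm w < 1" for w
  proof -
    obtain r where r: "norm w < r" "r < 1" using w dense by blast
    have r': "norm (complex_of_real r) < 1" "norm w < norm (complex_of_real r)" using r norm_ge_zero[of w] by (simp_all del: norm_ge_zero)
    have "(f has_field_derivative (\<Sum>n. diffs ?c n * w ^ n)) (at w)"
      unfolding f_def by (rule termdiffs_strong[OF summ[OF r'(1)] r'(2)])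
    moreover have "diffs ?c n * w ^ n = a * b * (hyp_coeff (a + 1) (b + 1) (c + 1) n * w ^ n)" for n
      unfolding diffs_def by (simp only: hyp_coeff_Suc_shift mult.assoc)
    moreover have "(\<Sum>n. a * b * (hyp_coeff (a + 1) (b + 1) (c + 1) n * w ^ n)) = a * b * g w"
      using sums_mult[OF sums[OF w], of "a * b"] by (simp only: sums_iff)
    ultimately show ?thesis by simp
  qed
  \<comment> \<open>The additive constant makes \<open>h\<close> agree with the series at 0;
    equality of the derivatives does the rest on the unit disc.\<close>
  define h where "h w = a * b * (G w - G 0) + f 0" for w
  have "(h has_field_derivative a * b * g w) (at w)" if "w \<in> slit_plane" for w
    unfolding h_def using G[OF that] by (auto intro!: derivative_eq_intros)
  hence hh: "h holomorphic_on slit_plane" and hd: "\<And>w. w \<in> slit_plane \<Longrightarrow> (h has_field_derivative a * b * g w) (at w)"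
    using open_slit_plane by (auto simp: holomorphic_on_open)
  have "\<exists>k. \<forall>w\<in>ball 0 1. h w - f w = k"
  proof (rule has_field_derivative_zero_constant)
    fix w :: complex assume "w \<in> ball 0 1"
    hence "norm w < 1" by simp
    thus "((\<lambda>w. h w - f w) has_field_derivative 0) (at w within ball 0 1)"
      using DERIV_diff[OF hd[OF norm_less_1_imp_slit_plane[of w]] fd[of w]]
      by (auto intro: has_field_derivative_at_within)
  qed simp
  then obtain k where k: "\<And>w. norm w < 1 \<Longrightarrow> h w - f w = k" by auto
  have "k = 0" using k[of 0] by (simp add: h_def)
  hence "h w = f w" if "norm w < 1" for w using k[OF that] by simp
  hence "(\<lambda>n. ?c n * w ^ n) sums h w" if "norm w < 1" for w
    using summ[OF that] that by (simp add: f_def summable_sums)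
  thus ?thesis using hh unfolding is_hyperF_reg_def by blast
qed

text \<open>Euler's integral needs Re b > 1 and Re (c - b) > 1. Raising all three parameters by k
  achieves the first without changing c - b, and raising \<open>c\<close> by a further m achieves
  the second. The two lowering lemmas then undo this, m times and k times.\<close>

lemma ex_hyperF_reg: "\<exists>g. is_hyperF_reg a b c g"
proof -
  obtain k :: nat where k: "1 - Re b < real k" using reals_Archimedean2 by blast
  obtain m :: nat where m: "1 - Re (c - b) < real m" using reals_Archimedean2 by blast
  have "\<exists>g. is_hyperF_reg (a + of_nat k) (b + of_nat k) (c + of_nat k + of_nat m) g"
    using k m by (intro is_hyperF_reg_Euler) auto
  hence "\<exists>g. is_hyperF_reg (a + of_nat k) (b + of_nat k) (c + of_nat k) g"
  proof (induction m)
    case (Suc m)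
    have "c + of_nat k + of_nat (Suc m) = c + of_nat k + of_nat m + 1" by simp
    with Suc show ?case using is_hyperF_reg_lower_c by metis
  qed simp
  thus ?thesis
  proof (induction k)
    case (Suc k)
    have "x + of_nat (Suc k) = x + of_nat k + 1" for x :: complex by simp
    with Suc show ?case using is_hyperF_reg_lower_abc by metis
  qed simp
qed

section \<open>Power series and differential equation of the regularized function\<close>

lemma is_hyperF_reg_hyperF_reg: "is_hyperF_reg a b c (hyperF_reg a b c)"
proof -
  have "hyperF_reg a b c = (SOME g. is_hyperF_reg a b c g)"
    by (simp add: hyperF_reg_def is_hyperF_reg_def hyp_coeff_def slit_plane_def)
  thus ?thesis using someI_ex[OF ex_hyperF_reg[of a b c]] by simp
qed

lemma holomorphic_on_hyperF_reg: "hyperF_reg a b c holomorphic_on slit_plane"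
  and sums_hyperF_reg: "norm w < 1 \<Longrightarrow> (\<lambda>n. hyp_coeff a b c n * w ^ n) sums hyperF_reg a b c w"
  using is_hyperF_reg_hyperF_reg[of a b c] by (auto simp: is_hyperF_reg_def)

text \<open>Kept free of division because c + n may vanish: later \<open>c\<close> is 1 - \<mu>, a
  nonpositive integer whenever \<mu> is a positive one.\<close>

lemma hyp_coeff_Suc:
  "of_nat (Suc n) * (c + of_nat n) * hyp_coeff a b c (Suc n) = (a + of_nat n) * (b + of_nat n) * hyp_coeff a b c n"
proof -
  define k :: complex where "k = of_nat (Suc n)"
  have "k \<noteq> 0" unfolding k_def by (simp only: of_nat_eq_0_iff)
  moreover have "fact (Suc n) = k * fact n" by (simp add: k_def)
  moreover have "rGamma (c + of_nat n) = (c + of_nat n) * rGamma (c + of_nat (Suc n))"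
    using rGamma_plus1[of "c + of_nat n"] by (simp add: add_ac)
  ultimately show ?thesis unfolding hyp_coeff_def pochhammer_rec' k_def[symmetric]
    by (simp add: field_simps)
qed

text \<open>On the unit disc the equation is the coefficient recurrence, summed; the identity
  theorem extends it to the connected slit plane.\<close>

lemma hyperF_reg_ODE:
  fixes a b c w :: complex
  defines "F \<equiv> hyperF_reg a b c"
  assumes w: "w \<in> slit_plane"
  shows "w * (1 - w) * deriv (deriv F) w + (c - (a + b + 1) * w) * deriv F w - a * b * F w = 0"
proof -
  have hol: "F holomorphic_on slit_plane" unfolding F_def by (rule holomorphic_on_hyperF_reg)
  have hol': "deriv F holomorphic_on slit_plane" by (intro holomorphic_deriv hol open_slit_plane)
  let ?c = "hyp_coeff a b c"
  have sums: "(\<lambda>n. ?c n * w ^ n) sums F w" if "norm w < 1" for w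
    unfolding F_def using that by (rule sums_hyperF_reg)
  have sums': "(\<lambda>n. diffs ?c n * w ^ n) sums deriv F w" if w: "norm w < 1" for w
    using w by (intro termdiffs_sums_strong[OF sums] holomorphic_derivI[OF hol open_slit_plane] norm_less_1_imp_slit_plane) auto
  have dF: "deriv (\<lambda>w. w * deriv F w) w = deriv F w + w * deriv (deriv F) w" if w: "w \<in> slit_plane" for w
    using holomorphic_derivI[OF hol' open_slit_plane w, of UNIV]
    by (intro DERIV_imp_deriv) (auto intro!: derivative_eq_intros)
  let ?L = "\<lambda>w. w * (1 - w) * deriv (deriv F) w + (c - (a + b + 1) * w) * deriv F w - a * b * F w"
  have disc: "?L w = 0" if w: "w \<in> ball 0 1" for w
  proof -
    have w': "norm w < 1" and ws: "w \<in> slit_plane" using w norm_less_1_imp_slit_plane[of w] by auto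
    have A: "(\<lambda>n. of_nat n * diffs ?c n * w ^ n) sums (w * deriv (deriv F) w)"
      by (rule power_series_shift_deriv[OF sums' hol' w'])
    have B: "(\<lambda>n. of_nat n * ?c n * w ^ n) sums (w * deriv F w)"
      by (rule power_series_shift_deriv[OF sums hol w'])
    have C: "(\<lambda>n. of_nat n * (of_nat n * ?c n) * w ^ n) sums (w * deriv (\<lambda>w. w * deriv F w) w)"
      by (rule power_series_shift_deriv[OF power_series_shift_deriv[OF sums hol] _ w'])
         (auto intro!: holomorphic_intros hol')
    \<comment> \<open>With \<theta> = w d/dw the equation reads w F'' + c F' = \<theta>\<theta>F +
      (a + b) \<theta>F + a b F, and both sides have known coefficients.\<close>
    have "(\<lambda>n. (of_nat n * diffs ?c n * w ^ n + c * (diffs ?c n * w ^ n)) -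
       (of_nat n * (of_nat n * ?c n) * w ^ n + (a + b) * (of_nat n * ?c n * w ^ n) + a * b * (?c n * w ^ n)))
      sums (w * deriv (deriv F) w + c * deriv F w - (w * deriv (\<lambda>w. w * deriv F w) w + (a + b) * (w * deriv F w) + a * b * F w))"
      by (intro sums_add sums_diff sums_mult A B C sums sums' w')
    moreover have "(of_nat n * diffs ?c n * w ^ n + c * (diffs ?c n * w ^ n)) -
       (of_nat n * (of_nat n * ?c n) * w ^ n + (a + b) * (of_nat n * ?c n * w ^ n) + a * b * (?c n * w ^ n)) = 0" for n
    proof -
      have "(of_nat n * diffs ?c n * w ^ n + c * (diffs ?c n * w ^ n)) -
       (of_nat n * (of_nat n * ?c n) * w ^ n + (a + b) * (of_nat n * ?c n * w ^ n) + a * b * (?c n * w ^ n))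
       = (of_nat (Suc n) * (c + of_nat n) * ?c (Suc n) - (a + of_nat n) * (b + of_nat n) * ?c n) * w ^ n"
        by (simp add: diffs_def algebra_simps)
      thus ?thesis by (simp only: hyp_coeff_Suc) simp
    qed
    ultimately have "(\<lambda>n. 0) sums (w * deriv (deriv F) w + c * deriv F w - (w * deriv (\<lambda>w. w * deriv F w) w + (a + b) * (w * deriv F w) + a * b * F w))"
      by simp
    from sums_unique2[OF this sums_zero] show ?thesis
      unfolding dF[OF ws] by (simp add: algebra_simps)
  qed
  have hL: "?L holomorphic_on slit_plane"
    by (intro holomorphic_intros hol hol' open_slit_plane)
  show ?thesis
    by (rule analytic_continuation_open[of "ball 0 1" slit_plane ?L "\<lambda>_. 0"])
       (use disc hL w open_slit_plane connected_slit_plane norm_less_1_imp_slit_plane in auto)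
qed

section \<open>Behaviour of the hypergeometric function at 1\<close>

lemma norm_le_mult_exp:
  fixes x y :: real
  assumes "x \<ge> real n + 1"
  shows "norm (Complex x y) \<le> x * exp (y\<^sup>2 / ((n + 1) * (n + 2)))"
proof -
  have x: "x > 0" using assms by linarith
  have "norm (Complex x y) = sqrt (x\<^sup>2 + y\<^sup>2)" by (simp add: cmod_def)
  also have "\<dots> \<le> x * (1 + y\<^sup>2 / (2 * x\<^sup>2))"
  proof (rule real_le_lsqrt)
    have "(x * (1 + y\<^sup>2 / (2 * x\<^sup>2)))\<^sup>2 = x\<^sup>2 + y\<^sup>2 + (y\<^sup>2 / (2 * x))\<^sup>2"
      using x by (simp add: field_simps power2_eq_square)
    thus "x\<^sup>2 + y\<^sup>2 \<le> (x * (1 + y\<^sup>2 / (2 * x\<^sup>2)))\<^sup>2" by simp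
  qed (use x in auto)
  also have "y\<^sup>2 / (2 * x\<^sup>2) \<le> y\<^sup>2 / ((n + 1) * (n + 2))"
  proof (rule divide_left_mono)
    have "(real n + 1) * (real n + 2) \<le> 2 * ((real n + 1) * (real n + 1))" by (simp add: algebra_simps)
    also have "\<dots> \<le> 2 * (x * x)" using assms by (intro mult_left_mono mult_mono) auto
    finally show "(n + 1) * (n + 2) \<le> 2 * x\<^sup>2" by (simp add: power2_eq_square algebra_simps)
  qed (use x in \<open>auto intro!: mult_pos_pos add_pos_nonneg\<close>)
  also have "1 + y\<^sup>2 / ((n + 1) * (n + 2)) \<le> exp (y\<^sup>2 / ((n + 1) * (n + 2)))" by (rule exp_ge_add_one_self)
  finally show ?thesis using x by (simp add: mult_left_mono)
qed

text \<open>Each factor |z + n| exceeds Re z + n by a factor of at most exp((Im z)^2 / ((n + 1)(n +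
  2))), and these exponents telescope to a sum not exceeding (Im z)^2.\<close>

lemma norm_pochhammer_le:
  assumes "Re z \<ge> 1"
  shows "norm (pochhammer z n) \<le> exp ((Im z)\<^sup>2) * pochhammer (Re z) n"
proof -
  \<comment> \<open>The induction carries the partial telescoping sum 1 - 1/(n + 1); the plain bound
    would not be inductive.\<close>
  have "norm (pochhammer z n) \<le> exp ((Im z)\<^sup>2 * (1 - 1 / (n + 1))) * pochhammer (Re z) n"
  proof (induction n)
    case (Suc n)
    have p: "pochhammer (Re z) n \<ge> 0" using assms by (intro pochhammer_nonneg) auto
    have "z + of_nat n = Complex (Re z + n) (Im z)" by (simp add: complex_eq_iff)
    hence "norm (z + of_nat n) \<le> (Re z + n) * exp ((Im z)\<^sup>2 / ((n + 1) * (n + 2)))"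
      using norm_le_mult_exp[of n "Re z + n" "Im z"] assms by simp
    hence "norm (pochhammer z (Suc n)) \<le> (exp ((Im z)\<^sup>2 * (1 - 1 / (n + 1))) * pochhammer (Re z) n) * ((Re z + n) * exp ((Im z)\<^sup>2 / ((n + 1) * (n + 2))))"
      unfolding pochhammer_Suc norm_mult using Suc p by (intro mult_mono) auto
    also have "\<dots> = exp ((Im z)\<^sup>2 * (1 - 1 / (n + 1)) + (Im z)\<^sup>2 / ((n + 1) * (n + 2))) * pochhammer (Re z) (Suc n)"
      by (simp add: pochhammer_Suc exp_add)
    also have "(Im z)\<^sup>2 * (1 - 1 / (n + 1)) + (Im z)\<^sup>2 / ((n + 1) * (n + 2)) = (Im z)\<^sup>2 * (1 - 1 / (Suc n + 1))"
    proof -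
      have "1 / ((real n + 1) * (real n + 2)) = 1 / (real n + 1) - 1 / (real n + 2)" by (simp add: field_simps)
      hence "(Im z)\<^sup>2 / ((real n + 1) * (real n + 2)) = (Im z)\<^sup>2 * (1 / (real n + 1) - 1 / (real n + 2))"
        by (metis times_divide_eq_right mult.right_neutral)
      thus ?thesis by (simp add: algebra_simps)
    qed
    finally show ?case .
  qed simp
  also have "\<dots> \<le> exp ((Im z)\<^sup>2) * pochhammer (Re z) n"
    using assms by (intro mult_right_mono pochhammer_nonneg) (auto intro!: mult_left_le)
  finally show ?thesis .
qed

lemma norm_pochhammer_ge:
  assumes "Re z \<ge> 0"
  shows "pochhammer (Re z) n \<le> norm (pochhammer z n)"
proof (induction n)
  case (Suc n)
  have "Re z + n \<le> norm (z + of_nat n)" using complex_Re_le_cmod[of "z + of_nat n"] by simp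
  thus ?case unfolding pochhammer_Suc norm_mult using Suc assms
    by (intro mult_mono) (auto)
qed simp

lemma norm_rGamma_series: 
  "norm (rGamma_series z n) = norm (pochhammer z (n + 1)) / (fact n * exp (Re z * ln n))"
  by (simp add: rGamma_series_def norm_divide norm_mult)

text \<open>The denominators of \<open>rGamma_series\<close> at z and at Re z have the same modulus,
  so the Pochhammer bound passes to the limit. Together with the opposite inequality below,
  |\<Gamma>(z)| and \<Gamma>(Re z) become comparable on strips of bounded imaginary part. This lets
  error bounds from real Beta integrals be stated with |\<Gamma>(\<mu> - N)|.\<close>

lemma norm_rGamma_le:
  assumes "Re z \<ge> 1"
  shows "norm (rGamma z) \<le> exp ((Im z)\<^sup>2) * rGamma (Re z)"
proof (rule LIMSEQ_le)
  show "(\<lambda>n. norm (rGamma_series z n)) \<longlonglongrightarrow> norm (rGamma z)" by (intro tendsto_intros)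
  show "(\<lambda>n. exp ((Im z)\<^sup>2) * rGamma_series (Re z) n) \<longlonglongrightarrow> exp ((Im z)\<^sup>2) * rGamma (Re z)" by (intro tendsto_intros)
  show "\<exists>N. \<forall>n\<ge>N. norm (rGamma_series z n) \<le> exp ((Im z)\<^sup>2) * rGamma_series (Re z) n"
    using divide_right_mono[OF norm_pochhammer_le[OF assms]]
    unfolding norm_rGamma_series rGamma_series_def[of "Re z"] by auto
qed

lemma norm_rGamma_ge:
  assumes "Re z \<ge> 0"
  shows "rGamma (Re z) \<le> norm (rGamma z)"
proof (rule LIMSEQ_le)
  show "(\<lambda>n. norm (rGamma_series z n)) \<longlonglongrightarrow> norm (rGamma z)" by (intro tendsto_intros)
  show "(\<lambda>n. rGamma_series (Re z) n) \<longlonglongrightarrow> rGamma (Re z)" by (intro tendsto_intros)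
  show "\<exists>N. \<forall>n\<ge>N. rGamma_series (Re z) n \<le> norm (rGamma_series z n)"
    using divide_right_mono[OF norm_pochhammer_ge[OF assms]]
    unfolding norm_rGamma_series rGamma_series_def[of "Re z"] by auto
qed

lemma norm_Gamma_le:
  assumes "Re z > 0"
  shows "norm (Gamma z) \<le> Gamma (Re z)"
proof -
  have "Gamma (Re z) > 0" using assms by simp
  thus ?thesis using norm_rGamma_ge[of z] assms notin_nonpos_Ints_if_Re_pos[OF assms]
    by (simp add: rGamma_inverse_Gamma norm_inverse Gamma_eq_zero_iff)
qed

lemma Gamma_Re_le:
  assumes "Re z \<ge> 1"
  shows "Gamma (Re z) \<le> exp ((Im z)\<^sup>2) * norm (Gamma z)"
proof -
  have "Gamma (Re z) > 0" using assms by simp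
  moreover have "norm (Gamma z) > 0" using assms notin_nonpos_Ints_if_Re_pos[of z] by (simp add: Gamma_eq_zero_iff)
  moreover have "inverse (norm (Gamma z)) \<le> exp ((Im z)\<^sup>2) * inverse (Gamma (Re z))"
    using norm_rGamma_le[OF assms] by (simp add: rGamma_inverse_Gamma norm_inverse)
  ultimately show ?thesis by (simp add: field_simps)
qed

lemma norm_powr_le:
  "norm (z powr s) \<le> norm z powr Re s * exp (pi * \<bar>Im s\<bar>)" for z s :: complex
proof (cases "z = 0")
  case False
  have "norm (z powr s) = exp (Re s * ln (norm z) - Im s * Im (Ln z))"
    using False by (simp add: powr_def norm_exp_eq_Re)
  also have "\<dots> \<le> exp (Re s * ln (norm z) + pi * \<bar>Im s\<bar>)"
  proof -
    have "- (Im s * Im (Ln z)) \<le> \<bar>Im s\<bar> * \<bar>Im (Ln z)\<bar>" by (metis abs_ge_minus_self abs_mult)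
    also have "\<dots> \<le> \<bar>Im s\<bar> * pi" using mpi_less_Im_Ln[OF False] Im_Ln_le_pi[OF False] by (intro mult_left_mono) auto
    finally show ?thesis by (simp add: mult.commute)
  qed
  finally show ?thesis using False by (simp add: powr_def exp_add mult_ac)
qed auto

text \<open>The coefficients are compared with those of \<open>(1 - q)\<close> to the power \<open>- Re s\<close>, which is
  comparable to \<open>\<bar>1 - q\<bar>\<close> to the power \<open>- Re s\<close> because the approach to \<open>1\<close> is nontangential.\<close>

lemma Abel_remainder_tendsto_0:
  fixes e :: "nat \<Rightarrow> complex" and q g :: "nat \<Rightarrow> complex"
  assumes s: "Re s > 0"
    and e: "(\<lambda>n. norm (e n) / (pochhammer (Re s) n / fact n)) \<longlonglongrightarrow> 0"
    and q1: "\<And>j. norm (q j) < 1" and qM: "\<And>j. norm (1 - q j) \<le> M * (1 - norm (q j))" and q: "q \<longlonglongrightarrow> 1"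
    and sums: "\<And>j. (\<lambda>n. e n * q j ^ n) sums g j"
  shows "(\<lambda>j. (1 - q j) powr s * g j) \<longlonglongrightarrow> 0"
proof (rule LIMSEQ_I)
  fix r :: real assume r: "r > 0"
  define D where "D n = pochhammer (Re s) n / fact n" for n
  have Dp: "D n > 0" for n unfolding D_def using s by (intro divide_pos_pos pochhammer_pos) auto
  define P where "P = exp (pi * \<bar>Im s\<bar>)"
  have P: "P > 0" by (simp add: P_def)
  have M: "M \<ge> 0" using qM[of 0] q1[of 0] norm_ge_zero[of "1 - q 0"]
    by (smt (verit) mult_neg_pos)
  \<comment> \<open>Chosen so that \<open>P * \<epsilon> * M powr Re s\<close> is at most r/2; the
    summand 1 keeps the denominator positive.\<close>
  define \<epsilon> where "\<epsilon> = r / 2 / (P * (M powr Re s + 1))"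
  have eps: "\<epsilon> > 0" unfolding \<epsilon>_def using r P by (intro divide_pos_pos mult_pos_pos add_nonneg_pos) auto
  obtain n0 where n0: "\<And>n. n \<ge> n0 \<Longrightarrow> norm (e n) / D n < \<epsilon>"
    using order_tendstoD(2)[OF e eps] unfolding D_def[symmetric] eventually_sequentially by blast
  define C where "C = (\<Sum>n<n0. norm (e n))"
  have bound: "norm ((1 - q j) powr s * g j) \<le> P * (norm (1 - q j) powr Re s * C) + r / 2" for j
  proof -
    have qq: "1 - q j \<noteq> 0" using q1[of j] by auto
    have "norm (complex_of_real (norm (q j))) < 1" using q1 by simp
    from binomial_series_pochhammer[OF this, of "of_real (Re s)"]
    have "(\<lambda>n. complex_of_real (D n * norm (q j) ^ n)) sums ((1 - of_real (norm (q j))) powr (- of_real (Re s)))"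
      by (simp add: D_def pochhammer_of_real)
    moreover have "(1 - complex_of_real (norm (q j))) powr (- of_real (Re s)) = of_real ((1 - norm (q j)) powr (- Re s))"
      using q1[of j] powr_of_real[of "1 - norm (q j)" "- Re s"] by simp
    ultimately have Ds: "(\<lambda>n. D n * norm (q j) ^ n) sums ((1 - norm (q j)) powr (- Re s))"
      by (simp only: sums_of_real_iff)
    \<comment> \<open>Finitely many early terms contribute a constant, which the factor of order |1
      - q|^(Re s) suppresses; the later ones are \<epsilon> times the comparison series.\<close>
    have le: "norm (e n * q j ^ n) \<le> (if n < n0 then norm (e n) else 0) + \<epsilon> * (D n * norm (q j) ^ n)" for n
    proof (cases "n < n0")
      case True
      have "norm (e n * q j ^ n) \<le> norm (e n)" using q1[of j] by (simp add: norm_mult norm_power mult_left_le power_le_one)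
      also have "\<dots> \<le> norm (e n) + \<epsilon> * (D n * norm (q j) ^ n)" using eps Dp[of n] by simp
      finally show ?thesis using True by simp
    next
      case False
      hence "norm (e n) \<le> \<epsilon> * D n" using n0[of n] Dp[of n] by (simp add: field_simps)
      thus ?thesis using False by (simp add: norm_mult norm_power mult_right_mono flip: mult.assoc)
    qed
    have "(\<lambda>n. if n < n0 then norm (e n) else 0) sums C"
      using sums_If_finite[of "\<lambda>n. n < n0" "\<lambda>n. norm (e n)"] by (simp add: C_def lessThan_def)
    hence S: "(\<lambda>n. (if n < n0 then norm (e n) else 0) + \<epsilon> * (D n * norm (q j) ^ n)) sums (C + \<epsilon> * (1 - norm (q j)) powr (- Re s))"
      by (intro sums_add sums_mult Ds)
    have "norm (g j) \<le> C + \<epsilon> * (1 - norm (q j)) powr (- Re s)"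
      using norm_suminf_le[OF le sums_summable[OF S]] sums_unique[OF sums[of j]] sums_unique[OF S] by simp
    hence "norm ((1 - q j) powr s * g j) \<le> (norm (1 - q j) powr Re s * P) * (C + \<epsilon> * (1 - norm (q j)) powr (- Re s))"
      unfolding norm_mult P_def by (intro mult_mono norm_powr_le) auto
    also have "\<dots> = P * (norm (1 - q j) powr Re s * C) + P * \<epsilon> * (norm (1 - q j) powr Re s * (1 - norm (q j)) powr (- Re s))"
      by (simp add: algebra_simps)
    also have "norm (1 - q j) powr Re s * (1 - norm (q j)) powr (- Re s) \<le> M powr Re s"
    proof -
      have "norm (1 - q j) powr Re s * (1 - norm (q j)) powr (- Re s) = (norm (1 - q j) / (1 - norm (q j))) powr Re s"
        using q1[of j] by (simp add: powr_divide powr_minus field_simps)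
      also have "\<dots> \<le> M powr Re s" using q1[of j] qM[of j] s by (intro powr_mono2) (auto simp: field_simps)
      finally show ?thesis .
    qed
    also have "P * \<epsilon> * M powr Re s \<le> r / 2"
    proof -
      have pos: "P * (M powr Re s + 1) > 0" using P by (intro mult_pos_pos add_nonneg_pos) auto
      have "P * \<epsilon> * M powr Re s \<le> \<epsilon> * (P * (M powr Re s + 1))" using P eps by (simp add: algebra_simps)
      also have "\<dots> = r / 2" unfolding \<epsilon>_def using pos by (metis nonzero_eq_divide_eq less_numeral_extra(3))
      finally show ?thesis .
    qed
    finally show ?thesis using P eps by (simp add: mult_left_mono)
  qed
  have "(\<lambda>j. P * (norm (1 - q j) powr Re s * C) + r / 2) \<longlonglongrightarrow> P * (norm (1 - 1 :: complex) powr Re s * C) + r / 2"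
    by (intro tendsto_intros q tendsto_powr') (use s in auto)
  hence "\<forall>\<^sub>F j in sequentially. P * (norm (1 - q j) powr Re s * C) + r / 2 < r"
    by (rule order_tendstoD) (use r s in auto)
  thus "\<exists>no. \<forall>n\<ge>no. norm ((1 - q n) powr s * g n - 0) < r"
    unfolding eventually_sequentially using bound by (metis diff_zero order.strict_trans1)
qed

section \<open>Asymptotics of the coefficients and the limit at 1\<close>

lemma pochhammer_over_power_tendsto_1:
  "(\<lambda>n. pochhammer (z + of_nat n) k / of_nat n ^ k) \<longlonglongrightarrow> (1 :: complex)"
proof (induction k)
  case (Suc k)
  have "(\<lambda>n. 1 + (z + of_nat k) / of_nat n) \<longlonglongrightarrow> 1 + 0"
    by (intro tendsto_intros lim_const_over_n)
  hence "(\<lambda>n. pochhammer (z + of_nat n) k / of_nat n ^ k * (1 + (z + of_nat k) / of_nat n)) \<longlonglongrightarrow> 1 * (1 + 0)"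
    by (intro tendsto_mult Suc)
  moreover have "\<forall>\<^sub>F n in sequentially. pochhammer (z + of_nat n) k / of_nat n ^ k * (1 + (z + of_nat k) / of_nat n)
      = pochhammer (z + of_nat n) (Suc k) / of_nat n ^ Suc k"
    using eventually_gt_at_top[of 0] by eventually_elim (simp add: pochhammer_Suc field_simps)
  ultimately show ?case by (simp add: tendsto_cong)
qed auto

text \<open>The ratio is a quotient of limit products for 1/\<Gamma>, in which the powers of n
  cancel because s + c = a + b. Since \<Gamma>(c) may have a pole, \<open>c\<close> is first moved
  to d = c + k with positive real part; the Pochhammer symbol relating \<Gamma>(c + n) to \<Gamma>(d
  + n) behaves like n^k.\<close>

lemma hyp_coeff_ratio_tendsto:
  assumes s: "Re s > 0" and abc: "s = a + b - c"
  shows "(\<lambda>n. hyp_coeff a b c n / (pochhammer s n / fact n)) \<longlonglongrightarrow> Gamma s * rGamma a * rGamma b"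
\<comment> \<open>The index is shifted because \<open>rGamma_series z n\<close> contains a
  Pochhammer symbol of length n + 1.\<close>
proof (rule LIMSEQ_imp_Suc)
  obtain k :: nat where k: "- Re c < real k" using reals_Archimedean2 by blast
  define d where "d = c + of_nat k"
  have d: "Re d > 0" using k by (simp add: d_def)
  have nz: "rGamma s \<noteq> 0" "rGamma d \<noteq> 0" 
    using notin_nonpos_Ints_if_Re_pos[OF s] notin_nonpos_Ints_if_Re_pos[OF d] by (auto simp: rGamma_eq_zero_iff)
  have pnz: "pochhammer s n \<noteq> 0" "pochhammer d n \<noteq> 0" for n
    using s d by (auto simp: pochhammer_eq_0_iff)
  have "(\<lambda>n. rGamma d * (rGamma_series a n * rGamma_series b n / (rGamma_series s n * rGamma_series d n)) * (pochhammer (c + 1 + of_nat n) k / of_nat n ^ k))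
    \<longlonglongrightarrow> rGamma d * (rGamma a * rGamma b / (rGamma s * rGamma d)) * 1"
    using nz by (intro tendsto_intros pochhammer_over_power_tendsto_1) auto
  moreover have "rGamma d * (rGamma a * rGamma b / (rGamma s * rGamma d)) * 1 = Gamma s * rGamma a * rGamma b"
    using nz by (simp add: Gamma_def field_simps)
  moreover have "\<forall>\<^sub>F n in sequentially. rGamma d * (rGamma_series a n * rGamma_series b n / (rGamma_series s n * rGamma_series d n)) * (pochhammer (c + 1 + of_nat n) k / of_nat n ^ k)
     = hyp_coeff a b c (Suc n) / (pochhammer s (Suc n) / fact (Suc n))"
    using eventually_gt_at_top[of 0]
  proof eventually_elim
    case (elim n)
    define l where "l = complex_of_real (ln (real n))"
    have e: "exp (a * l) * exp (b * l) * of_nat n ^ 0 = exp (s * l) * exp (d * l) / of_nat n ^ k"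
    proof -
      have "exp (complex_of_nat k * l) = of_nat n ^ k"
        using elim unfolding l_def by (simp add: exp_of_nat_mult exp_of_real)
      moreover have "exp (s * l) * exp (d * l) = exp (a * l) * exp (b * l) * exp (of_nat k * l)"
        by (simp add: abc d_def exp_add[symmetric] algebra_simps)
      ultimately show ?thesis using elim by simp
    qed
    have "rGamma (c + of_nat (Suc n)) = pochhammer (c + of_nat (Suc n)) k * rGamma (d + of_nat (Suc n))"
      using pochhammer_rGamma[of "c + of_nat (Suc n)" k] by (simp add: d_def add_ac)
    moreover have "rGamma d = pochhammer d (Suc n) * rGamma (d + of_nat (Suc n))"
      by (rule pochhammer_rGamma)
    ultimately have r: "rGamma (c + of_nat (Suc n)) = pochhammer (c + 1 + of_nat n) k * rGamma d / pochhammer d (Suc n)"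
      using pnz(2)[of "Suc n"] by (simp add: add_ac)
    have ps: "pochhammer s (Suc n) \<noteq> 0" "pochhammer d (Suc n) \<noteq> 0" using pnz by auto
    have "rGamma d * (rGamma_series a n * rGamma_series b n / (rGamma_series s n * rGamma_series d n)) * (pochhammer (c + 1 + of_nat n) k / of_nat n ^ k)
      = rGamma d * (pochhammer a (Suc n) * pochhammer b (Suc n)) / (pochhammer s (Suc n) * pochhammer d (Suc n)) * pochhammer (c + 1 + of_nat n) k
         * ((exp (s * l) * exp (d * l) / of_nat n ^ k) / (exp (a * l) * exp (b * l)))"
      using elim ps by (simp add: rGamma_series_def l_def[symmetric] field_simps)
    also have "(exp (s * l) * exp (d * l) / of_nat n ^ k) / (exp (a * l) * exp (b * l)) = 1" unfolding e[symmetric] by simp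
    finally show ?case unfolding hyp_coeff_def r using ps by (simp add: field_simps del: fact_Suc)
  qed
  ultimately show "(\<lambda>n. hyp_coeff a b c (Suc n) / (pochhammer s (Suc n) / fact (Suc n))) \<longlonglongrightarrow> Gamma s * rGamma a * rGamma b"
    by (simp only: tendsto_cong)
qed

text \<open>Coefficients asymptotic to L times those of (1 - q)^(-s) leave a remainder of smaller
  order, by the Abelian lemma. Re s \<ge> 1 serves to compare the Pochhammer symbols of s and Re s.
  The limit may be 0, for instance when \<open>a\<close> or \<open>b\<close> is a nonpositive
  integer.\<close>

lemma hyperF_reg_tendsto_at_1:
  fixes q :: "nat \<Rightarrow> complex"
  assumes s: "Re s \<ge> 1" and abc: "s = a + b - c"
    and q1: "\<And>j. norm (q j) < 1" and qM: "\<And>j. norm (1 - q j) \<le> M * (1 - norm (q j))" and q: "q \<longlonglongrightarrow> 1"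
  shows "(\<lambda>j. (1 - q j) powr s * hyperF_reg a b c (q j)) \<longlonglongrightarrow> Gamma s * rGamma a * rGamma b"
proof -
  define L where "L = Gamma s * rGamma a * rGamma b"
  define d where "d n = pochhammer s n / fact n" for n
  define e where "e n = hyp_coeff a b c n - L * d n" for n
  have dnz: "d n \<noteq> 0" for n unfolding d_def using s by (auto simp: pochhammer_eq_0_iff)
  have pp: "pochhammer (Re s) n > 0" for n using s by (intro pochhammer_pos) auto
  have "(\<lambda>n. norm (e n) / (pochhammer (Re s) n / fact n)) \<longlonglongrightarrow> 0"
  proof (rule Lim_null_comparison)
    have "(\<lambda>n. exp ((Im s)\<^sup>2) * norm (hyp_coeff a b c n / d n - L)) \<longlonglongrightarrow> exp ((Im s)\<^sup>2) * norm (L - L)"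
      unfolding d_def L_def using s by (intro tendsto_intros hyp_coeff_ratio_tendsto abc) auto
    thus "(\<lambda>n. exp ((Im s)\<^sup>2) * norm (hyp_coeff a b c n / d n - L)) \<longlonglongrightarrow> 0" by simp
    show "\<forall>\<^sub>F n in sequentially. norm (norm (e n) / (pochhammer (Re s) n / fact n)) \<le> exp ((Im s)\<^sup>2) * norm (hyp_coeff a b c n / d n - L)"
    proof (intro always_eventually allI)
      fix n
      have "norm (d n) \<le> exp ((Im s)\<^sup>2) * (pochhammer (Re s) n / fact n)"
        using norm_pochhammer_le[OF s, of n] by (simp add: d_def norm_divide divide_right_mono)
      moreover have "e n = (hyp_coeff a b c n / d n - L) * d n" using dnz[of n] by (simp add: e_def algebra_simps)
      ultimately have "norm (e n) \<le> norm (hyp_coeff a b c n / d n - L) * (exp ((Im s)\<^sup>2) * (pochhammer (Re s) n / fact n))"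
        by (simp only: norm_mult) (intro mult_left_mono, auto)
      thus "norm (norm (e n) / (pochhammer (Re s) n / fact n)) \<le> exp ((Im s)\<^sup>2) * norm (hyp_coeff a b c n / d n - L)"
        using pp[of n] by (simp add: field_simps)
    qed
  qed
  moreover have "(\<lambda>n. e n * q j ^ n) sums (hyperF_reg a b c (q j) - L * (1 - q j) powr (- s))" for j
    using sums_diff[OF sums_hyperF_reg[OF q1[of j], of a b c] sums_mult[OF binomial_series_pochhammer[OF q1[of j], of s], of L]]
    by (simp add: e_def d_def algebra_simps)
  ultimately have "(\<lambda>j. (1 - q j) powr s * (hyperF_reg a b c (q j) - L * (1 - q j) powr (- s))) \<longlonglongrightarrow> 0"
    using s by (intro Abel_remainder_tendsto_0[OF _ _ q1 qM q]) auto
  moreover have "(1 - q j) powr s * (hyperF_reg a b c (q j) - L * (1 - q j) powr (- s)) = (1 - q j) powr s * hyperF_reg a b c (q j) - L" for j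
  proof -
    have "1 - q j \<noteq> 0" using q1[of j] by auto
    hence "(1 - q j) powr s * (1 - q j) powr (- s) = 1" by (simp add: powr_minus)
    thus ?thesis by (simp add: algebra_simps)
  qed
  ultimately show ?thesis unfolding L_def[symmetric] by (simp add: LIM_zero_iff)
qed

section \<open>Growth of the kernel\<close>

abbreviation hyp32 :: "complex \<Rightarrow> complex \<Rightarrow> complex" where
  "hyp32 \<nu> \<equiv> hyperF_reg (\<nu> + 1) (- \<nu>) (3 / 2)"

abbreviation hyp32_coeff :: "complex \<Rightarrow> nat \<Rightarrow> complex" where
  "hyp32_coeff \<nu> \<equiv> hyp_coeff (\<nu> + 1) (- \<nu>) (3 / 2)"

section \<open>The kernel under the hyperbolic substitution\<close>

lemma Re_Im_cosh: "Re (cosh z) = cosh (Re z) * cos (Im z)" "Im (cosh z) = sinh (Re z) * sin (Im z)"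
  by (simp_all add: cosh_def sinh_def Re_exp Im_exp algebra_simps)

text \<open>A real value of -sinh^2 A that is at least 1 would make cosh^2 A = 1 + sinh^2 A
  nonpositive, hence cosh A purely imaginary; but its real part, the product of cosh (Re A) and cos
  (Im A), is positive in the strip.\<close>

lemma minus_sinh_square_in_slit_plane:
  assumes "\<bar>Im A\<bar> < pi / 2"
  shows "- (sinh A)\<^sup>2 \<in> slit_plane"
proof (rule ccontr)
  assume "- (sinh A)\<^sup>2 \<notin> slit_plane"
  hence *: "Im (- (sinh A)\<^sup>2) = 0" "Re (- (sinh A)\<^sup>2) \<ge> 1" by (auto simp: slit_plane_iff)
  have "(cosh A)\<^sup>2 = 1 + (sinh A)\<^sup>2" by (simp add: cosh_square_eq)
  with * have "Im ((cosh A)\<^sup>2) = 0" "Re ((cosh A)\<^sup>2) \<le> 0" by auto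
  hence "Re (cosh A) = 0 \<or> Im (cosh A) = 0" "(Re (cosh A))\<^sup>2 \<le> (Im (cosh A))\<^sup>2"
    by (auto simp: power2_eq_square)
  hence "Re (cosh A) = 0" by auto
  moreover have "Re (cosh A) > 0" using assms by (auto simp: Re_Im_cosh intro!: mult_pos_pos cos_gt_zero_pi)
  ultimately show False by simp
qed

lemma norm_cosh_le: "norm (cosh z) \<le> exp (norm z)" for z :: complex
proof -
  have "norm (cosh z) \<le> (norm (exp z) + norm (exp (-z))) / 2"
    unfolding cosh_def using norm_triangle_ineq[of "exp z" "exp (-z)"] by simp
  also have "\<dots> \<le> (exp (norm z) + exp (norm (-z))) / 2"
    using norm_exp[of z] norm_exp[of "-z"] by (intro divide_right_mono add_mono) auto
  finally show ?thesis by simp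
qed

lemma exp_ODE_unique:
  assumes d: "\<And>A. A \<in> S \<Longrightarrow> (f has_field_derivative l * f A) (at A within S)" and S: "convex S" "0 \<in> S" "A \<in> S"
  shows "f A = f 0 * exp (l * A :: complex)"
proof -
  have "\<exists>k. \<forall>A\<in>S. f A * exp (- l * A) = k"
  proof (rule has_field_derivative_zero_constant[OF S(1)])
    fix x assume "x \<in> S"
    from DERIV_mult[OF d[OF this], of "\<lambda>x. exp (- l * x)" "- l * exp (- l * x)"]
    show "((\<lambda>A. f A * exp (- l * A)) has_field_derivative 0) (at x within S)"
      by (auto intro!: derivative_eq_intros d[OF \<open>x \<in> S\<close>])
  qed
  then obtain k where k: "\<And>A. A \<in> S \<Longrightarrow> f A * exp (- l * A) = k" by blast
  from k[OF S(2)] k[OF S(3)] have "f A * exp (- l * A) = f 0" by simp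
  thus ?thesis by (simp add: exp_minus field_simps)
qed

text \<open>With \<open>- sinh\<^sup>2 A\<close> as the variable the kernel is elementary:
  \<open>U A = sinh A * hyp32 \<nu> (- sinh\<^sup>2 A)\<close> satisfies \<open>U'' = (2 * \<nu> + 1)\<^sup>2 * U\<close>, which gives
  \<open>U' A = U' 0 * cosh ((2 * \<nu> + 1) * A)\<close>.\<close>

lemma norm_sinh_hyp32_le:
  assumes A: "\<bar>Im A\<bar> < pi / 2"
  shows "norm (sinh A * hyp32 \<nu> (- (sinh A)\<^sup>2)) \<le> 2 * norm A * exp (norm (2 * \<nu> + 1) * norm A)"
proof -
  let ?S = "{A. \<bar>Im A\<bar> < pi / 2}"
  let ?H = "hyp32 \<nu>" and ?l = "2 * \<nu> + 1"
  have convS: "convex ?S"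
  proof -
    have "?S = {A. - (pi/2) < Im A} \<inter> {A. Im A < pi/2}" by auto
    thus ?thesis by (simp only:) (intro convex_Int convex_halfspace_Im_gt convex_halfspace_Im_lt)
  qed
  have hol: "?H holomorphic_on slit_plane" by (rule holomorphic_on_hyperF_reg)
  have hol': "deriv ?H holomorphic_on slit_plane" by (intro holomorphic_deriv hol open_slit_plane)
  define w where "w A = - (sinh A)\<^sup>2" for A :: complex
  have ws: "w A \<in> slit_plane" if "A \<in> ?S" for A using that by (auto simp: w_def intro: minus_sinh_square_in_slit_plane)
  have dw: "(w has_field_derivative - (2 * sinh A * cosh A)) (at A within ?S)" for A
    unfolding w_def by (auto intro!: derivative_eq_intros)
  have dH: "((\<lambda>A. ?H (w A)) has_field_derivative deriv ?H (w A) * (- (2 * sinh A * cosh A))) (at A within ?S)" if "A \<in> ?S" for A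
    by (rule DERIV_chain2[OF holomorphic_derivI[OF hol open_slit_plane ws[OF that]] dw])
  have dH': "((\<lambda>A. deriv ?H (w A)) has_field_derivative deriv (deriv ?H) (w A) * (- (2 * sinh A * cosh A))) (at A within ?S)" if "A \<in> ?S" for A
    by (rule DERIV_chain2[OF holomorphic_derivI[OF hol' open_slit_plane ws[OF that]] dw])
  define U where "U A = sinh A * ?H (w A)" for A
  define V where "V A = cosh A * (?H (w A) + 2 * w A * deriv ?H (w A))" for A
  have dU: "(U has_field_derivative V A) (at A within ?S)" if "A \<in> ?S" for A
    unfolding U_def by (rule derivative_eq_intros dH[OF that] refl)+
      (simp add: V_def w_def power2_eq_square algebra_simps)
  have dV: "(V has_field_derivative ?l\<^sup>2 * U A) (at A within ?S)" if "A \<in> ?S" for A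
  proof -
    let ?h = "?H (w A)" and ?h1 = "deriv ?H (w A)" and ?h2 = "deriv (deriv ?H) (w A)"
    have ode: "w A * (1 - w A) * ?h2 + (3 / 2 - (\<nu> + 1 + - \<nu> + 1) * w A) * ?h1 - (\<nu> + 1) * (- \<nu>) * ?h = 0"
      by (rule hyperF_reg_ODE[OF ws[OF that]])
    have c2: "cosh A * cosh A = 1 - w A" using cosh_square_eq[of A] by (simp add: w_def power2_eq_square)
    have "(V has_field_derivative sinh A * (?h + 2 * w A * ?h1) +
        cosh A * (?h1 * (- (2 * sinh A * cosh A)) + (2 * (- (2 * sinh A * cosh A)) * ?h1 + 2 * w A * (?h2 * (- (2 * sinh A * cosh A)))))) (at A within ?S)"
      unfolding V_def by (rule derivative_eq_intros dH[OF that] dH'[OF that] dw refl)+ (simp add: algebra_simps)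
    moreover have "sinh A * (?h + 2 * w A * ?h1) +
        cosh A * (?h1 * (- (2 * sinh A * cosh A)) + (2 * (- (2 * sinh A * cosh A)) * ?h1 + 2 * w A * (?h2 * (- (2 * sinh A * cosh A)))))
       = sinh A * (?h + 2 * w A * ?h1 - (cosh A * cosh A) * (6 * ?h1 + 4 * w A * ?h2))"
      by (simp add: algebra_simps)
    moreover have "sinh A * (?h + 2 * w A * ?h1 - (cosh A * cosh A) * (6 * ?h1 + 4 * w A * ?h2))
       = ?l\<^sup>2 * U A - 4 * sinh A * (w A * (1 - w A) * ?h2 + (3 / 2 - (\<nu> + 1 + - \<nu> + 1) * w A) * ?h1 - (\<nu> + 1) * (- \<nu>) * ?h)"
      unfolding c2 U_def by (simp add: algebra_simps power2_eq_square)
    ultimately show ?thesis using ode by simp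
  qed
  have r: "?H 0 = rGamma (3/2)"
    using sums_unique2[OF sums_hyperF_reg[of 0 "\<nu> + 1" "- \<nu>" "3/2"] powser_sums_zero[of "hyp32_coeff \<nu>"]]
    by (simp add: hyp_coeff_def)
  have w0: "w 0 = 0" "0 \<in> ?S" by (auto simp: w_def)
  have V0: "V 0 = rGamma (3/2)" "U 0 = 0" by (simp_all add: V_def U_def w0 r)
  \<comment> \<open>The second order equation splits into first order ones for V + l U and V - l U,
    where l = 2 \<nu> + 1. Nothing is divided by l, so \<nu> = -1/2 needs no separate case.\<close>
  have V: "V A = rGamma (3/2) * cosh (?l * A)" if "A \<in> ?S" for A
  proof -
    have "V A + ?l * U A = (V 0 + ?l * U 0) * exp (?l * A)"
    proof (rule exp_ODE_unique[OF _ convS w0(2) that])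
      fix A assume A: "A \<in> ?S"
      show "((\<lambda>A. V A + ?l * U A) has_field_derivative ?l * (V A + ?l * U A)) (at A within ?S)"
        by (rule DERIV_cong[OF DERIV_add[OF dV[OF A] DERIV_cmult[OF dU[OF A]]]]) (simp add: power2_eq_square algebra_simps)
    qed
    moreover have "V A - ?l * U A = (V 0 - ?l * U 0) * exp (- ?l * A)"
    proof (rule exp_ODE_unique[OF _ convS w0(2) that])
      fix A assume A: "A \<in> ?S"
      show "((\<lambda>A. V A - ?l * U A) has_field_derivative - ?l * (V A - ?l * U A)) (at A within ?S)"
        by (rule DERIV_cong[OF DERIV_diff[OF dV[OF A] DERIV_cmult[OF dU[OF A]]]]) (simp add: power2_eq_square algebra_simps)
    qed
    ultimately have e: "V A + ?l * U A = rGamma (3/2) * exp (?l * A)" "V A - ?l * U A = rGamma (3/2) * exp (- ?l * A)"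
      by (simp_all only: V0 mult_zero_right add_0_right diff_zero)
    have "2 * V A = (V A + ?l * U A) + (V A - ?l * U A)" by simp
    also have "\<dots> = rGamma (3/2) * exp (?l * A) + rGamma (3/2) * exp (- ?l * A)" by (simp only: e)
    finally show ?thesis unfolding cosh_field_def mult_minus_left by (simp add: field_simps)
  qed
  have G: "norm (rGamma (3/2 :: complex)) \<le> 2"
  proof -
    have "Gamma (3/2 :: complex) = of_real (sqrt pi) / 2"
      using Gamma_plus1[of "1/2 :: complex"] Gamma_one_half_complex notin_nonpos_Ints_if_Re_pos[of "1/2"] by simp
    hence n: "norm (Gamma (3/2 :: complex)) = sqrt pi / 2" by (simp only: norm_divide norm_of_real) simp
    have "norm (rGamma (3/2 :: complex)) = 2 / sqrt pi" unfolding rGamma_inverse_Gamma norm_inverse n by simp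
    moreover have "2 / sqrt pi \<le> 2 / 1" using pi_ge_two by (intro divide_left_mono) auto
    ultimately show ?thesis by linarith
  qed
  \<comment> \<open>\<open>U\<close> is recovered from its derivative by the mean value inequality
    on the segment from 0, again without dividing by 2 \<nu> + 1.\<close>
  have "norm (U A - U 0) \<le> (2 * exp (norm ?l * norm A)) * norm (A - 0)"
  proof (rule field_differentiable_bound[of "closed_segment 0 A"])
    fix z assume z: "z \<in> closed_segment 0 A"
    have "closed_segment 0 A \<subseteq> ?S" using convS A w0 by (intro closed_segment_subset) auto
    thus "(U has_field_derivative V z) (at z within closed_segment 0 A)"
      using dU z has_field_derivative_subset by blast
    have "norm z \<le> norm A" using segment_bound1[OF z] by simp
    have "norm (V z) = norm (rGamma (3/2 :: complex)) * norm (cosh (?l * z))"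
      using V[of z] z \<open>closed_segment 0 A \<subseteq> ?S\<close> by (auto simp: norm_mult)
    also have "\<dots> \<le> 2 * exp (norm ?l * norm A)"
    proof (intro mult_mono G)
      have "norm (cosh (?l * z)) \<le> exp (norm (?l * z))" by (rule norm_cosh_le)
      also have "\<dots> \<le> exp (norm ?l * norm A)" using \<open>norm z \<le> norm A\<close> by (simp add: norm_mult mult_left_mono)
      finally show "norm (cosh (?l * z)) \<le> exp (norm ?l * norm A)" .
    qed auto
    finally show "norm (V z) \<le> 2 * exp (norm ?l * norm A)" .
  qed auto
  thus ?thesis by (simp add: U_def w_def mult_ac)
qed

text \<open>A is the logarithm of y + s with s^2 = 1 + y^2. The numbers y + s and s - y are
  reciprocal and both of modulus at most 1 + 2|y|, which bounds Re A logarithmically from both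
  sides. A bound linear in |y| would not do, since exp of a multiple of |A| has to remain polynomial
  in |y|.\<close>

lemma obtain_arsinh:
  fixes y :: complex
  assumes y: "Re y > 0"
  obtains A where "sinh A = y" "\<bar>Im A\<bar> < pi / 2" "norm A \<le> ln (1 + 2 * norm y) + 2"
proof -
  define s where "s = csqrt (1 + y\<^sup>2)"
  have s2: "s\<^sup>2 = 1 + y\<^sup>2" by (simp add: s_def)
  have inv: "(y + s) * (s - y) = 1" using s2 by (simp add: algebra_simps power2_eq_square)
  have Re: "Re (y + s) > 0" using y Re_csqrt[of "1 + y\<^sup>2"] by (simp add: s_def add_pos_nonneg)
  hence nz: "y + s \<noteq> 0" by (metis less_irrefl zero_complex.sel(1))
  define A where "A = Ln (y + s)"
  have eA: "exp A = y + s" using nz by (simp add: A_def)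
  have emA: "exp (- A) = s - y" using inv nz by (simp add: exp_minus eA field_simps)
  have sinhA: "sinh A = y" by (simp add: sinh_def eA emA)
  have ImA: "\<bar>Im A\<bar> < pi / 2" unfolding A_def using Re Re_Ln_pos_lt[OF nz] by blast
  have ns: "norm s \<le> 1 + norm y"
  proof (rule power2_le_imp_le)
    have "(norm s)\<^sup>2 = norm (1 + y\<^sup>2)" by (simp add: s2 flip: norm_power)
    also have "\<dots> \<le> 1 + (norm y)\<^sup>2" using norm_triangle_ineq[of 1 "y\<^sup>2"] by (simp add: norm_power)
    also have "\<dots> \<le> (1 + norm y)\<^sup>2" by (simp add: power2_eq_square algebra_simps)
    finally show "(norm s)\<^sup>2 \<le> (1 + norm y)\<^sup>2" .
  qed auto
  have l1: "norm (y + s) \<le> 1 + 2 * norm y" using norm_triangle_ineq[of y s] ns by simp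
  have l2: "norm (s - y) \<le> 1 + 2 * norm y" using norm_triangle_ineq4[of s y] ns by simp
  have ReA: "Re A = ln (norm (y + s))" using nz by (simp add: A_def)
  have "\<bar>Re A\<bar> \<le> ln (1 + 2 * norm y)"
  proof -
    have "Re A \<le> ln (1 + 2 * norm y)" unfolding ReA using l1 nz by (intro ln_mono) auto
    moreover have "- Re A = ln (norm (s - y))"
    proof -
      have "norm (y + s) * norm (s - y) = 1" using inv by (metis norm_mult norm_one)
      hence "norm (s - y) = inverse (norm (y + s))" using nz by (simp add: field_simps)
      thus ?thesis using nz by (simp add: ReA ln_inverse)
    qed
    moreover have "s - y \<noteq> 0" using inv by auto
    hence "ln (norm (s - y)) \<le> ln (1 + 2 * norm y)" using l2 by (intro ln_mono) auto
    ultimately show ?thesis by linarith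
  qed
  moreover have "\<bar>Im A\<bar> \<le> 2" using ImA pi_less_4 by linarith
  ultimately have "norm A \<le> ln (1 + 2 * norm y) + 2" using cmod_le[of A] by linarith
  with sinhA ImA show ?thesis using that by blast
qed

text \<open>Write x = y^2 with Re y > 0 and y = sinh A in the strip; the logarithmic bound on A
  turns the exponential estimate into a power of 1 + |x|. That estimate concerns the product with
  sinh A, so isolating the kernel divides by |y|; hence the lower bound \<rho>, with small x left to
  the power series. The distance of x to the cut does not enter.\<close>

lemma norm_hyp32_le:
  assumes x: "x \<notin> \<real>\<^sub>\<le>\<^sub>0" and L: "norm (2 * \<nu> + 1) \<le> real L" and \<rho>: "0 < \<rho>" "\<rho> \<le> norm x"
  shows "norm (hyp32 \<nu> (- x)) \<le> 4 * (1 + 1 / sqrt \<rho>) * exp (2 * real L) * 3 ^ L * (1 + norm x) ^ L"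
proof -
  define y where "y = csqrt x"
  have y2: "y\<^sup>2 = x" by (simp add: y_def)
  have "Re y > 0"
  proof (rule ccontr)
    assume "\<not> Re y > 0"
    hence "Re y = 0" using Re_csqrt[of x] by (simp add: y_def)
    hence "x \<in> \<real>\<^sub>\<le>\<^sub>0" unfolding y2[symmetric] by (simp add: complex_nonpos_Reals_iff power2_eq_square)
    with x show False ..
  qed
  then obtain A where A: "sinh A = y" "\<bar>Im A\<bar> < pi / 2" "norm A \<le> ln (1 + 2 * norm y) + 2"
    using obtain_arsinh by blast
  have ny2: "(norm y)\<^sup>2 = norm x" by (simp add: y2 flip: norm_power)
  hence ny: "norm y = sqrt (norm x)" by (metis norm_ge_zero real_sqrt_unique)
  have yr: "sqrt \<rho> \<le> norm y" unfolding ny using \<rho> by simp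
  have yp: "norm y > 0" using yr \<rho> by (meson less_le_trans real_sqrt_gt_zero)
  have "norm y * norm (hyp32 \<nu> (- x)) \<le> 2 * norm A * exp (norm (2 * \<nu> + 1) * norm A)"
    using norm_sinh_hyp32_le[OF A(2), of \<nu>] by (simp add: A(1) y2 norm_mult)
  also have "\<dots> \<le> 2 * (2 * norm y + 2) * (exp (2 * real L) * (1 + 2 * norm y) ^ L)"
  proof (intro mult_mono)
    have "ln (1 + 2 * norm y) \<le> 2 * norm y" using ln_add_one_self_le_self[of "2 * norm y"] by simp
    thus "norm A \<le> 2 * norm y + 2" using A(3) by linarith
    have "norm (2 * \<nu> + 1) * norm A \<le> real L * (ln (1 + 2 * norm y) + 2)"
      using L A(3) by (intro mult_mono) auto
    hence "exp (norm (2 * \<nu> + 1) * norm A) \<le> exp (real L * (ln (1 + 2 * norm y) + 2))" by simp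
    also have "\<dots> = exp (2 * real L) * exp (ln (1 + 2 * norm y)) ^ L"
      by (simp add: algebra_simps exp_add exp_of_nat_mult)
    also have "exp (ln (1 + 2 * norm y)) = 1 + 2 * norm y" using yp by (intro exp_ln) linarith
    finally show "exp (norm (2 * \<nu> + 1) * norm A) \<le> exp (2 * real L) * (1 + 2 * norm y) ^ L" .
  qed auto
  also have "\<dots> \<le> 2 * (2 * norm y + 2) * (exp (2 * real L) * (3 * (1 + norm x)) ^ L)"
  proof -
    have "norm y \<le> 1 + norm x" unfolding ny2[symmetric] using self_le_power[of "norm y" 2]
      by (cases "norm y \<ge> 1") (auto simp: add_increasing2)
    hence "1 + 2 * norm y \<le> 1 + 2 * (1 + norm x)" by (intro add_left_mono mult_left_mono) auto
    also have "\<dots> \<le> 3 * (1 + norm x)" by (simp add: algebra_simps)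
    finally have "1 + 2 * norm y \<le> 3 * (1 + norm x)" .
    thus ?thesis by (intro mult_left_mono power_mono) auto
  qed
  also have "\<dots> = norm y * (4 * (1 + 1 / norm y) * (exp (2 * real L) * (3 * (1 + norm x)) ^ L))"
    using yp by (simp add: field_simps)
  also have "\<dots> \<le> norm y * (4 * (1 + 1 / sqrt \<rho>) * (exp (2 * real L) * (3 * (1 + norm x)) ^ L))"
  proof -
    have "1 / norm y \<le> 1 / sqrt \<rho>" using yr \<rho> by (intro divide_left_mono mult_pos_pos) (auto simp: yp)
    thus ?thesis by (intro mult_left_mono mult_right_mono) auto
  qed
  finally have "norm (hyp32 \<nu> (- x)) \<le> 4 * (1 + 1 / sqrt \<rho>) * (exp (2 * real L) * (3 * (1 + norm x)) ^ L)"
    using yp by (simp only: mult_le_cancel_left_pos)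
  thus ?thesis by (simp only: power_mult_distrib mult.assoc)
qed

text \<open>The recurrence multiplies by (\<nu> + 1 + n)(n - \<nu>) / ((n + 1)(n + 3/2)), and
  numerator factors exceed denominator factors by at most 1 + B each. The resulting geometric growth
  is crude, but it is uniform in \<nu>.\<close>

lemma norm_hyp32_coeff_le:
  assumes "norm \<nu> \<le> B"
  shows "norm (hyp32_coeff \<nu> n) \<le> norm (rGamma (3/2 :: complex)) * ((1 + B)\<^sup>2) ^ n"
proof (induction n)
  case 0 show ?case by (simp add: hyp_coeff_def)
next
  case (Suc n)
  have B: "B \<ge> 0" using assms norm_ge_zero order.trans by blast
  let ?k = "(real n + 1) * (real n + 3/2)"
  have "norm (of_nat (Suc n) * (3/2 + of_nat n) * hyp32_coeff \<nu> (Suc n)) = norm ((\<nu> + 1 + of_nat n) * (- \<nu> + of_nat n) * hyp32_coeff \<nu> n)"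
    by (simp only: hyp_coeff_Suc)
  moreover have "norm (3/2 + of_nat n :: complex) = real n + 3/2"
    using norm_of_real[of "real n + 3/2", where 'a = complex] by (simp add: add.commute)
  moreover have "norm (of_nat (Suc n) :: complex) = real n + 1" unfolding norm_of_nat by simp
  ultimately have "?k * norm (hyp32_coeff \<nu> (Suc n)) = norm (\<nu> + 1 + of_nat n) * norm (- \<nu> + of_nat n) * norm (hyp32_coeff \<nu> n)"
    by (simp only: norm_mult)
  also have "\<dots> \<le> ((1 + B) * (real n + 1)) * ((1 + B) * (real n + 3/2)) * norm (hyp32_coeff \<nu> n)"
  proof (intro mult_mono)
    have "norm (\<nu> + (1 + of_nat n)) \<le> norm \<nu> + norm (1 + of_nat n :: complex)" by (rule norm_triangle_ineq)
    also have "norm (1 + of_nat n :: complex) = real n + 1"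
      using norm_of_nat[of "Suc n", where 'a = complex] by simp
    also have "norm \<nu> + (real n + 1) \<le> (1 + B) * (real n + 1)"
    proof -
      have "(1 + B) * (real n + 1) = real n + 1 + B + B * real n" by (simp add: algebra_simps)
      moreover have "B * real n \<ge> 0" using B by simp
      ultimately show ?thesis using assms by linarith
    qed
    finally show "norm (\<nu> + 1 + of_nat n) \<le> (1 + B) * (real n + 1)" by (simp add: add_ac)
    have "norm (- \<nu> + of_nat n) \<le> norm \<nu> + real n" using norm_triangle_ineq[of "- \<nu>" "of_nat n"] by simp
    also have "\<dots> \<le> (1 + B) * (real n + 3/2)"
    proof -
      have "(1 + B) * (real n + 3/2) = real n + 3/2 + 3/2 * B + B * real n" by (simp add: algebra_simps)
      moreover have "B * real n \<ge> 0" using B by simp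
      ultimately show ?thesis using assms B by linarith
    qed
    finally show "norm (- \<nu> + of_nat n) \<le> (1 + B) * (real n + 3/2)" .
  qed (use B in auto)
  also have "\<dots> = ?k * ((1 + B)\<^sup>2 * norm (hyp32_coeff \<nu> n))" by (simp add: power2_eq_square)
  finally have "norm (hyp32_coeff \<nu> (Suc n)) \<le> (1 + B)\<^sup>2 * norm (hyp32_coeff \<nu> n)"
    by (rule mult_left_le_imp_le) (auto intro!: mult_pos_pos add_nonneg_pos)
  also have "\<dots> \<le> (1 + B)\<^sup>2 * (norm (rGamma (3/2 :: complex)) * ((1 + B)\<^sup>2) ^ n)" by (intro mult_left_mono Suc) auto
  finally show ?case by (simp add: mult_ac)
qed

text \<open>Two regimes. For |x| \<le> \<rho> the tail is dominated by a geometric series. For |x| >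
  \<rho> the function and its Taylor polynomial are bounded separately, and factors that are powers
  of |x|/\<rho> > 1 are inserted to create |x|^N. Neither regime sees the cut. The case N = 0 bounds
  the kernel itself.\<close>

lemma hyp32_Taylor_remainder:
  fixes B :: real and N :: nat
  assumes "B \<ge> 0"
  obtains K L where "K \<ge> 0"
    "\<And>\<nu> x. norm \<nu> \<le> B \<Longrightarrow> x \<notin> \<real>\<^sub>\<le>\<^sub>0 \<Longrightarrow>
       norm (hyp32 \<nu> (- x) - (\<Sum>n<N. hyp32_coeff \<nu> n * (- x) ^ n)) \<le> K * norm x ^ N * (1 + norm x) ^ (L::nat)"
proof -
  define Q where "Q = (1 + B)\<^sup>2"
  have Q: "Q \<ge> 1" unfolding Q_def using assms by (intro one_le_power) auto
  define c where "c = norm (rGamma (3/2 :: complex))"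
  have c: "c \<ge> 0" by (simp add: c_def)
  \<comment> \<open>This radius gives Q|x| \<le> 1/2, so the tail has ratio 1/2; as Q \<ge> 1, it
    also keeps x inside the disc of convergence.\<close>
  define \<rho> where "\<rho> = 1 / (2 * Q)"
  have \<rho>: "\<rho> > 0" using Q by (simp add: \<rho>_def)
  \<comment> \<open>\<open>L\<close> dominates |2 \<nu> + 1| for all admissible \<nu>, so the growth
    is an integral power.\<close>
  obtain L :: nat where L: "2 * B + 1 \<le> real L" using real_arch_simple by blast
  define D where "D = 4 * (1 + 1 / sqrt \<rho>) * exp (2 * real L) * 3 ^ L"
  have D: "D \<ge> 0" using \<rho> by (simp add: D_def)
  \<comment> \<open>\<open>T\<close> collects the polynomial in the second regime, where |x|^n \<le>
    |x|^N (1/\<rho>)^(N - n).\<close>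
  define T where "T = (\<Sum>n<N. c * Q ^ n * (1 / \<rho>) ^ (N - n))"
  have T: "T \<ge> 0" unfolding T_def using c Q \<rho> by (intro sum_nonneg mult_nonneg_nonneg) auto
  have cn: "norm (hyp32_coeff \<nu> n) \<le> c * Q ^ n" if "norm \<nu> \<le> B" for \<nu> n
    using norm_hyp32_coeff_le[OF that] by (simp add: c_def Q_def)
  have "norm (hyp32 \<nu> (- x) - (\<Sum>n<N. hyp32_coeff \<nu> n * (- x) ^ n)) \<le> (2 * c * Q ^ N + (D * (1 / \<rho>) ^ N + T)) * norm x ^ N * (1 + norm x) ^ L"
    (is "norm ?R \<le> _") if \<nu>: "norm \<nu> \<le> B" and x: "x \<notin> \<real>\<^sub>\<le>\<^sub>0" for \<nu> x
  proof (cases "norm x \<le> \<rho>")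
    case True
    have Qx: "Q * norm x \<le> 1/2" using True Q by (simp add: \<rho>_def field_simps)
    have "\<rho> \<le> 1/2" using Q by (simp add: \<rho>_def field_simps)
    hence "norm (- x) < 1" using True by simp
    from sums_hyperF_reg[OF this, of "\<nu> + 1" "- \<nu>" "3/2"]
    have "(\<lambda>n. hyp32_coeff \<nu> (n + N) * (- x) ^ (n + N)) sums ?R"
      by (rule sums_split_initial_segment)
    moreover have "norm (hyp32_coeff \<nu> (n + N) * (- x) ^ (n + N)) \<le> c * (Q * norm x) ^ N * (1/2) ^ n" for n
    proof -
      have "norm (hyp32_coeff \<nu> (n + N) * (- x) ^ (n + N)) \<le> c * Q ^ (n + N) * norm x ^ (n + N)"
        unfolding norm_mult norm_power norm_minus_cancel by (intro mult_right_mono cn \<nu>) auto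
      also have "\<dots> = c * (Q * norm x) ^ N * (Q * norm x) ^ n" by (simp add: power_add power_mult_distrib)
      also have "\<dots> \<le> c * (Q * norm x) ^ N * (1/2) ^ n" using c Q Qx by (intro mult_left_mono power_mono) auto
      finally show ?thesis .
    qed
    moreover have "(\<lambda>n. c * (Q * norm x) ^ N * (1/2) ^ n) sums (c * (Q * norm x) ^ N * 2)"
      using sums_mult[OF geometric_sums[of "1/2 :: real"]] by simp
    ultimately have "norm ?R \<le> c * (Q * norm x) ^ N * 2"
      by (metis (no_types, lifting) norm_suminf_le sums_iff)
    also have "\<dots> = 2 * c * Q ^ N * norm x ^ N * 1" by (simp add: power_mult_distrib)
    also have "\<dots> \<le> (2 * c * Q ^ N + (D * (1 / \<rho>) ^ N + T)) * norm x ^ N * (1 + norm x) ^ L"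
      using c Q D T \<rho> by (intro mult_mono one_le_power) auto
    finally show ?thesis .
  next
    case False
    hence xr: "\<rho> \<le> norm x" "norm x > 0" using \<rho> by auto
    have xn: "1 \<le> norm x / \<rho>" using xr \<rho> by simp
    have "norm (2 * \<nu> + 1) \<le> real L" using norm_triangle_ineq[of "2 * \<nu>" 1] \<nu> L by (simp add: norm_mult)
    from norm_hyp32_le[OF x this \<rho> xr(1)] have "norm (hyp32 \<nu> (- x)) \<le> D * (1 + norm x) ^ L * 1" by (simp add: D_def)
    also have "\<dots> \<le> D * (1 + norm x) ^ L * (norm x / \<rho>) ^ N"
      using D xn by (intro mult_left_mono one_le_power) auto
    finally have 1: "norm (hyp32 \<nu> (- x)) \<le> D * (1 / \<rho>) ^ N * norm x ^ N * (1 + norm x) ^ L"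
      by (simp add: power_divide mult_ac)
    have "norm (\<Sum>n<N. hyp32_coeff \<nu> n * (- x) ^ n) \<le> (\<Sum>n<N. c * Q ^ n * (1 / \<rho>) ^ (N - n) * norm x ^ N)"
    proof (rule sum_norm_le)
      fix n assume "n \<in> {..<N}"
      hence N: "N = n + (N - n)" by simp
      have "norm (hyp32_coeff \<nu> n * (- x) ^ n) \<le> c * Q ^ n * norm x ^ n * 1"
        unfolding norm_mult norm_power norm_minus_cancel mult_1_right by (intro mult_right_mono cn \<nu>) auto
      also have "\<dots> \<le> c * Q ^ n * norm x ^ n * (norm x / \<rho>) ^ (N - n)"
        using c Q xn by (intro mult_left_mono one_le_power) auto
      also have "\<dots> = c * Q ^ n * (1 / \<rho>) ^ (N - n) * (norm x ^ n * norm x ^ (N - n))" by (simp add: power_divide)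
      also have "norm x ^ n * norm x ^ (N - n) = norm x ^ N" using N by (metis power_add)
      finally show "norm (hyp32_coeff \<nu> n * (- x) ^ n) \<le> c * Q ^ n * (1 / \<rho>) ^ (N - n) * norm x ^ N" .
    qed
    also have "\<dots> = T * norm x ^ N * 1" by (simp add: T_def sum_distrib_right)
    also have "\<dots> \<le> T * norm x ^ N * (1 + norm x) ^ L" using T by (intro mult_left_mono one_le_power) auto
    finally have "norm ?R \<le> D * (1 / \<rho>) ^ N * norm x ^ N * (1 + norm x) ^ L + T * norm x ^ N * (1 + norm x) ^ L"
      using 1 norm_triangle_ineq4[of "hyp32 \<nu> (- x)"] by (smt (verit))
    also have "\<dots> = (0 + (D * (1 / \<rho>) ^ N + T)) * norm x ^ N * (1 + norm x) ^ L" by (simp add: algebra_simps)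
    also have "\<dots> \<le> (2 * c * Q ^ N + (D * (1 / \<rho>) ^ N + T)) * norm x ^ N * (1 + norm x) ^ L"
      using c Q by (intro mult_right_mono add_right_mono) auto
    finally show ?thesis .
  qed
  moreover have "2 * c * Q ^ N + (D * (1 / \<rho>) ^ N + T) \<ge> 0" using c Q D T \<rho> by auto
  ultimately show ?thesis using that by blast
qed

section \<open>The building block of the expansions\<close>

text \<open>In the variable s = t / (1 - t) on the half-line the weight becomes s^(1/2) (1 +
  s)^(-\<mu> - 3/2), against the kernel at -p s. On the unit interval the integral is proper for
  large Re \<mu>, and powers of s become shifts of Beta parameters.\<close>

definition legE_integrand :: "complex \<Rightarrow> complex \<Rightarrow> complex \<Rightarrow> real \<Rightarrow> complex" where
  "legE_integrand \<nu> \<mu> p t = hyp32 \<nu> (- (p * of_real (t / (1 - t)))) * (of_real t powr (1 / 2) * of_real (1 - t) powr (\<mu> - 1))"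

text \<open>Integrating the Taylor series of the kernel term by term turns \<open>legE \<nu> \<mu> p\<close> into the formal
  series \<open>\<Sum>n. a\<^sub>n(\<nu> + 1/2) * \<Gamma>(\<mu> - n) * (2 * p)\<^sup>n\<close>. At \<open>t = 1\<close> the argument of the kernel is junk, but the
  weight vanishes there.\<close>

definition legE :: "complex \<Rightarrow> complex \<Rightarrow> complex \<Rightarrow> complex" where
  "legE \<nu> \<mu> p = Gamma (\<mu> + 3 / 2) * integral {0..1} (legE_integrand \<nu> \<mu> p)"

section \<open>Analyticity of the integral and its differential equation\<close>

lemma open_Compl_nonpos_Reals: "open (- \<real>\<^sub>\<le>\<^sub>0 :: complex set)"
  using closed_nonpos_Reals_complex by (simp add: open_Compl)

lemma mult_of_real_notin_nonpos_Reals: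
  assumes "p \<notin> \<real>\<^sub>\<le>\<^sub>0" "s > 0" shows "p * complex_of_real s \<notin> \<real>\<^sub>\<le>\<^sub>0"
  using assms by (auto simp: complex_nonpos_Reals_iff mult_le_0_iff)

lemma minus_mult_of_real_in_slit_plane:
  assumes "p \<notin> \<real>\<^sub>\<le>\<^sub>0" "s \<ge> 0" shows "- (p * complex_of_real s) \<in> slit_plane"
proof (cases "s = 0")
  case False
  hence "p * complex_of_real s \<notin> \<real>\<^sub>\<le>\<^sub>0" using assms by (intro mult_of_real_notin_nonpos_Reals) auto
  thus ?thesis by (auto simp: slit_plane_iff complex_nonpos_Reals_iff)
qed (auto simp: slit_plane_iff)

text \<open>Since 1 + |p| t/(1 - t) \<le> (1 + |p|)/(1 - t), polynomial growth of degree
  \<open>L\<close> of the kernel costs \<open>L\<close> powers of 1 - t, which the weight can afford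
  once Re \<mu> is large.\<close>

lemma norm_legE_integrand_le:
  assumes bound: "\<And>x. x \<notin> \<real>\<^sub>\<le>\<^sub>0 \<Longrightarrow> norm (hyp32 \<nu> (- x)) \<le> K * (1 + norm x) ^ L"
    and K: "K \<ge> 0" and p: "p \<notin> \<real>\<^sub>\<le>\<^sub>0" and t: "t \<in> {0..1}"
  shows "norm (legE_integrand \<nu> \<mu> p t) \<le> K * (1 + norm p) ^ L * (1 - t) powr (Re \<mu> - 1 - L)"
proof (cases "t \<in> {0, 1}")
  case True
  thus ?thesis using K by (auto simp: legE_integrand_def)
next
  case False
  hence t: "0 < t" "t < 1" using t by auto
  let ?s = "t / (1 - t)"
  have s: "?s > 0" using t by simp
  have "norm (legE_integrand \<nu> \<mu> p t) = norm (hyp32 \<nu> (- (p * of_real ?s))) * (t powr (1/2) * (1 - t) powr (Re \<mu> - 1))"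
    unfolding legE_integrand_def norm_mult using t by (simp add: norm_powr_real_powr del: of_real_diff)
  also have "\<dots> \<le> (K * (1 + norm (p * of_real ?s)) ^ L) * (1 * (1 - t) powr (Re \<mu> - 1))"
    using t s p K by (intro mult_mono bound mult_of_real_notin_nonpos_Reals powr_le1) auto
  also have "\<dots> \<le> K * ((1 + norm p) / (1 - t)) ^ L * (1 * (1 - t) powr (Re \<mu> - 1))"
  proof (intro mult_right_mono mult_left_mono power_mono)
    have "norm (p * of_real ?s) = norm p * t / (1 - t)" using t unfolding norm_mult norm_of_real by simp
    also have "1 + norm p * t / (1 - t) = ((1 - t) + norm p * t) / (1 - t)" using t by (simp add: field_simps)
    also have "\<dots> \<le> (1 + norm p) / (1 - t)" using t by (intro divide_right_mono add_mono mult_left_le) auto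
    finally show "1 + norm (p * of_real ?s) \<le> (1 + norm p) / (1 - t)" .
  qed (use K in auto)
  also have "K * ((1 + norm p) / (1 - t)) ^ L * (1 * (1 - t) powr (Re \<mu> - 1)) = K * (1 + norm p) ^ L * ((1 - t) powr (Re \<mu> - 1) / (1 - t) ^ L)"
    by (simp add: power_divide)
  also have "(1 - t) powr (Re \<mu> - 1) / (1 - t) ^ L = (1 - t) powr (Re \<mu> - 1 - L)"
    using t by (simp add: powr_diff powr_realpow)
  finally show ?thesis .
qed

text \<open>Only t = 1 is critical. There the integrand is 0 and the majorant tends to 0 jointly in
  p and t, because its exponent Re \<mu> - 1 - L is positive.\<close>

lemma continuous_on_legE_integrand:
  assumes bound: "\<And>x. x \<notin> \<real>\<^sub>\<le>\<^sub>0 \<Longrightarrow> norm (hyp32 \<nu> (- x)) \<le> K * (1 + norm x) ^ L"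
    and K: "K \<ge> 0" and \<mu>: "Re \<mu> > L + 1"
  shows "continuous_on ((- \<real>\<^sub>\<le>\<^sub>0) \<times> {0..1}) (\<lambda>(p, t). legE_integrand \<nu> \<mu> p t)"
  unfolding continuous_on_eq_continuous_within
proof (intro ballI, clarify)
  let ?U = "- \<real>\<^sub>\<le>\<^sub>0 :: complex set"
  fix p0 :: complex and t0 :: real assume p0: "p0 \<notin> \<real>\<^sub>\<le>\<^sub>0" and t0: "t0 \<in> {0..1}"
  show "continuous (at (p0, t0) within ?U \<times> {0..1}) (\<lambda>(p, t). legE_integrand \<nu> \<mu> p t)"
  proof (cases "t0 < 1")
    case True
    have "continuous_on (?U \<times> {0..<1}) (\<lambda>p. hyp32 \<nu> (- (fst p * of_real (snd p / (1 - snd p)))))"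
      by (rule continuous_on_compose2[OF holomorphic_on_imp_continuous_on[OF holomorphic_on_hyperF_reg]])
         (auto intro!: continuous_intros minus_mult_of_real_in_slit_plane simp del: of_real_divide)
    moreover have "continuous_on (?U \<times> {0..<1}) (\<lambda>p. complex_of_real (snd p) powr (1/2))"
      by (rule continuous_on_powr_complex) (auto intro!: continuous_intros)
    moreover have "continuous_on (?U \<times> {0..<1}) (\<lambda>p. complex_of_real (1 - snd p) powr (\<mu> - 1))"
      by (rule continuous_on_powr_complex) (auto intro!: continuous_intros)
    ultimately have "continuous_on (?U \<times> {0..<1}) (\<lambda>(p, t). legE_integrand \<nu> \<mu> p t)"
      unfolding legE_integrand_def split_beta by (intro continuous_on_mult)
    hence "continuous (at (p0, t0) within ?U \<times> {0..<1}) (\<lambda>(p, t). legE_integrand \<nu> \<mu> p t)"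
      using p0 t0 True by (auto simp: continuous_on_eq_continuous_within)
    moreover have "at (p0, t0) within ?U \<times> {0..1} = at (p0, t0) within ?U \<times> {0..<1}"
      by (rule at_within_nhd[of _ "UNIV \<times> {..<1}"]) (use True in \<open>auto intro!: open_Times\<close>)
    ultimately show ?thesis by simp
  next
    case False
    hence [simp]: "t0 = 1" using t0 by simp
    let ?g = "\<lambda>x::complex \<times> real. K * (1 + norm (fst x)) ^ L * (1 - snd x) powr (Re \<mu> - 1 - L)"
    have "continuous_on (?U \<times> {0..1}) (\<lambda>x. (1 - snd x) powr (Re \<mu> - 1 - L))"
      by (rule continuous_on_powr') (use \<mu> in \<open>auto intro!: continuous_intros\<close>)
    hence "continuous_on (?U \<times> {0..1}) ?g"
      by (intro continuous_on_mult) (auto intro!: continuous_intros)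
    from bspec[OF this[unfolded continuous_on_def], of "(p0, 1)"] p0
    have g: "(?g \<longlongrightarrow> 0) (at (p0, 1) within ?U \<times> {0..1})" by simp
    have "((\<lambda>x. legE_integrand \<nu> \<mu> (fst x) (snd x)) \<longlongrightarrow> 0) (at (p0, 1) within ?U \<times> {0..1})"
      by (rule Lim_null_comparison[OF _ g])
         (auto simp: eventually_at_filter intro!: always_eventually norm_legE_integrand_le[OF bound K])
    moreover have "legE_integrand \<nu> \<mu> p0 1 = 0" by (simp add: legE_integrand_def)
    ultimately show ?thesis by (simp add: continuous_within case_prod_unfold)
  qed
qed

lemma holomorphic_on_legE_integrand:
  assumes "t \<in> {0..1}"
  shows "(\<lambda>p. legE_integrand \<nu> \<mu> p t) holomorphic_on - \<real>\<^sub>\<le>\<^sub>0"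
proof -
  have "(hyp32 \<nu> \<circ> (\<lambda>p. - (p * of_real (t / (1 - t))))) holomorphic_on - \<real>\<^sub>\<le>\<^sub>0"
    using assms by (intro holomorphic_on_compose_gen[OF _ holomorphic_on_hyperF_reg])
      (auto intro!: holomorphic_intros minus_mult_of_real_in_slit_plane simp del: of_real_divide)
  thus ?thesis unfolding legE_integrand_def o_def by (intro holomorphic_intros)
qed

text \<open>The differential operator in p, applied to the integrand, gives an exact t-derivative
  whose primitive vanishes at both ends. Differentiation under the integral then yields the
  homogeneous equation.\<close>

lemma
  fixes K :: real and L :: nat
  assumes bound: "\<And>x. x \<notin> \<real>\<^sub>\<le>\<^sub>0 \<Longrightarrow> norm (hyp32 \<nu> (- x)) \<le> K * (1 + norm x) ^ L"
    and K: "K \<ge> 0" and \<mu>: "Re \<mu> > L + 1"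
  shows holomorphic_on_legE: "legE \<nu> \<mu> holomorphic_on - \<real>\<^sub>\<le>\<^sub>0"
    and legE_ODE: "\<And>p. p \<notin> \<real>\<^sub>\<le>\<^sub>0 \<Longrightarrow> p * (1 - p) * deriv (deriv (legE \<nu> \<mu>)) p + (1 - \<mu> - 2 * p) * deriv (legE \<nu> \<mu>) p + \<nu> * (\<nu> + 1) * legE \<nu> \<mu> p = 0"
proof -
  let ?U = "- \<real>\<^sub>\<le>\<^sub>0 :: complex set"
  let ?H = "hyp32 \<nu>"
  note op = open_Compl_nonpos_Reals
  note c0 = continuous_on_legE_integrand[OF bound K \<mu>]
  note h0 = holomorphic_on_legE_integrand[of _ \<nu> \<mu>]
  define E1 where "E1 p t = deriv (\<lambda>p. legE_integrand \<nu> \<mu> p t) p" for p t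
  have c1: "continuous_on (?U \<times> {0..1}) (\<lambda>(p, t). E1 p t)"
    unfolding E1_def by (rule continuous_on_deriv_param[OF op c0 h0])
  have h1: "(\<lambda>p. E1 p t) holomorphic_on ?U" if "t \<in> {0..1}" for t
    unfolding E1_def by (rule holomorphic_deriv[OF h0[OF that] op])
  define E2 where "E2 p t = deriv (\<lambda>p. E1 p t) p" for p t
  have c2: "continuous_on (?U \<times> {0..1}) (\<lambda>(p, t). E2 p t)"
    unfolding E2_def by (rule continuous_on_deriv_param[OF op c1 h1])
  have d0: "((\<lambda>p. legE \<nu> \<mu> p) has_field_derivative Gamma (\<mu> + 3/2) * integral {0..1} (E1 p)) (at p)" if "p \<in> ?U" for p
    unfolding legE_def E1_def by (intro DERIV_cmult has_field_derivative_integral_param[OF op c0 h0 that])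
  have d1: "((\<lambda>p. Gamma (\<mu> + 3/2) * integral {0..1} (E1 p)) has_field_derivative Gamma (\<mu> + 3/2) * integral {0..1} (E2 p)) (at p)" if "p \<in> ?U" for p
    unfolding E2_def by (intro DERIV_cmult has_field_derivative_integral_param[OF op c1 h1 that])
  show hol: "legE \<nu> \<mu> holomorphic_on ?U"
    using d0 unfolding holomorphic_on_def field_differentiable_def by (blast intro: has_field_derivative_at_within)
  have e1: "deriv (legE \<nu> \<mu>) p = Gamma (\<mu> + 3/2) * integral {0..1} (E1 p)" if "p \<in> ?U" for p
    using d0[OF that] by (rule DERIV_imp_deriv)
  have e2: "deriv (deriv (legE \<nu> \<mu>)) p = Gamma (\<mu> + 3/2) * integral {0..1} (E2 p)" if "p \<in> ?U" for p
    by (rule DERIV_imp_deriv, rule has_field_derivative_transform_within_open[OF d1[OF that] op that])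
       (simp add: e1)
  have holH: "?H holomorphic_on slit_plane" by (rule holomorphic_on_hyperF_reg)
  have holH': "deriv ?H holomorphic_on slit_plane" by (intro holomorphic_deriv holH open_slit_plane)
  fix p :: complex assume p: "p \<notin> \<real>\<^sub>\<le>\<^sub>0"
  define m where "m t = complex_of_real t powr (1 / 2) * complex_of_real (1 - t) powr (\<mu> - 1)" for t
  have E1: "E1 q t = - of_real (t / (1 - t)) * deriv ?H (- (q * of_real (t / (1 - t)))) * m t"
    if "q \<notin> \<real>\<^sub>\<le>\<^sub>0" "t \<in> {0..1}" for q t
  proof -
    have "- (q * of_real (t / (1 - t))) \<in> slit_plane" using that by (intro minus_mult_of_real_in_slit_plane) auto
    note D = holomorphic_derivI[OF holH open_slit_plane this, of UNIV]
    have "((\<lambda>q. ?H (- (q * of_real (t / (1 - t))))) has_field_derivative deriv ?H (- (q * of_real (t / (1 - t)))) * (- of_real (t / (1 - t)))) (at q)"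
      by (rule DERIV_chain2[where f = "?H" and g = "\<lambda>q. - (q * of_real (t / (1 - t)))", OF D])
         (auto intro!: derivative_eq_intros simp del: of_real_divide)
    from DERIV_cmult_right[OF this, of "m t"] show ?thesis
      unfolding E1_def legE_integrand_def m_def[symmetric] by (intro DERIV_imp_deriv) (simp add: mult_ac)
  qed
  have E2: "E2 p t = of_real (t / (1 - t)) ^ 2 * deriv (deriv ?H) (- (p * of_real (t / (1 - t)))) * m t"
    if t: "t \<in> {0..1}" for t
  proof -
    have "- (p * of_real (t / (1 - t))) \<in> slit_plane" using t p by (intro minus_mult_of_real_in_slit_plane) auto
    note D = holomorphic_derivI[OF holH' open_slit_plane this, of UNIV]
    have "((\<lambda>q. deriv ?H (- (q * of_real (t / (1 - t))))) has_field_derivative deriv (deriv ?H) (- (p * of_real (t / (1 - t)))) * (- of_real (t / (1 - t)))) (at p)"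
      by (rule DERIV_chain2[where f = "deriv ?H" and g = "\<lambda>q. - (q * of_real (t / (1 - t)))", OF D])
         (auto intro!: derivative_eq_intros simp del: of_real_divide)
    from DERIV_cmult[OF DERIV_cmult_right[OF this, of "m t"], of "- of_real (t / (1 - t))"]
    have "((\<lambda>p. E1 p t) has_field_derivative of_real (t / (1 - t)) ^ 2 * deriv (deriv ?H) (- (p * of_real (t / (1 - t)))) * m t) (at p)"
      by (rule has_field_derivative_transform_within_open[OF DERIV_cong op])
         (use p t in \<open>auto simp: E1 power2_eq_square mult_ac simp del: of_real_divide\<close>)
    thus ?thesis unfolding E2_def by (rule DERIV_imp_deriv)
  qed
  \<comment> \<open>The primitive: up to sign t times the weight times the derivative of the kernel.
    It vanishes at 0 through t and at 1 through the factor 1 - t.\<close>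
  define T where "T t = of_real (1 - t) * E1 p t" for t :: real
  define G where "G t = p * (1 - p) * E2 p t + (1 - \<mu> - 2 * p) * E1 p t + \<nu> * (\<nu> + 1) * legE_integrand \<nu> \<mu> p t" for t
  have "(G has_integral T 1 - T 0) {0..1}"
  proof (rule fundamental_theorem_of_calculus_interior)
    show "continuous_on {0..1} T" unfolding T_def
      using continuous_on_param_slice[OF c1, of p] p by (intro continuous_intros) auto
    fix t :: real assume t: "t \<in> {0<..<1}"
    \<comment> \<open>The derivative is computed in a complex variable at the point t and only
      afterwards restricted to the real line.\<close>
    define z where "z = complex_of_real t"
    have z: "z \<noteq> 0" "1 - z \<noteq> 0" "z \<notin> \<real>\<^sub>\<le>\<^sub>0" "1 - z \<notin> \<real>\<^sub>\<le>\<^sub>0"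
      using t unfolding z_def by (auto simp: complex_nonpos_Reals_iff complex_eq_iff)
    have sz: "of_real (t / (1 - t)) = z / (1 - z)" by (simp add: z_def)
    have ws: "- (p * (z / (1 - z))) \<in> slit_plane"
      using minus_mult_of_real_in_slit_plane[OF p, of "t / (1 - t)"] t by (simp add: sz[symmetric] del: of_real_divide)
    let ?w = "- (p * (z / (1 - z)))"
    let ?h = "?H ?w" and ?h1 = "deriv ?H ?w" and ?h2 = "deriv (deriv ?H) ?w"
    let ?W = "z powr (1/2) * (1 - z) powr (\<mu> - 1)"
    have ode: "?w * (1 - ?w) * ?h2 + (3 / 2 - (\<nu> + 1 + - \<nu> + 1) * ?w) * ?h1 - (\<nu> + 1) * (- \<nu>) * ?h = 0"
      by (rule hyperF_reg_ODE[OF ws])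
    have d1: "((\<lambda>z. deriv ?H (- (p * (z / (1 - z))))) has_field_derivative ?h2 * (- p / (1 - z)\<^sup>2)) (at z)"
      by (rule DERIV_chain2[where f = "deriv ?H" and g = "\<lambda>z. - (p * (z / (1 - z)))", OF holomorphic_derivI[OF holH' open_slit_plane ws, of UNIV]])
         (use z in \<open>auto intro!: derivative_eq_intros simp: power2_eq_square field_simps\<close>)
    have d2: "((\<lambda>z. z powr (1/2)) has_field_derivative z powr (1/2) * (1 / (2 * z))) (at z)"
    proof -
      have "z powr - (1/2) = z powr (1/2) / z" using powr_diff[of z "1/2" 1] z by simp
      thus ?thesis using z by (auto intro!: derivative_eq_intros)
    qed
    have d3: "((\<lambda>z. (1 - z) powr (\<mu> - 1)) has_field_derivative (1 - z) powr (\<mu> - 1) * (- (\<mu> - 1) / (1 - z))) (at z)"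
    proof -
      have "(1 - z) powr (\<mu> - 1 - 1) = (1 - z) powr (\<mu> - 1) / (1 - z)" using z by (subst powr_diff) auto
      thus ?thesis using z by (auto intro!: derivative_eq_intros simp: divide_inverse algebra_simps)
    qed
    define c1 c2 c3 where "c1 = ?h2 * (- p / (1 - z)\<^sup>2)" and "c2 = 1 / (2 * z)" and "c3 = - (\<mu> - 1) / (1 - z)"
    have "((\<lambda>z. - z * (z powr (1/2) * (1 - z) powr (\<mu> - 1)) * deriv ?H (- (p * (z / (1 - z))))) has_field_derivative
       (- ?W - z * (?W * c2 + ?W * c3)) * ?h1 + (- z * ?W) * c1) (at z)"
      by (rule DERIV_cong[OF DERIV_mult[OF DERIV_mult[OF DERIV_minus[OF DERIV_ident]
            DERIV_mult[OF d2[folded c2_def] d3[folded c3_def]]] d1[folded c1_def]]]) (simp add: algebra_simps)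
    hence "((\<lambda>z. - z * (z powr (1/2) * (1 - z) powr (\<mu> - 1)) * deriv ?H (- (p * (z / (1 - z))))) has_field_derivative
       (- ?W - z * (?W * (1 / (2 * z)) + ?W * (- (\<mu> - 1) / (1 - z)))) * ?h1 + (- z * ?W) * (?h2 * (- p / (1 - z)\<^sup>2))) (at z)"
      unfolding c1_def c2_def c3_def .
    moreover have "(- ?W - z * (?W * (1 / (2 * z)) + ?W * (- (\<mu> - 1) / (1 - z)))) * ?h1 + (- z * ?W) * (?h2 * (- p / (1 - z)\<^sup>2))
       = ?W * (p * z / (1 - z)\<^sup>2 * ?h2 - (3/2 - (\<mu> - 1) * (z / (1 - z))) * ?h1)"
      using z by (simp add: field_simps)
    moreover have "\<dots> = ?W * (p * (1 - p) * ((z / (1 - z))\<^sup>2 * ?h2) - (1 - \<mu> - 2 * p) * ((z / (1 - z)) * ?h1) + \<nu> * (\<nu> + 1) * ?h)"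
    proof -
      \<comment> \<open>In terms of \<sigma> = t/(1 - t) what remains is the hypergeometric equation
        of the kernel at -p\<sigma>, used to eliminate its undifferentiated term.\<close>
      define \<sigma> where "\<sigma> = z / (1 - z)"
      have "z / (1 - z)\<^sup>2 = \<sigma> * (\<sigma> + 1)" unfolding \<sigma>_def using z by (simp add: field_simps power2_eq_square)
      hence s2: "p * z / (1 - z)\<^sup>2 = p * (\<sigma> * (\<sigma> + 1))" by (metis times_divide_eq_right)
      have "\<nu> * (\<nu> + 1) * ?h = p * \<sigma> * (1 + p * \<sigma>) * ?h2 - (3/2 + 2 * p * \<sigma>) * ?h1"
        using ode unfolding \<sigma>_def[symmetric] by (simp add: algebra_simps)
      thus ?thesis unfolding s2 \<sigma>_def[symmetric] by (simp only: ) (simp add: algebra_simps power2_eq_square)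
    qed
    moreover have "\<dots> = G t"
    proof -
      have mt: "m t = ?W" by (simp add: m_def z_def)
      have tt: "t \<in> {0..1}" using t by auto
      show ?thesis unfolding G_def E1[OF p tt] E2[OF tt] legE_integrand_def m_def[symmetric] mt sz by (simp add: algebra_simps)
    qed
    ultimately have "((\<lambda>z. - z * (z powr (1/2) * (1 - z) powr (\<mu> - 1)) * deriv ?H (- (p * (z / (1 - z))))) has_field_derivative G t) (at (of_real t))"
      by (simp only: z_def)
    hence "((\<lambda>t. - of_real t * (of_real t powr (1/2) * (1 - of_real t) powr (\<mu> - 1)) * deriv ?H (- (p * (of_real t / (1 - of_real t))))) has_vector_derivative G t) (at t)"
      by (rule has_vector_derivative_real_field)
    thus "(T has_vector_derivative G t) (at t)"
    proof (rule has_vector_derivative_transform_within_open[of _ _ _ "{0<..<1}"])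
      fix s :: real assume s: "s \<in> {0<..<1}"
      hence "complex_of_real (1 - s) \<noteq> 0" by simp
      moreover have "s \<in> {0..1}" using s by auto
      ultimately show "- of_real s * (of_real s powr (1/2) * (1 - of_real s) powr (\<mu> - 1)) * deriv ?H (- (p * (of_real s / (1 - of_real s)))) = T s"
        unfolding T_def by (subst E1[OF p]) (auto simp: m_def)
    qed (use t in auto)
  qed simp
  moreover have "T 1 - T 0 = 0" unfolding T_def by (simp add: E1[OF p])
  ultimately have "(G has_integral 0) {0..1}" by simp
  moreover have "(G has_integral p * (1 - p) * integral {0..1} (E2 p) + (1 - \<mu> - 2 * p) * integral {0..1} (E1 p) + \<nu> * (\<nu> + 1) * integral {0..1} (legE_integrand \<nu> \<mu> p)) {0..1}"
    unfolding G_def using p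
    by (intro has_integral_add has_integral_mult_right integrable_integral integrable_continuous_real
        continuous_on_param_slice[OF c0] continuous_on_param_slice[OF c1] continuous_on_param_slice[OF c2]) auto
  ultimately have "p * (1 - p) * integral {0..1} (E2 p) + (1 - \<mu> - 2 * p) * integral {0..1} (E1 p) + \<nu> * (\<nu> + 1) * integral {0..1} (legE_integrand \<nu> \<mu> p) = 0"
    by (rule has_integral_unique[symmetric])
  hence "Gamma (\<mu> + 3/2) * (p * (1 - p) * integral {0..1} (E2 p) + (1 - \<mu> - 2 * p) * integral {0..1} (E1 p) + \<nu> * (\<nu> + 1) * integral {0..1} (legE_integrand \<nu> \<mu> p)) = 0"
    by simp
  thus "p * (1 - p) * deriv (deriv (legE \<nu> \<mu>)) p + (1 - \<mu> - 2 * p) * deriv (legE \<nu> \<mu>) p + \<nu> * (\<nu> + 1) * legE \<nu> \<mu> p = 0"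
    using p by (simp add: e1 e2 legE_def algebra_simps)
qed

text \<open>By difference of squares the factor with k = n + 1 is -4 (\<nu> + 1 + n)(-\<nu> + n).
  The power 2^n comes from the expansion variable 2p; (-4)^n 2^n / 8^n leaves only a sign.\<close>

lemma a_coeff_pochhammer:
  "a_coeff n (\<nu> + 1 / 2) * 2 ^ n = (- 1) ^ n * (pochhammer (\<nu> + 1) n * pochhammer (- \<nu>) n) / fact n"
proof -
  have "(\<Prod>k=1..n. 4 * (\<nu> + 1 / 2)\<^sup>2 - (2 * of_nat k - 1)\<^sup>2) = (- 4) ^ n * (pochhammer (\<nu> + 1) n * pochhammer (- \<nu>) n)"
  proof (induction n)
    case (Suc n)
    have "(\<Prod>k=1..Suc n. 4 * (\<nu> + 1 / 2)\<^sup>2 - (2 * of_nat k - 1)\<^sup>2) =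
      (- 4) ^ n * (pochhammer (\<nu> + 1) n * pochhammer (- \<nu>) n) * (4 * (\<nu> + 1 / 2)\<^sup>2 - (2 * of_nat (Suc n) - 1)\<^sup>2)"
      using Suc by (simp add: mult_ac)
    also have "4 * (\<nu> + 1 / 2)\<^sup>2 - (2 * of_nat (Suc n) - 1)\<^sup>2 = (- 4) * ((\<nu> + 1 + of_nat n) * (- \<nu> + of_nat n))"
      by (simp add: power2_eq_square field_simps)
    finally show ?case by (simp only: pochhammer_Suc power_Suc mult_ac)
  qed simp
  moreover have "(- 4) ^ n * 2 ^ n = (- 1) ^ n * (8 :: complex) ^ n"
    by (simp flip: power_mult_distrib)
  ultimately show ?thesis by (simp add: a_coeff_def field_simps)
qed

text \<open>Each power of t/(1 - t) moves one unit from the second Beta parameter to the first. The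
  resulting \<Gamma>(n + 3/2) cancels against the regularized coefficient and \<Gamma>(\<mu> + 3/2)
  against the prefactor of \<open>legE\<close>, leaving \<Gamma>(\<mu> - n).\<close>

lemma legE_integrand_Taylor_term:
  assumes \<mu>: "Re \<mu> > n + 1"
  shows "((\<lambda>t. hyp32_coeff \<nu> n * (- (p * of_real (t / (1 - t)))) ^ n * (of_real t powr (1 / 2) * of_real (1 - t) powr (\<mu> - 1)))
     has_integral hyp32_coeff \<nu> n * (- p) ^ n * Beta (of_nat n + 3/2) (\<mu> - of_nat n)) {0..1}"
proof -
  have "((\<lambda>t. hyp32_coeff \<nu> n * (- p) ^ n * (of_real t powr (of_nat n + 3/2 - 1) * of_real (1 - t) powr (\<mu> - of_nat n - 1)))
     has_integral hyp32_coeff \<nu> n * (- p) ^ n * Beta (of_nat n + 3/2) (\<mu> - of_nat n)) {0..1}"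
    using \<mu> by (intro has_integral_mult_right has_integral_Beta_complex) auto
  thus ?thesis
  proof (rule has_integral_eq[rotated])
    fix t :: real assume t: "t \<in> {0..1}"
    show "hyp32_coeff \<nu> n * (- p) ^ n * (of_real t powr (of_nat n + 3/2 - 1) * of_real (1 - t) powr (\<mu> - of_nat n - 1)) =
      hyp32_coeff \<nu> n * (- (p * of_real (t / (1 - t)))) ^ n * (of_real t powr (1 / 2) * of_real (1 - t) powr (\<mu> - 1))"
    proof (cases "t = 0 \<or> t = 1")
      case False
      define z where "z = complex_of_real t"
      define y where "y = complex_of_real (1 - t)"
      have nz: "z \<noteq> 0" "y \<noteq> 0" using False t by (auto simp: z_def y_def complex_eq_iff)
      have "z powr (of_nat n + 3/2 - 1) = z powr (of_nat n + 1/2)" by (simp add: add.commute)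
      also have "\<dots> = z ^ n * z powr (1/2)" using nz by (simp only: powr_add powr_nat if_False)
      finally have 1: "z powr (of_nat n + 3/2 - 1) = z ^ n * z powr (1/2)" .
      have "\<mu> - of_nat n - 1 = (\<mu> - 1) - of_nat n" by simp
      hence 2: "y powr (\<mu> - of_nat n - 1) = y powr (\<mu> - 1) / y ^ n" using nz by (simp only: powr_diff powr_nat if_False)
      have "complex_of_real (t / (1 - t)) = z / y" by (simp add: z_def y_def)
      thus ?thesis unfolding z_def[symmetric] y_def[symmetric] 1 2
        by (simp add: power_minus[of p] power_minus[of "p * z / y"] power_divide power_mult_distrib mult_ac)
    qed auto
  qed
qed

text \<open>Recovers the \<open>L\<close> powers of 1 - t lost to the growth of the kernel. After
  the common Gamma factors are removed, two Pochhammer symbols of length L are compared factor by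
  factor, and for large m each factor on the left is at most twice the one on the right.\<close>

lemma Gamma_ratio_bound:
  fixes m :: real
  assumes m: "m \<ge> 2 * (real N + real L) + 2"
  shows "Gamma (m + 3/2) * Beta (real N + 3/2) (m - N - L) \<le> Gamma (real N + 3/2) * 2 ^ L * Gamma (m - N)"
proof -
  let ?a = "m - N - L"
  let ?b = "m + 3/2 - L"
  have a: "?a > 0" and b: "?b > 0" using m by auto
  have na: "?a \<notin> \<int>\<^sub>\<le>\<^sub>0" "?b \<notin> \<int>\<^sub>\<le>\<^sub>0" using a b by (auto simp del: of_nat_add elim!: nonpos_Ints_cases)
  have 1: "pochhammer ?b L = Gamma (m + 3/2) / Gamma ?b" using pochhammer_Gamma[OF na(2), of L] by simp
  have 2: "pochhammer ?a L = Gamma (m - N) / Gamma ?a" using pochhammer_Gamma[OF na(1), of L] by simp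
  have "pochhammer ?b L \<le> (\<Prod>i<L. 2 * (?a + i))" unfolding pochhammer_prod atLeast0LessThan
    using m b by (intro prod_mono) (auto simp: field_simps)
  also have "\<dots> = 2 ^ L * pochhammer ?a L" unfolding pochhammer_prod atLeast0LessThan
    using prod.distrib[of "\<lambda>_. 2" "\<lambda>i. ?a + real i" "{..<L}"] by simp
  finally have "Gamma (m + 3/2) / Gamma ?b \<le> 2 ^ L * (Gamma (m - N) / Gamma ?a)" unfolding 1 2 .
  hence "Gamma (m + 3/2) / Gamma ?b * (Gamma (real N + 3/2) * Gamma ?a) \<le> 2 ^ L * (Gamma (m - N) / Gamma ?a) * (Gamma (real N + 3/2) * Gamma ?a)"
    using a by (intro mult_right_mono mult_nonneg_nonneg) (auto intro!: less_imp_le Gamma_real_pos)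
  moreover have "Gamma ?a > 0" using a by simp
  moreover have "real N + 3/2 + ?a = ?b" by simp
  ultimately show ?thesis unfolding Beta_def by (simp add: field_simps)
qed

text \<open>The Taylor polynomial of the kernel integrates exactly to the partial sum, and the bound
  on its remainder is a real Beta integral. All constants depend only on B, C, Y and N. Analyticity
  and the differential equation are returned with the same threshold.\<close>

lemma legE_expansion:
  fixes B C Y :: real and N :: nat
  assumes B: "B \<ge> 0" and C: "C \<ge> 0" and Y: "Y \<ge> 0"
  obtains K R :: real where "K \<ge> 0" 
    "\<And>\<nu> \<mu> p. norm \<nu> \<le> B \<Longrightarrow> \<bar>Im \<mu>\<bar> \<le> Y \<Longrightarrow> R \<le> Re \<mu> \<Longrightarrow> p \<notin> \<real>\<^sub>\<le>\<^sub>0 \<Longrightarrow> norm p \<le> C \<Longrightarrow>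
       norm (legE \<nu> \<mu> p - (\<Sum>n<N. a_coeff n (\<nu> + 1/2) * Gamma (\<mu> - of_nat n) * (2 * p) ^ n)) \<le> K * (norm (Gamma (\<mu> - of_nat N)) * norm p ^ N)"
    "\<And>\<nu> \<mu>. norm \<nu> \<le> B \<Longrightarrow> R \<le> Re \<mu> \<Longrightarrow> legE \<nu> \<mu> holomorphic_on - \<real>\<^sub>\<le>\<^sub>0"
    "\<And>\<nu> \<mu> p. norm \<nu> \<le> B \<Longrightarrow> R \<le> Re \<mu> \<Longrightarrow> p \<notin> \<real>\<^sub>\<le>\<^sub>0 \<Longrightarrow>
        p * (1 - p) * deriv (deriv (legE \<nu> \<mu>)) p + (1 - \<mu> - 2 * p) * deriv (legE \<nu> \<mu>) p + \<nu> * (\<nu> + 1) * legE \<nu> \<mu> p = 0"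
proof -
  obtain K0 L0 where K0: "K0 \<ge> 0" and bound0: "\<And>\<nu> x. norm \<nu> \<le> B \<Longrightarrow> x \<notin> \<real>\<^sub>\<le>\<^sub>0 \<Longrightarrow>
       norm (hyp32 \<nu> (- x) - (\<Sum>n<0. hyp32_coeff \<nu> n * (- x) ^ n)) \<le> K0 * norm x ^ 0 * (1 + norm x) ^ L0"
    using hyp32_Taylor_remainder[OF B, of 0] by blast
  hence bound0: "\<And>\<nu> x. norm \<nu> \<le> B \<Longrightarrow> x \<notin> \<real>\<^sub>\<le>\<^sub>0 \<Longrightarrow> norm (hyp32 \<nu> (- x)) \<le> K0 * (1 + norm x) ^ L0"
    by simp
  obtain K1 L where K1: "K1 \<ge> 0" and bound: "\<And>\<nu> x. norm \<nu> \<le> B \<Longrightarrow> x \<notin> \<real>\<^sub>\<le>\<^sub>0 \<Longrightarrow>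
       norm (hyp32 \<nu> (- x) - (\<Sum>n<N. hyp32_coeff \<nu> n * (- x) ^ n)) \<le> K1 * norm x ^ N * (1 + norm x) ^ L"
    using hyp32_Taylor_remainder[OF B, of N] by blast
  \<comment> \<open>The first entry is the hypothesis of the Gamma ratio bound, the second
    guarantees Re \<mu> > L0 + 1 as needed for continuity of the integrand.\<close>
  define R where "R = max (2 * (real N + real L) + 2) (real L0 + 2)"
  \<comment> \<open>Kernel growth on |p| \<le> C gives (1 + C)^L, the ratio bound gives \<Gamma>(N +
    3/2) 2^L, and exp(Y^2) is the price for replacing \<Gamma>(Re \<mu> - N) by |\<Gamma>(\<mu> -
    N)|.\<close>
  define K where "K = K1 * (1 + C) ^ L * (Gamma (real N + 3/2) * 2 ^ L * exp (Y\<^sup>2))"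
  have GN: "Gamma (real N + 3/2) > 0" by (intro Gamma_real_pos) auto
  have Kpos: "K \<ge> 0" unfolding K_def using K1 C GN by (intro mult_nonneg_nonneg) auto
  have main: "norm (legE \<nu> \<mu> p - (\<Sum>n<N. a_coeff n (\<nu> + 1/2) * Gamma (\<mu> - of_nat n) * (2 * p) ^ n)) \<le> K * (norm (Gamma (\<mu> - of_nat N)) * norm p ^ N)"
    if \<nu>: "norm \<nu> \<le> B" and Im: "\<bar>Im \<mu>\<bar> \<le> Y" and Re: "R \<le> Re \<mu>" and p: "p \<notin> \<real>\<^sub>\<le>\<^sub>0" "norm p \<le> C" for \<nu> \<mu> p
  proof -
    define m where "m = Re \<mu>"
    have m: "m \<ge> 2 * (real N + real L) + 2" "m \<ge> real L0 + 2" using Re by (auto simp: R_def m_def)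
    define w where "w t = complex_of_real t powr (1 / 2) * complex_of_real (1 - t) powr (\<mu> - 1)" for t
    define x where "x t = p * complex_of_real (t / (1 - t))" for t
    define r where "r t = (hyp32 \<nu> (- x t) - (\<Sum>n<N. hyp32_coeff \<nu> n * (- x t) ^ n)) * w t" for t
    have cE: "continuous_on {0..1} (legE_integrand \<nu> \<mu> p)"
      by (rule continuous_on_param_slice[OF continuous_on_legE_integrand[OF bound0[OF \<nu>] K0]]) (use m p in \<open>auto simp: m_def\<close>)
    have E: "(legE_integrand \<nu> \<mu> p has_integral integral {0..1} (legE_integrand \<nu> \<mu> p)) {0..1}"
      by (intro integrable_integral integrable_continuous_real cE)
    have S: "((\<lambda>t. \<Sum>n<N. hyp32_coeff \<nu> n * (- x t) ^ n * w t) has_integral (\<Sum>n<N. hyp32_coeff \<nu> n * (- p) ^ n * Beta (of_nat n + 3/2) (\<mu> - of_nat n))) {0..1}"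
      unfolding x_def w_def using m by (intro has_integral_sum legE_integrand_Taylor_term) (auto simp: m_def)
    have r: "(r has_integral integral {0..1} (legE_integrand \<nu> \<mu> p) - (\<Sum>n<N. hyp32_coeff \<nu> n * (- p) ^ n * Beta (of_nat n + 3/2) (\<mu> - of_nat n))) {0..1}"
      using has_integral_diff[OF E S] by (rule has_integral_eq[rotated]) (simp add: r_def legE_integrand_def x_def w_def left_diff_distrib sum_distrib_right)
    have "((\<lambda>t. K1 * norm p ^ N * (1 + C) ^ L * (t powr (real N + 3/2 - 1) * (1 - t) powr (m - N - L - 1))) has_integral
        K1 * norm p ^ N * (1 + C) ^ L * Beta (real N + 3/2) (m - N - L)) {0..1}"
      using m by (intro has_integral_mult_right has_integral_Beta_real) auto
    moreover have "norm (r t) \<le> K1 * norm p ^ N * (1 + C) ^ L * (t powr (real N + 3/2 - 1) * (1 - t) powr (m - N - L - 1))" if t: "t \<in> {0..1}" for t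
    proof (cases "t = 0 \<or> t = 1")
      case True
      thus ?thesis by (auto simp: r_def w_def)
    next
      case False
      hence t: "0 < t" "t < 1" using t by auto
      have nx: "norm (x t) = norm p * (t / (1 - t))" using t unfolding x_def norm_mult norm_of_real by simp
      have 1: "1 + norm (x t) \<le> (1 + C) / (1 - t)"
      proof -
        have "1 + norm p * (t / (1 - t)) = ((1 - t) + norm p * t) / (1 - t)" using t by (simp add: field_simps)
        also have "(1 - t) + norm p * t \<le> 1 + C * 1" using t p C by (intro add_mono mult_mono) auto
        finally show ?thesis using t by (simp add: nx divide_right_mono)
      qed
      have "norm (r t) \<le> K1 * norm (x t) ^ N * (1 + norm (x t)) ^ L * norm (w t)"
        unfolding r_def norm_mult using t p by (intro mult_right_mono bound \<nu>) (simp_all only: x_def norm_ge_zero mult_of_real_notin_nonpos_Reals divide_pos_pos diff_gt_0_iff_gt not_False_eq_True)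
      also have "norm (w t) = t powr (1/2) * (1 - t) powr (m - 1)"
        using t unfolding w_def norm_mult by (simp add: norm_powr_real_powr m_def del: of_real_diff)
      also have "K1 * norm (x t) ^ N * (1 + norm (x t)) ^ L * (t powr (1/2) * (1 - t) powr (m - 1))
        \<le> K1 * norm (x t) ^ N * ((1 + C) / (1 - t)) ^ L * (t powr (1/2) * (1 - t) powr (m - 1))"
        using K1 1 by (intro mult_right_mono mult_left_mono power_mono) auto
      also have "\<dots> = K1 * norm p ^ N * (1 + C) ^ L * ((t powr (1/2) * t ^ N) * ((1 - t) powr (m - 1) / (1 - t) ^ N / (1 - t) ^ L))"
        by (simp add: nx power_divide power_mult_distrib)
      also have "t powr (1/2) * t ^ N = t powr (real N + 3/2 - 1)" using t by (simp add: powr_add powr_realpow)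
      also have "(1 - t) powr (m - 1) / (1 - t) ^ N / (1 - t) ^ L = (1 - t) powr (m - 1 - N - L)"
        using t by (simp add: powr_diff powr_realpow)
      also have "m - 1 - N - L = m - N - L - 1" by simp
      finally show ?thesis .
    qed
    ultimately have "norm (integral {0..1} (legE_integrand \<nu> \<mu> p) - (\<Sum>n<N. hyp32_coeff \<nu> n * (- p) ^ n * Beta (of_nat n + 3/2) (\<mu> - of_nat n))) \<le> K1 * norm p ^ N * (1 + C) ^ L * Beta (real N + 3/2) (m - N - L)"
      using r by (metis (no_types, lifting) has_integral_integrable has_integral_iff integral_norm_bound_integral)
    hence "norm (Gamma (\<mu> + 3/2)) * norm (integral {0..1} (legE_integrand \<nu> \<mu> p) - (\<Sum>n<N. hyp32_coeff \<nu> n * (- p) ^ n * Beta (of_nat n + 3/2) (\<mu> - of_nat n)))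
       \<le> Gamma (m + 3/2) * (K1 * norm p ^ N * (1 + C) ^ L * Beta (real N + 3/2) (m - N - L))"
      using norm_Gamma_le[of "\<mu> + 3/2"] m by (intro mult_mono) (auto simp: m_def)
    also have "\<dots> = K1 * norm p ^ N * (1 + C) ^ L * (Gamma (m + 3/2) * Beta (real N + 3/2) (m - N - L))" by simp
    also have "\<dots> \<le> K1 * norm p ^ N * (1 + C) ^ L * (Gamma (real N + 3/2) * 2 ^ L * (exp (Y\<^sup>2) * norm (Gamma (\<mu> - of_nat N))))"
    proof (intro mult_left_mono order.trans[OF Gamma_ratio_bound[OF m(1)]])
      have "Gamma (Re (\<mu> - of_nat N)) \<le> exp ((Im (\<mu> - of_nat N))\<^sup>2) * norm (Gamma (\<mu> - of_nat N))"
        using m by (intro Gamma_Re_le) (auto simp: m_def)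
      also have "\<dots> \<le> exp (Y\<^sup>2) * norm (Gamma (\<mu> - of_nat N))" using Im Y by (intro mult_right_mono) (auto simp flip: abs_le_square_iff)
      finally show "Gamma (m - N) \<le> exp (Y\<^sup>2) * norm (Gamma (\<mu> - of_nat N))" by (simp add: m_def)
    qed (use K1 C GN in auto)
    finally have fin: "norm (Gamma (\<mu> + 3/2) * (integral {0..1} (legE_integrand \<nu> \<mu> p) - (\<Sum>n<N. hyp32_coeff \<nu> n * (- p) ^ n * Beta (of_nat n + 3/2) (\<mu> - of_nat n)))) \<le> K * (norm (Gamma (\<mu> - of_nat N)) * norm p ^ N)"
      by (simp add: norm_mult K_def mult_ac)
    have "Gamma (\<mu> + 3/2) * (hyp32_coeff \<nu> n * (- p) ^ n * Beta (of_nat n + 3/2) (\<mu> - of_nat n)) = a_coeff n (\<nu> + 1/2) * Gamma (\<mu> - of_nat n) * (2 * p) ^ n" for n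
    proof -
      have "Re (\<mu> + 3/2) > 0" "Re (of_nat n + 3/2 :: complex) > 0" using m by (auto simp: m_def)
      hence "Gamma (\<mu> + 3/2) \<noteq> 0" "Gamma (of_nat n + 3/2 :: complex) \<noteq> 0"
        unfolding Gamma_eq_zero_iff by (blast dest: notin_nonpos_Ints_if_Re_pos)+
      moreover have "rGamma (3/2 + of_nat n :: complex) = 1 / Gamma (of_nat n + 3/2)" by (simp only: rGamma_inverse_Gamma add.commute inverse_eq_divide)
      moreover have "of_nat n + 3/2 + (\<mu> - of_nat n) = \<mu> + 3/2" by simp
      ultimately have "Gamma (\<mu> + 3/2) * (hyp32_coeff \<nu> n * (- p) ^ n * Beta (of_nat n + 3/2) (\<mu> - of_nat n))
        = (pochhammer (\<nu> + 1) n * pochhammer (- \<nu>) n / fact n) * (- p) ^ n * Gamma (\<mu> - of_nat n)"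
        unfolding hyp_coeff_def Beta_def by (simp add: add.commute[of "3/2" \<mu>])
      also have "\<dots> = (a_coeff n (\<nu> + 1 / 2) * 2 ^ n) * p ^ n * Gamma (\<mu> - of_nat n)"
        unfolding a_coeff_pochhammer by (simp add: power_minus[of p])
      finally show ?thesis by (simp add: power_mult_distrib mult_ac)
    qed
    hence "Gamma (\<mu> + 3/2) * (integral {0..1} (legE_integrand \<nu> \<mu> p) - (\<Sum>n<N. hyp32_coeff \<nu> n * (- p) ^ n * Beta (of_nat n + 3/2) (\<mu> - of_nat n)))
       = legE \<nu> \<mu> p - (\<Sum>n<N. a_coeff n (\<nu> + 1/2) * Gamma (\<mu> - of_nat n) * (2 * p) ^ n)"
      by (simp add: right_diff_distrib sum_distrib_left legE_def)
    with fin show ?thesis by simp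
  qed
  have hol: "legE \<nu> \<mu> holomorphic_on - \<real>\<^sub>\<le>\<^sub>0" if "norm \<nu> \<le> B" "R \<le> Re \<mu>" for \<nu> \<mu>
    by (rule holomorphic_on_legE[OF bound0[OF that(1)] K0]) (use that in \<open>auto simp: R_def\<close>)
  have ode: "p * (1 - p) * deriv (deriv (legE \<nu> \<mu>)) p + (1 - \<mu> - 2 * p) * deriv (legE \<nu> \<mu>) p + \<nu> * (\<nu> + 1) * legE \<nu> \<mu> p = 0"
    if "norm \<nu> \<le> B" "R \<le> Re \<mu>" "p \<notin> \<real>\<^sub>\<le>\<^sub>0" for \<nu> \<mu> p
    by (rule legE_ODE[OF bound0[OF that(1)] K0 _ that(3)]) (use that in \<open>auto simp: R_def\<close>)
  show ?thesis by (rule that[OF Kpos main hol ode])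
qed

section \<open>Connection formulas from the differential equation\<close>

text \<open>The hypergeometric equation with parameters \<nu> + 1, -\<nu>, 1 - \<mu> when k = \<nu>
  (\<nu> + 1), written as a first order system. Carrying the derivative as a separate function
  spares second derivatives of products with powers.\<close>

definition leg_sol :: "complex set \<Rightarrow> complex \<Rightarrow> complex \<Rightarrow> (complex \<Rightarrow> complex) \<Rightarrow> (complex \<Rightarrow> complex) \<Rightarrow> bool" where
  "leg_sol \<Omega> \<mu> k f f1 \<longleftrightarrow> (\<forall>w\<in>\<Omega>. (f has_field_derivative f1 w) (at w) \<and>
     (f1 has_field_derivative - ((1 - \<mu> - 2 * w) * f1 w + k * f w) / (w * (1 - w))) (at w))"

lemma leg_solD:
  assumes "leg_sol \<Omega> \<mu> k f f1" "w \<in> \<Omega>"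
  shows "(f has_field_derivative f1 w) (at w)"
    "(f1 has_field_derivative - ((1 - \<mu> - 2 * w) * f1 w + k * f w) / (w * (1 - w))) (at w)"
  using assms by (auto simp: leg_sol_def)

lemma leg_sol_holomorphic:
  assumes "leg_sol \<Omega> \<mu> k f f1" "open \<Omega>"
  shows "f holomorphic_on \<Omega>"
  using assms by (auto simp: leg_sol_def holomorphic_on_open)

text \<open>Abel's formula. The first order coefficient is (1 - \<mu>)/w - (1 + \<mu>)/(1 - w), and
  the powers in front are its integrating factor.\<close>

lemma leg_sol_Wronskian:
  assumes \<Omega>: "open \<Omega>" "connected \<Omega>" and sub: "\<And>w. w \<in> \<Omega> \<Longrightarrow> w \<notin> \<real>\<^sub>\<le>\<^sub>0 \<and> 1 - w \<notin> \<real>\<^sub>\<le>\<^sub>0"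
    and f: "leg_sol \<Omega> \<mu> k f f1" and g: "leg_sol \<Omega> \<mu> k g g1"
  obtains c where "\<And>w. w \<in> \<Omega> \<Longrightarrow> w powr (1 - \<mu>) * (1 - w) powr (1 + \<mu>) * (f w * g1 w - f1 w * g w) = c"
proof -
  have "(\<lambda>w. w powr (1 - \<mu>) * (1 - w) powr (1 + \<mu>) * (f w * g1 w - f1 w * g w)) constant_on \<Omega>"
  proof (rule has_field_derivative_0_imp_constant_on[OF _ \<Omega>(2,1)])
    fix w assume w: "w \<in> \<Omega>"
    have nz: "w \<noteq> 0" "1 - w \<noteq> 0" using sub[OF w] by auto
    define a b where "a = w powr (1 - \<mu>)" and "b = (1 - w) powr (1 + \<mu>)"
    have d1: "((\<lambda>w. w powr (1 - \<mu>)) has_field_derivative a * (1 - \<mu>) / w) (at w)"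
    proof -
      have "w powr (1 - \<mu> - 1) = a / w" unfolding a_def using nz by (subst powr_diff) auto
      thus ?thesis using sub[OF w] by (auto intro!: derivative_eq_intros)
    qed
    have d2: "((\<lambda>w. (1 - w) powr (1 + \<mu>)) has_field_derivative - b * (1 + \<mu>) / (1 - w)) (at w)"
    proof -
      have "(1 - w) powr (1 + \<mu> - 1) = b / (1 - w)" unfolding b_def using nz by (subst powr_diff) auto
      thus ?thesis using sub[OF w] by (auto intro!: derivative_eq_intros)
    qed
    define f2 g2 where "f2 = - ((1 - \<mu> - 2 * w) * f1 w + k * f w) / (w * (1 - w))" and "g2 = - ((1 - \<mu> - 2 * w) * g1 w + k * g w) / (w * (1 - w))"
    note F = leg_solD[OF f w, folded f2_def] and G = leg_solD[OF g w, folded g2_def]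
    have W: "((\<lambda>w. f w * g1 w - f1 w * g w) has_field_derivative f w * g2 - f2 * g w) (at w)"
      by (rule DERIV_cong[OF DERIV_diff[OF DERIV_mult[OF F(1) G(2)] DERIV_mult[OF F(2) G(1)]]]) (simp add: algebra_simps)
    have "f w * g2 - f2 * g w = - ((1 - \<mu>) / w - (1 + \<mu>) / (1 - w)) * (f w * g1 w - f1 w * g w)"
    proof -
      have "(f w * g2 - f2 * g w) * (w * (1 - w)) = - (1 - \<mu> - 2 * w) * (f w * g1 w - f1 w * g w)"
      proof -
        have "g2 * (w * (1 - w)) = - ((1 - \<mu> - 2 * w) * g1 w + k * g w)" "f2 * (w * (1 - w)) = - ((1 - \<mu> - 2 * w) * f1 w + k * f w)"
          unfolding f2_def g2_def using nz by auto
        moreover have "(f w * g2 - f2 * g w) * (w * (1 - w)) = f w * (g2 * (w * (1 - w))) - (f2 * (w * (1 - w))) * g w"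
          by (simp add: algebra_simps)
        ultimately show ?thesis by (simp only:) (simp add: algebra_simps)
      qed
      moreover have "- ((1 - \<mu>) / w - (1 + \<mu>) / (1 - w)) * (f w * g1 w - f1 w * g w) * (w * (1 - w)) = - (1 - \<mu> - 2 * w) * (f w * g1 w - f1 w * g w)"
      proof -
        have "((1 - \<mu>) / w - (1 + \<mu>) / (1 - w)) * (w * (1 - w)) = 1 - \<mu> - 2 * w" using nz by (simp add: field_simps)
        moreover have "- a * b * c = - (a * c) * b" for a b c :: complex by simp
        ultimately show ?thesis by (simp only:)
      qed
      ultimately show ?thesis using nz by (metis mult_eq_0_iff mult_right_cancel)
    qed
    with W have W': "((\<lambda>w. f w * g1 w - f1 w * g w) has_field_derivative - ((1 - \<mu>) / w - (1 + \<mu>) / (1 - w)) * (f w * g1 w - f1 w * g w)) (at w)"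
      by simp
    show "((\<lambda>w. w powr (1 - \<mu>) * (1 - w) powr (1 + \<mu>) * (f w * g1 w - f1 w * g w)) has_field_derivative 0) (at w)"
      by (rule DERIV_cong[OF DERIV_mult[OF DERIV_mult[OF d1 d2] W']])
         (simp add: a_def[symmetric] b_def[symmetric] divide_inverse algebra_simps)
  qed
  thus ?thesis using that unfolding constant_on_def by blast
qed

text \<open>Cramer's rule with Wronskians expresses y through u and v, up to the constant c = W(u,
  v) with its integrating factor. The boundary limits first show c \<noteq> 0 and then determine the
  coefficients: at the first sequence v disappears, and at the second, after weighting by
  \<open>g\<close>, u does.\<close>

lemma leg_sol_combination:
  assumes \<Omega>: "open \<Omega>" "connected \<Omega>" and sub: "\<And>w. w \<in> \<Omega> \<Longrightarrow> w \<notin> \<real>\<^sub>\<le>\<^sub>0 \<and> 1 - w \<notin> \<real>\<^sub>\<le>\<^sub>0"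
    and y: "leg_sol \<Omega> \<mu> k y y1" and u: "leg_sol \<Omega> \<mu> k u u1" and v: "leg_sol \<Omega> \<mu> k v v1"
    and q0: "\<And>j::nat. q0 j \<in> \<Omega>" and q1: "\<And>j::nat. q1 j \<in> \<Omega>" and G: "G \<noteq> 0"
    and u0: "(\<lambda>j. u (q0 j)) \<longlonglongrightarrow> G" and v0: "(\<lambda>j. v (q0 j)) \<longlonglongrightarrow> 0" and y0: "(\<lambda>j. y (q0 j)) \<longlonglongrightarrow> \<alpha> * G"
    and u1: "(\<lambda>j. g j * u (q1 j)) \<longlonglongrightarrow> 0" and v1: "(\<lambda>j. g j * v (q1 j)) \<longlonglongrightarrow> G" and y1: "(\<lambda>j. g j * y (q1 j)) \<longlonglongrightarrow> \<beta> * G"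
    and w: "w \<in> \<Omega>"
  shows "y w = \<alpha> * u w + \<beta> * v w"
proof -
  let ?D = "\<lambda>w. w powr (1 - \<mu>) * (1 - w) powr (1 + \<mu>)"
  have Dnz: "?D w \<noteq> 0" if "w \<in> \<Omega>" for w using sub[OF that] by (auto simp: powr_eq_0_iff)
  obtain c where c: "\<And>w. w \<in> \<Omega> \<Longrightarrow> ?D w * (u w * v1 w - u1 w * v w) = c"
    using leg_sol_Wronskian[OF \<Omega> sub u v] by blast
  obtain a where a: "\<And>w. w \<in> \<Omega> \<Longrightarrow> ?D w * (y w * v1 w - y1 w * v w) = a"
    using leg_sol_Wronskian[OF \<Omega> sub y v] by blast
  obtain b where b: "\<And>w. w \<in> \<Omega> \<Longrightarrow> ?D w * (u w * y1 w - u1 w * y w) = b"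
    using leg_sol_Wronskian[OF \<Omega> sub u y] by blast
  \<comment> \<open>The identity W(u, v) y = W(y, v) u + W(u, y) v is purely algebraic; the
    integrating factor makes the three Wronskians constant.\<close>
  have comb: "c * y w = a * u w + b * v w" if "w \<in> \<Omega>" for w
  proof -
    have "c * y w = ?D w * (u w * v1 w - u1 w * v w) * y w" using c[OF that] by simp
    also have "\<dots> = ?D w * (y w * v1 w - y1 w * v w) * u w + ?D w * (u w * y1 w - u1 w * y w) * v w"
      by (simp add: algebra_simps)
    finally show ?thesis by (simp only: a[OF that] b[OF that])
  qed
  \<comment> \<open>A vanishing Wronskian makes v/u constant near a point with u \<noteq> 0, hence v
    = k u everywhere. The limits at the first sequence force k = 0, which contradicts the nonzero
    limit of v at the second.\<close>
  have cnz: "c \<noteq> 0"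
  proof
    assume [simp]: "c = 0"
    have W0: "u w * v1 w - u1 w * v w = 0" if "w \<in> \<Omega>" for w using c[OF that] Dnz[OF that] by simp
    have "\<exists>j. u (q0 j) \<noteq> 0"
    proof (rule ccontr)
      assume "\<nexists>j. u (q0 j) \<noteq> 0"
      hence "(\<lambda>j. u (q0 j)) = (\<lambda>j. 0)" by auto
      with u0 have "(\<lambda>j::nat. 0) \<longlonglongrightarrow> G" by (simp only:)
      thus False using G LIMSEQ_unique tendsto_const by blast
    qed
    then obtain j where j: "u (q0 j) \<noteq> 0" by blast
    define z where "z = q0 j"
    have hu: "u holomorphic_on \<Omega>" and hv: "v holomorphic_on \<Omega>" using u v \<Omega> by (auto intro: leg_sol_holomorphic)
    have z: "z \<in> \<Omega>" "u z \<noteq> 0" using q0 j by (auto simp: z_def)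
    have "open (\<Omega> \<inter> u -` (- {0}))"
      using holomorphic_on_imp_continuous_on[OF hu] \<Omega>(1) by (intro continuous_open_preimage) auto
    then obtain e where e: "e > 0" "ball z e \<subseteq> \<Omega> \<inter> u -` (- {0})" using z unfolding open_contains_ball by blast
    have "\<exists>k. \<forall>w\<in>ball z e. v w / u w = k"
    proof (rule has_field_derivative_zero_constant)
      fix x assume "x \<in> ball z e"
      hence x: "x \<in> \<Omega>" "u x \<noteq> 0" using e by auto
      have "((\<lambda>w. v w / u w) has_field_derivative (v1 x * u x - v x * u1 x) / (u x * u x)) (at x)"
        by (rule DERIV_divide[OF leg_solD(1)[OF v x(1)] leg_solD(1)[OF u x(1)] x(2)])
      moreover have "v1 x * u x - v x * u1 x = 0" using W0[OF x(1)] by (simp add: mult.commute)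
      ultimately show "((\<lambda>w. v w / u w) has_field_derivative 0) (at x within ball z e)"
        by (auto intro: has_field_derivative_at_within)
    qed simp
    then obtain k where k: "\<And>w. w \<in> ball z e \<Longrightarrow> v w / u w = k" by blast
    have vb: "v w = k * u w" if "w \<in> ball z e" for w
    proof -
      have "u w \<noteq> 0" using e that by blast
      thus ?thesis using k[OF that] by (simp add: field_simps)
    qed
    have vk: "v w = k * u w" if w: "w \<in> \<Omega>" for w
    proof (rule analytic_continuation_open[of "ball z e" \<Omega> v "\<lambda>w. k * u w", OF _ \<Omega>(1) _ \<Omega>(2) _ hv _ vb w])
      show "(\<lambda>w. k * u w) holomorphic_on \<Omega>" by (intro holomorphic_intros hu)
    qed (use e in auto)
    have "(\<lambda>j. v (q0 j)) \<longlonglongrightarrow> k * G" using tendsto_mult_left[OF u0, of k] by (simp add: vk[OF q0])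
    hence "0 = k * G" by (rule LIMSEQ_unique[OF v0])
    hence "k = 0" using G by simp
    hence "(\<lambda>j. g j * v (q1 j)) = (\<lambda>j. 0)" by (auto simp: vk[OF q1])
    with v1 have "(\<lambda>j::nat. 0) \<longlonglongrightarrow> G" by (simp only:)
    thus False using G LIMSEQ_unique tendsto_const by blast
  qed
  have "(\<lambda>j. a * u (q0 j) + b * v (q0 j)) \<longlonglongrightarrow> a * G + b * 0" by (intro tendsto_intros u0 v0)
  moreover have "(\<lambda>j. c * y (q0 j)) \<longlonglongrightarrow> c * (\<alpha> * G)" by (intro tendsto_intros y0)
  ultimately have "c * (\<alpha> * G) = a * G + b * 0" unfolding comb[OF q0] by (rule LIMSEQ_unique[rotated])
  hence A: "a = c * \<alpha>" using G by simp
  have eq: "c * (g j * y (q1 j)) = a * (g j * u (q1 j)) + b * (g j * v (q1 j))" for j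
    using comb[OF q1[of j]] by (metis (no_types, lifting) distrib_left mult.left_commute)
  have "(\<lambda>j. c * (g j * y (q1 j))) \<longlonglongrightarrow> c * (\<beta> * G)" by (intro tendsto_intros y1)
  hence "(\<lambda>j. a * (g j * u (q1 j)) + b * (g j * v (q1 j))) \<longlonglongrightarrow> c * (\<beta> * G)" by (simp only: eq)
  moreover have "(\<lambda>j. a * (g j * u (q1 j)) + b * (g j * v (q1 j))) \<longlonglongrightarrow> a * 0 + b * G" by (intro tendsto_intros u1 v1)
  ultimately have "c * (\<beta> * G) = a * 0 + b * G" by (rule LIMSEQ_unique)
  hence B: "b = c * \<beta>" using G by simp
  have "c * y w = c * (\<alpha> * u w + \<beta> * v w)" using comb[OF w] by (simp add: A B algebra_simps)
  thus ?thesis using cnz by simp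
qed

lemma leg_sol_of_ODE:
  assumes hol: "f holomorphic_on S" "open S" "\<Omega> \<subseteq> S" and nz: "\<And>w. w \<in> \<Omega> \<Longrightarrow> w \<noteq> 0 \<and> w \<noteq> 1"
    and ode: "\<And>w. w \<in> \<Omega> \<Longrightarrow> w * (1 - w) * deriv (deriv f) w + (1 - \<mu> - 2 * w) * deriv f w + k * f w = 0"
  shows "leg_sol \<Omega> \<mu> k f (deriv f)"
  unfolding leg_sol_def
proof (intro ballI conjI)
  fix w assume w: "w \<in> \<Omega>"
  have wS: "w \<in> S" using w hol by auto
  show "(f has_field_derivative deriv f w) (at w)" by (rule holomorphic_derivI[OF hol(1,2) wS])
  have "deriv (deriv f) w * (w * (1 - w)) = - ((1 - \<mu> - 2 * w) * deriv f w + k * f w)"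
    using ode[OF w] by (simp add: algebra_simps add_eq_0_iff)
  hence "deriv (deriv f) w = - ((1 - \<mu> - 2 * w) * deriv f w + k * f w) / (w * (1 - w))"
    using nz[OF w] by (subst eq_divide_eq) auto
  thus "(deriv f has_field_derivative - ((1 - \<mu> - 2 * w) * deriv f w + k * f w) / (w * (1 - w))) (at w)"
    using holomorphic_derivI[OF holomorphic_deriv[OF hol(1,2)] hol(2) wS] by simp
qed

text \<open>Legendre's equation is even in z = 1 - 2w, so w may be replaced by 1 - w. The division
  by \<open>exp (\<mu> * \<xi>)\<close> is not even; the factor (w/(1 - w))^\<mu> repairs this and
  exchanges the roles of the exponents at 0 and 1.\<close>

lemma leg_sol_reflect:
  assumes E: "leg_sol S \<mu> k E E1" and S: "\<And>w. w \<in> \<Omega> \<Longrightarrow> 1 - w \<in> S" and sub: "\<And>w. w \<in> \<Omega> \<Longrightarrow> w \<notin> \<real>\<^sub>\<le>\<^sub>0 \<and> 1 - w \<notin> \<real>\<^sub>\<le>\<^sub>0"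
  shows "leg_sol \<Omega> \<mu> k (\<lambda>w. w powr \<mu> * (1 - w) powr (- \<mu>) * E (1 - w))
     (\<lambda>w. w powr \<mu> * (1 - w) powr (- \<mu>) * (\<mu> / (w * (1 - w)) * E (1 - w) - E1 (1 - w)))"
  unfolding leg_sol_def
proof (intro ballI conjI)
  fix w assume w: "w \<in> \<Omega>"
  have nz: "w \<noteq> 0" "1 - w \<noteq> 0" using sub[OF w] by auto
  define h where "h = (\<lambda>w. w powr \<mu> * (1 - w) powr (- \<mu>))"
  define e2 where "e2 = - ((1 - \<mu> - 2 * (1 - w)) * E1 (1 - w) + k * E (1 - w)) / ((1 - w) * (1 - (1 - w)))"
  have d1: "((\<lambda>w. w powr \<mu>) has_field_derivative w powr \<mu> * \<mu> / w) (at w)"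
  proof -
    have "w powr (\<mu> - 1) = w powr \<mu> / w" using nz by (subst powr_diff) auto
    thus ?thesis using sub[OF w] by (auto intro!: derivative_eq_intros)
  qed
  have d2: "((\<lambda>w. (1 - w) powr (- \<mu>)) has_field_derivative (1 - w) powr (- \<mu>) * \<mu> / (1 - w)) (at w)"
  proof -
    have "(1 - w) powr (- \<mu> - 1) = (1 - w) powr (- \<mu>) / (1 - w)" using nz by (subst powr_diff) auto
    thus ?thesis using sub[OF w] by (auto intro!: derivative_eq_intros)
  qed
  \<comment> \<open>The logarithmic derivative is \<mu>/w + \<mu>/(1 - w), which is \<mu>/(w(1 -
    w)).\<close>
  have hd: "(h has_field_derivative h w * (\<mu> / (w * (1 - w)))) (at w)"
    unfolding h_def by (rule DERIV_cong[OF DERIV_mult[OF d1 d2]]) (use nz in \<open>simp add: field_simps\<close>)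
  have r: "((\<lambda>w. 1 - w) has_field_derivative - 1) (at w)" by (auto intro!: derivative_eq_intros)
  have e: "((\<lambda>w. E (1 - w)) has_field_derivative - E1 (1 - w)) (at w)"
    using DERIV_chain2[where g = "\<lambda>w. 1 - w", OF leg_solD(1)[OF E S[OF w]] r] by simp
  have e1: "((\<lambda>w. E1 (1 - w)) has_field_derivative - e2) (at w)"
    using DERIV_chain2[where g = "\<lambda>w. 1 - w", OF leg_solD(2)[OF E S[OF w]] r] unfolding e2_def by simp
  show "((\<lambda>w. w powr \<mu> * (1 - w) powr (- \<mu>) * E (1 - w)) has_field_derivative
       w powr \<mu> * (1 - w) powr (- \<mu>) * (\<mu> / (w * (1 - w)) * E (1 - w) - E1 (1 - w))) (at w)"
    using DERIV_cong[OF DERIV_mult[OF hd e], of "h w * (\<mu> / (w * (1 - w)) * E (1 - w) - E1 (1 - w))"]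
    unfolding h_def by (simp add: algebra_simps)
  define D where "D = \<mu> / (w * (1 - w))"
  define d where "d = - (1 - 2 * w) * D / (w * (1 - w))"
  have dd: "((\<lambda>w. \<mu> / (w * (1 - w))) has_field_derivative d) (at w)"
    unfolding d_def D_def using nz by (auto intro!: derivative_eq_intros simp: field_simps power2_eq_square)
  have "((\<lambda>w. h w * (\<mu> / (w * (1 - w)) * E (1 - w) - E1 (1 - w))) has_field_derivative
     h w * (D * (D * E (1 - w) - E1 (1 - w)) + (d * E (1 - w) - D * E1 (1 - w) + e2))) (at w)"
    by (rule DERIV_cong[OF DERIV_mult[OF hd DERIV_diff[OF DERIV_mult[OF dd e] e1]]]) (unfold D_def[symmetric], simp add: algebra_simps)
  moreover have "h w * (D * (D * E (1 - w) - E1 (1 - w)) + (d * E (1 - w) - D * E1 (1 - w) + e2))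
     = - ((1 - \<mu> - 2 * w) * (h w * (D * E (1 - w) - E1 (1 - w))) + k * (h w * E (1 - w))) / (w * (1 - w))"
  proof -
    have 1: "e2 * (w * (1 - w)) = - ((1 - \<mu> - 2 * (1 - w)) * E1 (1 - w) + k * E (1 - w))" unfolding e2_def using nz by simp
    have 2: "D * (w * (1 - w)) = \<mu>" unfolding D_def using nz by simp
    have 3: "d * (w * (1 - w)) = - (1 - 2 * w) * D" unfolding d_def using nz by simp
    have "(D * (D * E (1 - w) - E1 (1 - w)) + (d * E (1 - w) - D * E1 (1 - w) + e2)) * (w * (1 - w))
      = (D * (w * (1 - w))) * (D * E (1 - w) - 2 * E1 (1 - w)) + (d * (w * (1 - w))) * E (1 - w) + e2 * (w * (1 - w))"
      by (simp add: algebra_simps)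
    also have "\<dots> = - ((1 - \<mu> - 2 * w) * (D * E (1 - w) - E1 (1 - w)) + k * E (1 - w))"
      unfolding 1 2 3 by (simp add: algebra_simps)
    finally have "h w * ((D * (D * E (1 - w) - E1 (1 - w)) + (d * E (1 - w) - D * E1 (1 - w) + e2)) * (w * (1 - w)))
      = h w * (- ((1 - \<mu> - 2 * w) * (D * E (1 - w) - E1 (1 - w)) + k * E (1 - w)))" by simp
    thus ?thesis using nz by (subst eq_divide_eq) (simp add: algebra_simps)
  qed
  ultimately show "((\<lambda>w. w powr \<mu> * (1 - w) powr (- \<mu>) * (\<mu> / (w * (1 - w)) * E (1 - w) - E1 (1 - w))) has_field_derivative
       - ((1 - \<mu> - 2 * w) * (w powr \<mu> * (1 - w) powr (- \<mu>) * (\<mu> / (w * (1 - w)) * E (1 - w) - E1 (1 - w)))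
          + k * (w powr \<mu> * (1 - w) powr (- \<mu>) * E (1 - w))) / (w * (1 - w))) (at w)"
    unfolding h_def D_def by simp
qed

text \<open>Both coefficients are read off from limits at the singular points: at \<open>0\<close> the first solution tends
  to \<open>\<Gamma>(\<mu>)\<close> and the second one to \<open>0\<close>, and after multiplication by \<open>(1 - w)\<^sup>\<mu>\<close> the roles are exchanged at \<open>1\<close>.\<close>

lemma leg_sol_eq_legE:
  assumes \<mu>: "Re \<mu> > 0"
    and hol: "legE \<nu> \<mu> holomorphic_on - \<real>\<^sub>\<le>\<^sub>0"
    and ode: "\<And>p. p \<notin> \<real>\<^sub>\<le>\<^sub>0 \<Longrightarrow> p * (1 - p) * deriv (deriv (legE \<nu> \<mu>)) p + (1 - \<mu> - 2 * p) * deriv (legE \<nu> \<mu>) p + \<nu> * (\<nu> + 1) * legE \<nu> \<mu> p = 0"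
    and E0: "\<And>p. p \<notin> \<real>\<^sub>\<le>\<^sub>0 \<Longrightarrow> norm p \<le> 1 \<Longrightarrow> norm (legE \<nu> \<mu> p - Gamma \<mu>) \<le> K * norm p"
    and \<Omega>: "open \<Omega>" "connected \<Omega>" and sub: "\<And>w. w \<in> \<Omega> \<Longrightarrow> w \<notin> \<real>\<^sub>\<le>\<^sub>0 \<and> 1 - w \<notin> \<real>\<^sub>\<le>\<^sub>0"
    and y: "leg_sol \<Omega> \<mu> (\<nu> * (\<nu> + 1)) y y1"
    and q0: "\<And>j::nat. q0 j \<in> \<Omega>" "q0 \<longlonglongrightarrow> 0" and q1: "\<And>j::nat. q1 j \<in> \<Omega>" "q1 \<longlonglongrightarrow> 1"
    and y0: "(\<lambda>j. y (q0 j)) \<longlonglongrightarrow> \<alpha> * Gamma \<mu>" and y1: "(\<lambda>j. (1 - q1 j) powr \<mu> * y (q1 j)) \<longlonglongrightarrow> \<beta> * Gamma \<mu>"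
    and w: "w \<in> \<Omega>"
  shows "y w = \<alpha> * legE \<nu> \<mu> w + \<beta> * (w powr \<mu> * (1 - w) powr (- \<mu>) * legE \<nu> \<mu> (1 - w))"
proof -
  have nz: "w \<noteq> 0 \<and> w \<noteq> 1" if "w \<in> \<Omega>" for w using sub[OF that] by auto
  have u: "leg_sol \<Omega> \<mu> (\<nu> * (\<nu> + 1)) (legE \<nu> \<mu>) (deriv (legE \<nu> \<mu>))"
    by (rule leg_sol_of_ODE[OF hol open_Compl_nonpos_Reals]) (use sub nz ode in auto)
  have "leg_sol {p. p \<notin> \<real>\<^sub>\<le>\<^sub>0 \<and> 1 - p \<notin> \<real>\<^sub>\<le>\<^sub>0} \<mu> (\<nu> * (\<nu> + 1)) (legE \<nu> \<mu>) (deriv (legE \<nu> \<mu>))"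
    by (rule leg_sol_of_ODE[OF hol open_Compl_nonpos_Reals]) (use ode in auto)
  from leg_sol_reflect[OF this, of \<Omega>] sub
  have v: "leg_sol \<Omega> \<mu> (\<nu> * (\<nu> + 1)) (\<lambda>w. w powr \<mu> * (1 - w) powr (- \<mu>) * legE \<nu> \<mu> (1 - w))
     (\<lambda>w. w powr \<mu> * (1 - w) powr (- \<mu>) * (\<mu> / (w * (1 - w)) * legE \<nu> \<mu> (1 - w) - deriv (legE \<nu> \<mu>) (1 - w)))" by auto
  have lim0: "(\<lambda>j. legE \<nu> \<mu> (q j)) \<longlonglongrightarrow> Gamma \<mu>" if q: "\<And>j. q j \<notin> \<real>\<^sub>\<le>\<^sub>0" "q \<longlonglongrightarrow> 0" for q
  proof -
    have "(\<lambda>j. legE \<nu> \<mu> (q j) - Gamma \<mu>) \<longlonglongrightarrow> 0"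
    proof (rule Lim_null_comparison)
      have "\<forall>\<^sub>F j in sequentially. norm (q j) < 1" using order_tendstoD(2)[OF tendsto_norm[OF q(2)], of 1] by simp
      thus "\<forall>\<^sub>F j in sequentially. norm (legE \<nu> \<mu> (q j) - Gamma \<mu>) \<le> K * norm (q j)"
        by eventually_elim (use E0 q in auto)
      show "(\<lambda>j. K * norm (q j)) \<longlonglongrightarrow> 0" using tendsto_mult_left[OF tendsto_norm[OF q(2)], of K] by simp
    qed
    thus ?thesis by (simp add: LIM_zero_iff)
  qed
  have lim1: "(\<lambda>j. legE \<nu> \<mu> (q j)) \<longlonglongrightarrow> legE \<nu> \<mu> 1" if q: "q \<longlonglongrightarrow> 1" for q :: "nat \<Rightarrow> complex"
  proof -
    have "isCont (legE \<nu> \<mu>) 1"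
      using holomorphic_on_imp_continuous_on[OF hol] open_Compl_nonpos_Reals by (simp add: continuous_on_eq_continuous_at)
    thus ?thesis using q isCont_tendsto_compose by blast
  qed
  have p0: "(\<lambda>j. q j powr \<mu>) \<longlonglongrightarrow> 0" if q: "q \<longlonglongrightarrow> 0" for q :: "nat \<Rightarrow> complex"
  proof (rule Lim_null_comparison)
    show "\<forall>\<^sub>F j in sequentially. norm (q j powr \<mu>) \<le> norm (q j) powr Re \<mu> * exp (pi * \<bar>Im \<mu>\<bar>)"
      by (intro always_eventually allI norm_powr_le)
    have "(\<lambda>j. norm (q j) powr Re \<mu>) \<longlonglongrightarrow> norm (0::complex) powr Re \<mu>"
      by (rule tendsto_powr'[OF tendsto_norm[OF q] tendsto_const]) (use \<mu> in auto)
    from tendsto_mult_right[OF this, of "exp (pi * \<bar>Im \<mu>\<bar>)"]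
    show "(\<lambda>j. norm (q j) powr Re \<mu> * exp (pi * \<bar>Im \<mu>\<bar>)) \<longlonglongrightarrow> 0" using \<mu> by simp
  qed
  have p1: "(\<lambda>j. q j powr m) \<longlonglongrightarrow> 1" if q: "q \<longlonglongrightarrow> 1" for q :: "nat \<Rightarrow> complex" and m
    using tendsto_powr_complex[OF _ q tendsto_const, of m] by simp
  have q0': "(\<lambda>j. 1 - q0 j) \<longlonglongrightarrow> 1" using tendsto_diff[OF tendsto_const q0(2), of 1] by simp
  have q1': "(\<lambda>j. 1 - q1 j) \<longlonglongrightarrow> 0" using tendsto_diff[OF tendsto_const q1(2), of 1] by simp
  have G: "Gamma \<mu> \<noteq> 0" using notin_nonpos_Ints_if_Re_pos[OF \<mu>] by (simp add: Gamma_eq_zero_iff)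
  show ?thesis
  proof (rule leg_sol_combination[OF \<Omega> sub y u v q0(1) q1(1) G _ _ y0 _ _ y1 w])
    show "(\<lambda>j. legE \<nu> \<mu> (q0 j)) \<longlonglongrightarrow> Gamma \<mu>" using sub q0 by (intro lim0) auto
    show "(\<lambda>j. q0 j powr \<mu> * (1 - q0 j) powr (- \<mu>) * legE \<nu> \<mu> (1 - q0 j)) \<longlonglongrightarrow> 0"
      using tendsto_mult[OF tendsto_mult[OF p0[OF q0(2)] p1[OF q0', of "- \<mu>"]] lim1[OF q0']] by simp
    show "(\<lambda>j. (1 - q1 j) powr \<mu> * legE \<nu> \<mu> (q1 j)) \<longlonglongrightarrow> 0"
      using tendsto_mult[OF p0[OF q1'] lim1[OF q1(2)]] by simp
    have eq: "(1 - q1 j) powr \<mu> * (q1 j powr \<mu> * (1 - q1 j) powr (- \<mu>) * legE \<nu> \<mu> (1 - q1 j)) = q1 j powr \<mu> * legE \<nu> \<mu> (1 - q1 j)" for j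
      using nz[OF q1(1)[of j]] by (simp add: powr_minus field_simps)
    have "(\<lambda>j. q1 j powr \<mu> * legE \<nu> \<mu> (1 - q1 j)) \<longlonglongrightarrow> Gamma \<mu>"
      using tendsto_mult[OF p1[OF q1(2), of \<mu>] lim0[of "\<lambda>j. 1 - q1 j"]] sub[OF q1(1)] q1' by simp
    thus "(\<lambda>j. (1 - q1 j) powr \<mu> * (q1 j powr \<mu> * (1 - q1 j) powr (- \<mu>) * legE \<nu> \<mu> (1 - q1 j))) \<longlonglongrightarrow> Gamma \<mu>"
      by (simp only: eq)
  qed
qed

section \<open>The doubly cut plane and the connection formula for P\<close>

definition double_slit_plane :: "complex set" where
  "double_slit_plane = {w. w \<notin> \<real>\<^sub>\<le>\<^sub>0 \<and> 1 - w \<notin> \<real>\<^sub>\<le>\<^sub>0}"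

lemma double_slit_plane_iff: "w \<in> double_slit_plane \<longleftrightarrow> Im w \<noteq> 0 \<or> 0 < Re w \<and> Re w < 1"
  by (auto simp: double_slit_plane_def complex_nonpos_Reals_iff)

lemma double_slit_plane_eq: "double_slit_plane = - \<real>\<^sub>\<le>\<^sub>0 \<inter> slit_plane"
  by (auto simp: double_slit_plane_iff slit_plane_iff complex_nonpos_Reals_iff)

lemma open_double_slit_plane: "open double_slit_plane"
  unfolding double_slit_plane_eq by (intro open_Int open_Compl_nonpos_Reals open_slit_plane)

lemma connected_double_slit_plane: "connected double_slit_plane"
proof (rule starlike_imp_connected)
  show "starlike double_slit_plane" unfolding starlike_def
  proof (intro bexI[of _ "1/2"] ballI subsetI)
    fix x y assume x: "x \<in> double_slit_plane" and y: "y \<in> closed_segment (1/2) x"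
    then obtain u where u: "0 \<le> u" "u \<le> 1" "y = of_real (1 - u) * (1/2) + of_real u * x"
      by (auto simp: closed_segment_def scaleR_conv_of_real)
    have Im: "Im y = u * Im x" and Re: "Re y = (1 - u) / 2 + u * Re x" using u by auto
    show "y \<in> double_slit_plane"
    proof (cases "u = 0 \<or> Im x \<noteq> 0")
      case True thus ?thesis using Im Re by (auto simp: double_slit_plane_iff)
    next
      case False
      hence r: "0 < Re x" "Re x < 1" "u > 0" using x u by (auto simp: double_slit_plane_iff)
      hence "u * Re x > 0" "u * Re x < u" by auto
      hence "0 < Re y" "Re y < 1" unfolding Re using u(2) by (simp_all add: field_simps)
      thus ?thesis by (simp add: double_slit_plane_iff)
    qed
  qed (auto simp: double_slit_plane_iff)
qed

text \<open>Bundles what the identification of coefficients uses. Re \<mu> \<ge> 1 is the hypothesis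
  of the Abelian limit at 1, and the last clause gives the limit \<Gamma>(\<mu>) at 0 along every
  sequence off the cut, even a tangential one.\<close>

definition legE_regular :: "complex \<Rightarrow> complex \<Rightarrow> bool" where
  "legE_regular \<nu> \<mu> \<longleftrightarrow> Re \<mu> \<ge> 1 \<and> legE \<nu> \<mu> holomorphic_on - \<real>\<^sub>\<le>\<^sub>0 \<and>
     (\<forall>p. p \<notin> \<real>\<^sub>\<le>\<^sub>0 \<longrightarrow> p * (1 - p) * deriv (deriv (legE \<nu> \<mu>)) p + (1 - \<mu> - 2 * p) * deriv (legE \<nu> \<mu>) p + \<nu> * (\<nu> + 1) * legE \<nu> \<mu> p = 0) \<and>
     (\<exists>K. \<forall>p. p \<notin> \<real>\<^sub>\<le>\<^sub>0 \<longrightarrow> norm p \<le> 1 \<longrightarrow> norm (legE \<nu> \<mu> p - Gamma \<mu>) \<le> K * norm p)"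

lemma leg_sol_double_slit_plane_eq_legE:
  assumes reg: "legE_regular \<nu> \<mu>"
    and \<Omega>: "open \<Omega>" "connected \<Omega>" "\<Omega> \<subseteq> double_slit_plane"
    and y: "leg_sol \<Omega> \<mu> (\<nu> * (\<nu> + 1)) y y1"
    and q0: "\<And>j::nat. q0 j \<in> \<Omega>" "q0 \<longlonglongrightarrow> 0" and q1: "\<And>j::nat. q1 j \<in> \<Omega>" "q1 \<longlonglongrightarrow> 1"
    and y0: "(\<lambda>j. y (q0 j)) \<longlonglongrightarrow> \<alpha> * Gamma \<mu>" and y1: "(\<lambda>j. (1 - q1 j) powr \<mu> * y (q1 j)) \<longlonglongrightarrow> \<beta> * Gamma \<mu>"
    and w: "w \<in> \<Omega>"
  shows "y w = \<alpha> * legE \<nu> \<mu> w + \<beta> * (w powr \<mu> * (1 - w) powr (- \<mu>) * legE \<nu> \<mu> (1 - w))"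
proof -
  obtain K where K: "\<And>p. p \<notin> \<real>\<^sub>\<le>\<^sub>0 \<Longrightarrow> norm p \<le> 1 \<Longrightarrow> norm (legE \<nu> \<mu> p - Gamma \<mu>) \<le> K * norm p"
    using reg unfolding legE_regular_def by blast
  show ?thesis
  proof (rule leg_sol_eq_legE[OF _ _ _ K \<Omega>(1,2) _ y q0 q1 y0 y1 w])
    fix w assume "w \<in> \<Omega>" thus "w \<notin> \<real>\<^sub>\<le>\<^sub>0 \<and> 1 - w \<notin> \<real>\<^sub>\<le>\<^sub>0" using \<Omega>(3) by (auto simp: double_slit_plane_def)
  qed (use reg in \<open>auto simp: legE_regular_def\<close>)
qed

lemma LIMSEQ_of_real_inverse_Suc: "(\<lambda>j. complex_of_real (1 / (real j + 2))) \<longlonglongrightarrow> 0"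
proof -
  have "(\<lambda>j. complex_of_real (1 / real (j + 2))) \<longlonglongrightarrow> of_real 0"
    by (intro tendsto_of_real LIMSEQ_ignore_initial_segment[OF lim_1_over_n])
  thus ?thesis by (simp add: add.commute)
qed

text \<open>At 0 the value is 1/\<Gamma>(1 - \<mu>), by reflection sin(\<pi>\<mu>)/\<pi> times
  \<Gamma>(\<mu>). At 1 the Abelian limit with s = \<mu> is \<Gamma>(\<mu>)/(\<Gamma>(\<nu> +
  1)\<Gamma>(-\<nu>)), by reflection -sin(\<pi>\<nu>)/\<pi> times \<Gamma>(\<mu>). Both singular
  points are approached along the real segment between them.\<close>

lemma hyperF_reg_P_connection:
  assumes reg: "legE_regular \<nu> \<mu>" and w: "w \<in> double_slit_plane"
  shows "hyperF_reg (\<nu> + 1) (- \<nu>) (1 - \<mu>) w = sin (of_real pi * \<mu>) / of_real pi * legE \<nu> \<mu> w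
     + (- (sin (of_real pi * \<nu>) / of_real pi)) * (w powr \<mu> * (1 - w) powr (- \<mu>) * legE \<nu> \<mu> (1 - w))"
proof -
  let ?F = "hyperF_reg (\<nu> + 1) (- \<nu>) (1 - \<mu>)"
  let ?\<eta> = "\<lambda>j. 1 / (real j + 2)"
  have \<mu>: "Re \<mu> \<ge> 1" using reg by (simp add: legE_regular_def)
  have \<eta>: "?\<eta> j > 0" "?\<eta> j < 1" for j by (auto simp: field_simps)
  have hol: "?F holomorphic_on slit_plane" by (rule holomorphic_on_hyperF_reg)
  have sol: "leg_sol double_slit_plane \<mu> (\<nu> * (\<nu> + 1)) ?F (deriv ?F)"
  proof (rule leg_sol_of_ODE[OF hol open_slit_plane])
    fix w assume w: "w \<in> double_slit_plane"
    show "w \<noteq> 0 \<and> w \<noteq> 1" using w by (auto simp: double_slit_plane_iff)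
    have "w \<in> slit_plane" using w by (simp add: double_slit_plane_eq)
    from hyperF_reg_ODE[OF this, of "\<nu> + 1" "- \<nu>" "1 - \<mu>"]
    show "w * (1 - w) * deriv (deriv ?F) w + (1 - \<mu> - 2 * w) * deriv ?F w + \<nu> * (\<nu> + 1) * ?F w = 0"
      by (simp add: algebra_simps)
  qed (auto simp: double_slit_plane_eq)
  show ?thesis
  proof (rule leg_sol_double_slit_plane_eq_legE[OF reg open_double_slit_plane connected_double_slit_plane order.refl sol _ LIMSEQ_of_real_inverse_Suc _ _ _ _ w])
    show "complex_of_real (?\<eta> j) \<in> double_slit_plane" for j using \<eta>[of j] by (simp only: double_slit_plane_iff Re_complex_of_real) simp
    show "1 - complex_of_real (?\<eta> j) \<in> double_slit_plane" for j
      using \<eta>[of j] by (simp only: double_slit_plane_iff Re_complex_of_real minus_complex.sel) simp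
    show q1: "(\<lambda>j. 1 - complex_of_real (?\<eta> j)) \<longlonglongrightarrow> 1"
      using tendsto_diff[OF tendsto_const LIMSEQ_of_real_inverse_Suc, of 1] by simp
    have "isCont ?F 0"
      using holomorphic_on_imp_continuous_on[OF hol] open_slit_plane by (simp add: continuous_on_eq_continuous_at slit_plane_iff)
    hence "(\<lambda>j. ?F (complex_of_real (?\<eta> j))) \<longlonglongrightarrow> ?F 0"
      using LIMSEQ_of_real_inverse_Suc isCont_tendsto_compose by blast
    moreover have "?F 0 = rGamma (1 - \<mu>)"
      using sums_unique2[OF sums_hyperF_reg[of 0 "\<nu> + 1" "- \<nu>" "1 - \<mu>"] powser_sums_zero[of "hyp_coeff (\<nu> + 1) (- \<nu>) (1 - \<mu>)"]]
      by (simp add: hyp_coeff_def)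
    moreover have "rGamma (1 - \<mu>) = sin (of_real pi * \<mu>) / of_real pi * Gamma \<mu>"
    proof -
      have "rGamma \<mu> \<noteq> 0" using \<mu> notin_nonpos_Ints_if_Re_pos[of \<mu>] by (auto simp: rGamma_eq_zero_iff)
      thus ?thesis unfolding rGamma_reflection_complex[symmetric] by (simp add: Gamma_def)
    qed
    ultimately show "(\<lambda>j. ?F (complex_of_real (?\<eta> j))) \<longlonglongrightarrow> sin (of_real pi * \<mu>) / of_real pi * Gamma \<mu>"
      by simp
    have n: "norm (1 - complex_of_real (?\<eta> j)) = 1 - ?\<eta> j" for j
      using \<eta>[of j] norm_of_real[of "1 - ?\<eta> j", where 'a = complex] by simp
    have "(\<lambda>j. (1 - (1 - complex_of_real (?\<eta> j))) powr \<mu> * ?F (1 - complex_of_real (?\<eta> j))) \<longlonglongrightarrow> Gamma \<mu> * rGamma (\<nu> + 1) * rGamma (- \<nu>)"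
    proof (rule hyperF_reg_tendsto_at_1[where M = 1])
      show "norm (1 - complex_of_real (?\<eta> j)) < 1" for j using n[of j] \<eta>[of j] by simp
      show "norm (1 - (1 - complex_of_real (?\<eta> j))) \<le> 1 * (1 - norm (1 - complex_of_real (?\<eta> j)))" for j
        using \<eta>[of j] unfolding n[of j] by (simp add: norm_divide del: of_real_divide)
    qed (use \<mu> q1 in auto)
    moreover have "rGamma (\<nu> + 1) * rGamma (- \<nu>) = - (sin (of_real pi * \<nu>) / of_real pi)"
      using rGamma_reflection_complex[of "- \<nu>"] by (simp add: mult.commute add.commute)
    ultimately show "(\<lambda>j. (1 - (1 - complex_of_real (?\<eta> j))) powr \<mu> * ?F (1 - complex_of_real (?\<eta> j))) \<longlonglongrightarrow> (- (sin (of_real pi * \<nu>) / of_real pi)) * Gamma \<mu>"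
      by (simp add: mult_ac)
  qed
qed

section \<open>The connection formula for Q\<close>

lemma inverse_square_in_slit_plane:
  assumes "Im z \<noteq> 0"
  shows "1 / z\<^sup>2 \<in> slit_plane"
proof (rule ccontr)
  assume "1 / z\<^sup>2 \<notin> slit_plane"
  then obtain r where r: "1 / z\<^sup>2 = complex_of_real r" "r \<ge> 1"
    unfolding slit_plane_def by auto
  have "z \<noteq> 0" using assms by auto
  hence "complex_of_real r * z\<^sup>2 = 1" unfolding r(1)[symmetric] by simp
  hence "z\<^sup>2 = complex_of_real (1 / r)" using r(2) by (simp add: field_simps)
  hence "Im (z\<^sup>2) = 0" "Re (z\<^sup>2) > 0" using r(2) by (auto simp del: of_real_divide)
  hence "Re z * Im z = 0" "(Re z)\<^sup>2 > (Im z)\<^sup>2" by (auto simp: power2_eq_square)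
  thus False using assms by (auto simp: power2_less_0)
qed

text \<open>Up to constants this is Q divided by \<open>exp (\<mu> * \<xi>)\<close>, since the
  product of (z - 1)^(\<mu>/2) and (z + 1)^(\<mu>/2) is \<open>exp (\<mu> * \<xi>)\<close> times (z
  - 1)^\<mu>. Direct substitution of the hypergeometric equation at 1/z^2 takes the place of a
  quadratic transformation. Off the real axis no factor meets a cut.\<close>

lemma leg_sol_Q:
  fixes \<nu> \<mu> :: complex
  defines "\<kappa> \<equiv> \<nu> + \<mu> + 1"
  defines "\<Phi> \<equiv> hyperF_reg ((\<nu> + \<mu> + 2) / 2) ((\<nu> + \<mu> + 1) / 2) (\<nu> + 3 / 2)"
  assumes \<Omega>: "\<And>w. w \<in> \<Omega> \<Longrightarrow> Im w \<noteq> 0"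
  shows "\<exists>y1. leg_sol \<Omega> \<mu> (\<nu> * (\<nu> + 1))
    (\<lambda>w. ((1 - 2 * w) - 1) powr \<mu> * (1 - 2 * w) powr (- \<kappa>) * \<Phi> (1 / (1 - 2 * w)\<^sup>2)) y1"
proof -
  have hol: "\<Phi> holomorphic_on slit_plane" unfolding \<Phi>_def by (rule holomorphic_on_hyperF_reg)
  have hol': "deriv \<Phi> holomorphic_on slit_plane" by (intro holomorphic_deriv hol open_slit_plane)
  define A where "A z = (z - 1) powr \<mu> * z powr (- \<kappa>)" for z :: complex
  \<comment> \<open>The logarithmic derivative of the power factor \<open>A\<close>.\<close>
  define L where "L z = \<mu> / (z - 1) - \<kappa> / z" for z :: complex
  define Y where "Y z = A z * \<Phi> (1 / z\<^sup>2)" for z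
  define Y1 where "Y1 z = A z * (L z * \<Phi> (1 / z\<^sup>2) - 2 / z ^ 3 * deriv \<Phi> (1 / z\<^sup>2))" for z
  define Y2 where "Y2 z = (2 * (z - \<mu>) * Y1 z - \<nu> * (\<nu> + 1) * Y z) / (1 - z\<^sup>2)" for z
  have dY: "(Y has_field_derivative Y1 z) (at z)" and dY1: "(Y1 has_field_derivative Y2 z) (at z)" if Im: "Im z \<noteq> 0" for z
  proof -
    have z: "z \<noteq> 0" "z - 1 \<noteq> 0" "z + 1 \<noteq> 0" "z \<notin> \<real>\<^sub>\<le>\<^sub>0" "z - 1 \<notin> \<real>\<^sub>\<le>\<^sub>0"
      using Im by (auto simp: complex_nonpos_Reals_iff complex_eq_iff)
    have z2: "1 - z\<^sup>2 \<noteq> 0" using z(2,3) by (auto simp: power2_eq_square square_eq_1_iff add_eq_0_iff2)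
    note qs = inverse_square_in_slit_plane[OF Im]
    have d1: "((\<lambda>z. (z - 1) powr \<mu>) has_field_derivative (z - 1) powr \<mu> * \<mu> / (z - 1)) (at z)"
    proof -
      have "(z - 1) powr (\<mu> - 1) = (z - 1) powr \<mu> / (z - 1)" using z by (subst powr_diff) auto
      thus ?thesis using z by (auto intro!: derivative_eq_intros)
    qed
    have d2: "((\<lambda>z. z powr (- \<kappa>)) has_field_derivative - (z powr (- \<kappa>) * \<kappa> / z)) (at z)"
    proof -
      have "z powr (- \<kappa> - 1) = z powr (- \<kappa>) / z" using z by (subst powr_diff) auto
      thus ?thesis using z by (auto intro!: derivative_eq_intros)
    qed
    have dA: "(A has_field_derivative A z * L z) (at z)"
      unfolding A_def L_def by (rule DERIV_cong[OF DERIV_mult[OF d1 d2]]) (simp add: divide_inverse algebra_simps)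
    have dq: "((\<lambda>z. 1 / z\<^sup>2) has_field_derivative - 2 / z ^ 3) (at z)"
      using z by (auto intro!: derivative_eq_intros simp: field_simps power2_eq_square power3_eq_cube)
    have dF: "((\<lambda>z. \<Phi> (1 / z\<^sup>2)) has_field_derivative deriv \<Phi> (1 / z\<^sup>2) * (- 2 / z ^ 3)) (at z)"
      by (rule DERIV_chain2[where g = "\<lambda>z. 1 / z\<^sup>2", OF holomorphic_derivI[OF hol open_slit_plane qs] dq])
    have dF1: "((\<lambda>z. deriv \<Phi> (1 / z\<^sup>2)) has_field_derivative deriv (deriv \<Phi>) (1 / z\<^sup>2) * (- 2 / z ^ 3)) (at z)"
      by (rule DERIV_chain2[where g = "\<lambda>z. 1 / z\<^sup>2", OF holomorphic_derivI[OF hol' open_slit_plane qs] dq])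
    show "(Y has_field_derivative Y1 z) (at z)"
      unfolding Y_def Y1_def by (rule DERIV_cong[OF DERIV_mult[OF dA dF]]) (simp add: algebra_simps)
    define F F1 F2 where "F = \<Phi> (1 / z\<^sup>2)" and "F1 = deriv \<Phi> (1 / z\<^sup>2)" and "F2 = deriv (deriv \<Phi>) (1 / z\<^sup>2)"
    define l r where "l = - \<mu> / (z - 1)\<^sup>2 + \<kappa> / z\<^sup>2" and "r = - 2 / z ^ 3"
    have dL: "(L has_field_derivative l) (at z)"
      unfolding L_def l_def using z by (auto intro!: derivative_eq_intros simp: power2_eq_square)
    have dr: "((\<lambda>z. 2 / z ^ 3) has_field_derivative - 6 / z ^ 4) (at z)"
      using z by (auto intro!: derivative_eq_intros simp: field_simps eval_nat_numeral)
    have dY1': "(Y1 has_field_derivative A z * (L z * (L z * F + r * F1) + (l * F + L z * (r * F1) + 6 / z ^ 4 * F1 + r * (r * F2)))) (at z)"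
      unfolding Y1_def
      by (rule DERIV_cong[OF DERIV_mult[OF dA DERIV_diff[OF DERIV_mult[OF dL dF] DERIV_mult[OF dr dF1]]]])
         (unfold F_def[symmetric] F1_def[symmetric] F2_def[symmetric] r_def, simp add: algebra_simps)
    \<comment> \<open>The equation of \<open>\<Phi>\<close> at 1/z^2, multiplied by z^4 and solved
      for its second order term.\<close>
    have ode: "(z\<^sup>2 - 1) * F2 = \<kappa> * (\<kappa> + 1) / 4 * z ^ 4 * F - ((\<nu> + 3/2) * z ^ 4 - (\<kappa> + 3/2) * z\<^sup>2) * F1"
    proof -
      define q where "q = 1 / z\<^sup>2"
      have k1: "(\<nu> + \<mu> + 2) / 2 + (\<nu> + \<mu> + 1) / 2 + 1 = \<kappa> + 3/2" by (simp add: \<kappa>_def field_simps)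
      have k2: "(\<nu> + \<mu> + 2) / 2 * ((\<nu> + \<mu> + 1) / 2) = \<kappa> * (\<kappa> + 1) / 4" by (simp add: \<kappa>_def field_simps)
      have "q * (1 - q) * F2 + (\<nu> + 3/2 - (\<kappa> + 3/2) * q) * F1 - \<kappa> * (\<kappa> + 1) / 4 * F = 0"
        using hyperF_reg_ODE[OF qs, of "(\<nu> + \<mu> + 2) / 2" "(\<nu> + \<mu> + 1) / 2" "\<nu> + 3 / 2"]
        unfolding \<Phi>_def[symmetric] F_def[symmetric] F1_def[symmetric] F2_def[symmetric]
        unfolding q_def[symmetric] k1 k2 .
      hence "z ^ 4 * (q * (1 - q)) * F2 + (z ^ 4 * (\<nu> + 3/2) - (\<kappa> + 3/2) * (z ^ 4 * q)) * F1 - \<kappa> * (\<kappa> + 1) / 4 * z ^ 4 * F = 0"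
        by algebra
      moreover have "z ^ 4 * q = z\<^sup>2" "z ^ 4 * (q * (1 - q)) = z\<^sup>2 - 1" unfolding q_def using z by (simp_all add: field_simps eval_nat_numeral)
      ultimately have "(z\<^sup>2 - 1) * F2 + ((\<nu> + 3/2) * z ^ 4 - (\<kappa> + 3/2) * z\<^sup>2) * F1 - \<kappa> * (\<kappa> + 1) / 4 * z ^ 4 * F = 0"
        by (simp only: mult.commute[of "z ^ 4" "\<nu> + 3/2"])
      moreover have "a = c - b" if "a + b - c = 0" for a b c :: complex using that by (simp add: algebra_simps)
      ultimately show ?thesis by blast
    qed
    \<comment> \<open>After eliminating \<open>F2\<close> the claim separates into the coefficients
      of \<open>F\<close> and \<open>F1\<close>, which are compared in \<open>c1\<close>,
      \<open>c2\<close> and \<open>c3\<close>.\<close>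
    have key: "(1 - z\<^sup>2) * (L z * (L z * F + r * F1) + (l * F + L z * (r * F1) + 6 / z ^ 4 * F1 + r * (r * F2)))
       = 2 * (z - \<mu>) * (L z * F + r * F1) - \<nu> * (\<nu> + 1) * F"
    proof -
      have c1: "(1 - z\<^sup>2) * (L z * L z + l) = 2 * (z - \<mu>) * L z - \<nu> * (\<nu> + 1) + \<kappa> * (\<kappa> + 1) / z\<^sup>2"
      proof -
        \<comment> \<open>Treating the reciprocals as unknowns with a (z - 1) = 1 and b z = 1 turns
          the rational identity into a polynomial one.\<close>
        define a b where "a = 1 / (z - 1)" and "b = 1 / z"
        have ab: "a * (z - 1) = 1" "b * z = 1" unfolding a_def b_def using z by auto
        have "L z = \<mu> * a - \<kappa> * b" "l = - \<mu> * a\<^sup>2 + \<kappa> * b\<^sup>2" "\<kappa> * (\<kappa> + 1) / z\<^sup>2 = \<kappa> * (\<kappa> + 1) * b\<^sup>2"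
          unfolding L_def l_def a_def b_def by (simp_all add: power_divide)
        thus ?thesis using ab unfolding \<kappa>_def by algebra
      qed
      have c2: "(1 - z\<^sup>2) * (2 * L z * r + 6 / z ^ 4) + r * r * ((\<nu> + 3/2) * z ^ 4 - (\<kappa> + 3/2) * z\<^sup>2) = 2 * (z - \<mu>) * r"
      proof -
        define a b where "a = 1 / (z - 1)" and "b = 1 / z"
        have ab: "a * (z - 1) = 1" "b * z = 1" unfolding a_def b_def using z by auto
        have "L z = \<mu> * a - \<kappa> * b" "r = - 2 * b ^ 3" "6 / z ^ 4 = 6 * b ^ 4"
          unfolding L_def r_def a_def b_def by (simp_all add: power_divide)
        thus ?thesis using ab unfolding \<kappa>_def by algebra
      qed
      have c3: "r * r * (\<kappa> * (\<kappa> + 1) / 4 * z ^ 4) = \<kappa> * (\<kappa> + 1) / z\<^sup>2"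
        unfolding r_def using z by (simp add: field_simps eval_nat_numeral)
      have "(1 - z\<^sup>2) * (L z * (L z * F + r * F1) + (l * F + L z * (r * F1) + 6 / z ^ 4 * F1 + r * (r * F2)))
        = ((1 - z\<^sup>2) * (L z * L z + l)) * F + ((1 - z\<^sup>2) * (2 * L z * r + 6 / z ^ 4)) * F1 - r * r * ((z\<^sup>2 - 1) * F2)"
        by (simp add: algebra_simps)
      also have "\<dots> = ((1 - z\<^sup>2) * (L z * L z + l) - r * r * (\<kappa> * (\<kappa> + 1) / 4 * z ^ 4)) * F +
           ((1 - z\<^sup>2) * (2 * L z * r + 6 / z ^ 4) + r * r * ((\<nu> + 3/2) * z ^ 4 - (\<kappa> + 3/2) * z\<^sup>2)) * F1"
        unfolding ode by (simp add: algebra_simps)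
      also have "\<dots> = (2 * (z - \<mu>) * L z - \<nu> * (\<nu> + 1)) * F + (2 * (z - \<mu>) * r) * F1"
        unfolding c1 c2 c3 by simp
      finally show ?thesis by (simp add: algebra_simps)
    qed
    have "A z * (L z * (L z * F + r * F1) + (l * F + L z * (r * F1) + 6 / z ^ 4 * F1 + r * (r * F2))) = Y2 z"
    proof -
      have "Y1 z = A z * (L z * F + r * F1)" "Y z = A z * F" unfolding Y1_def Y_def F_def F1_def r_def by auto
      hence "2 * (z - \<mu>) * Y1 z - \<nu> * (\<nu> + 1) * Y z = A z * (2 * (z - \<mu>) * (L z * F + r * F1) - \<nu> * (\<nu> + 1) * F)"
        by (simp add: algebra_simps)
      thus ?thesis unfolding Y2_def key[symmetric] using z2 by (simp add: field_simps)
    qed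
    with dY1' show "(Y1 has_field_derivative Y2 z) (at z)" by simp
  qed
  have "leg_sol \<Omega> \<mu> (\<nu> * (\<nu> + 1)) (\<lambda>w. Y (1 - 2 * w)) (\<lambda>w. - 2 * Y1 (1 - 2 * w))"
    unfolding leg_sol_def
  proof (intro ballI conjI)
    fix w assume w: "w \<in> \<Omega>"
    have Im: "Im (1 - 2 * w) \<noteq> 0" using \<Omega>[OF w] by simp
    have r: "((\<lambda>w. 1 - 2 * w) has_field_derivative - 2) (at w)" by (auto intro!: derivative_eq_intros)
    show "((\<lambda>w. Y (1 - 2 * w)) has_field_derivative - 2 * Y1 (1 - 2 * w)) (at w)"
      using DERIV_chain2[where g = "\<lambda>w. 1 - 2 * w", OF dY[OF Im] r] by (simp add: mult.commute)
    have nz: "w \<noteq> 0" "1 - w \<noteq> 0" using \<Omega>[OF w] by auto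
    have "((\<lambda>w. - 2 * Y1 (1 - 2 * w)) has_field_derivative 4 * Y2 (1 - 2 * w)) (at w)"
      using DERIV_cmult[OF DERIV_chain2[where g = "\<lambda>w. 1 - 2 * w", OF dY1[OF Im] r], of "- 2"] by simp
    moreover have "4 * Y2 (1 - 2 * w) = - ((1 - \<mu> - 2 * w) * (- 2 * Y1 (1 - 2 * w)) + \<nu> * (\<nu> + 1) * Y (1 - 2 * w)) / (w * (1 - w))"
    proof -
      have e: "1 - (1 - 2 * w)\<^sup>2 = 4 * (w * (1 - w))" by (simp add: power2_eq_square algebra_simps)
      define B where "B = 2 * (1 - 2 * w - \<mu>) * Y1 (1 - 2 * w) - \<nu> * (\<nu> + 1) * Y (1 - 2 * w)"
      have "4 * Y2 (1 - 2 * w) = B / (w * (1 - w))" unfolding Y2_def e B_def[symmetric] by simp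
      also have "B = - ((1 - \<mu> - 2 * w) * (- 2 * Y1 (1 - 2 * w)) + \<nu> * (\<nu> + 1) * Y (1 - 2 * w))" unfolding B_def by (simp add: algebra_simps)
      finally show ?thesis .
    qed
    ultimately show "((\<lambda>w. - 2 * Y1 (1 - 2 * w)) has_field_derivative
       - ((1 - \<mu> - 2 * w) * (- 2 * Y1 (1 - 2 * w)) + \<nu> * (\<nu> + 1) * Y (1 - 2 * w)) / (w * (1 - w))) (at w)" by simp
  qed
  thus ?thesis unfolding Y_def A_def by blast
qed

text \<open>Every branch question below reduces to this: logarithms of the same number agree once
  their imaginary parts differ by less than a full period.\<close>

lemma complex_eq_if_exp_eq:
  assumes "exp a = exp b" "\<bar>Im a - Im b\<bar> < 2 * pi"
  shows "a = (b :: complex)"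
proof -
  obtain n :: int where n: "a = b + of_int (2 * n) * of_real pi * \<i>" using assms(1) exp_eq[of a b] by auto
  hence "Im a - Im b = 2 * of_int n * pi" by simp
  with assms(2) have "\<bar>of_int n :: real\<bar> * (2 * pi) < 1 * (2 * pi)" by (simp add: abs_mult mult_ac)
  hence "\<bar>of_int n :: real\<bar> < 1" using pi_gt_zero by (subst (asm) mult_less_cancel_right_pos) auto
  hence "n = 0" by linarith
  thus ?thesis using n by simp
qed

text \<open>Factor into 1 - 1/z and 1 + 1/z. The imaginary parts of z, z - 1, z + 1 and 1 - 1/z
  share one sign and that of 1 + 1/z is opposite, which keeps all differences of arguments below
  2\<pi>.\<close>

lemma Ln_one_minus_inverse_square:
  assumes "Im z \<noteq> 0"
  shows "Ln (1 - 1 / z\<^sup>2) = Ln (z - 1) + Ln (z + 1) - 2 * Ln z"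
proof -
  have nz: "z \<noteq> 0" "z - 1 \<noteq> 0" "z + 1 \<noteq> 0" using assms by (auto simp: complex_eq_iff)
  have nz': "1 - 1 / z \<noteq> 0" "1 + 1 / z \<noteq> 0" "1 - 1 / z\<^sup>2 \<noteq> 0"
  proof -
    show a: "1 - 1 / z \<noteq> 0" "1 + 1 / z \<noteq> 0" using nz by (auto simp: field_simps add_eq_0_iff)
    have "1 - 1 / z\<^sup>2 = (1 - 1 / z) * (1 + 1 / z)" by (simp add: algebra_simps power2_eq_square)
    thus "1 - 1 / z\<^sup>2 \<noteq> 0" using a by simp
  qed
  have Iminv: "Im (1 / z) = - Im z / ((Re z)\<^sup>2 + (Im z)\<^sup>2)" by (simp add: Im_divide)
  have pos: "(Re z)\<^sup>2 + (Im z)\<^sup>2 > 0" using assms by (simp add: sum_power2_gt_zero_iff)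
  have b: "\<bar>Im (Ln x)\<bar> \<le> pi" if "x \<noteq> 0" for x using that mpi_less_Im_Ln[of x] Im_Ln_le_pi[of x] by auto
  have sgn: "0 < Im (Ln x) \<and> Im (Ln x) < pi" if "Im x > 0" for x
    using that Im_Ln_pos_lt[of x] by force
  have sgn': "- pi < Im (Ln x) \<and> Im (Ln x) < 0" if "Im x < 0" for x
  proof -
    have "x \<noteq> 0" using that by auto
    with that have "\<not> (0 \<le> Im (Ln x) \<and> Im (Ln x) \<le> pi)" using Im_Ln_pos_le[of x] by simp
    thus ?thesis using mpi_less_Im_Ln[OF \<open>x \<noteq> 0\<close>] Im_Ln_le_pi[OF \<open>x \<noteq> 0\<close>] by auto
  qed
  have e: "exp (Ln (z - 1) - Ln z) = 1 - 1 / z" "exp (Ln (z + 1) - Ln z) = 1 + 1 / z"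
    using nz by (simp_all add: exp_diff field_simps)
  have cases: "Im z > 0 \<or> Im z < 0" using assms by auto
  have 1: "Ln (1 - 1 / z) = Ln (z - 1) - Ln z"
  proof (rule complex_eq_if_exp_eq)
    show "exp (Ln (1 - 1 / z)) = exp (Ln (z - 1) - Ln z)" using nz' e by simp
    have "Im (1 - 1 / z) = Im z / ((Re z)\<^sup>2 + (Im z)\<^sup>2)" using Iminv by simp
    hence "Im (1 - 1 / z) > 0 \<longleftrightarrow> Im z > 0" "Im (1 - 1 / z) < 0 \<longleftrightarrow> Im z < 0" using pos by (simp_all only: zero_less_divide_iff divide_less_0_iff) auto
    thus "\<bar>Im (Ln (1 - 1 / z)) - Im (Ln (z - 1) - Ln z)\<bar> < 2 * pi"
      using cases sgn[of "1 - 1 / z"] sgn[of "z - 1"] sgn[of z] sgn'[of "1 - 1 / z"] sgn'[of "z - 1"] sgn'[of z] by auto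
  qed
  have 2: "Ln (1 + 1 / z) = Ln (z + 1) - Ln z"
  proof (rule complex_eq_if_exp_eq)
    show "exp (Ln (1 + 1 / z)) = exp (Ln (z + 1) - Ln z)" using nz' e by simp
    have "Im (1 + 1 / z) = - (Im z / ((Re z)\<^sup>2 + (Im z)\<^sup>2))" using Iminv by simp
    hence "Im (1 + 1 / z) < 0 \<longleftrightarrow> Im z > 0" "Im (1 + 1 / z) > 0 \<longleftrightarrow> Im z < 0" using pos
      by (simp_all only: neg_less_0_iff_less neg_0_less_iff_less zero_less_divide_iff divide_less_0_iff) auto
    thus "\<bar>Im (Ln (1 + 1 / z)) - Im (Ln (z + 1) - Ln z)\<bar> < 2 * pi"
      using cases sgn[of "1 + 1 / z"] sgn[of "z + 1"] sgn[of z] sgn'[of "1 + 1 / z"] sgn'[of "z + 1"] sgn'[of z] by auto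
  qed
  have "Ln (1 - 1 / z\<^sup>2) = Ln (1 - 1 / z) + Ln (1 + 1 / z)"
  proof (rule complex_eq_if_exp_eq)
    show "exp (Ln (1 - 1 / z\<^sup>2)) = exp (Ln (1 - 1 / z) + Ln (1 + 1 / z))"
      using nz' by (simp add: exp_add algebra_simps power2_eq_square)
    have "Im (1 - 1 / z) = - Im (1 / z)" "Im (1 + 1 / z) = Im (1 / z)" by auto
    moreover have "Im (1 / z) \<noteq> 0" unfolding Iminv using pos assms by auto
    ultimately have "\<bar>Im (Ln (1 - 1 / z) + Ln (1 + 1 / z))\<bar> < pi"
      using sgn[of "1 - 1 / z"] sgn[of "1 + 1 / z"] sgn'[of "1 - 1 / z"] sgn'[of "1 + 1 / z"] by (cases "Im (1 / z) > 0") auto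
    thus "\<bar>Im (Ln (1 - 1 / z\<^sup>2)) - Im (Ln (1 - 1 / z) + Ln (1 + 1 / z))\<bar> < 2 * pi" using b[OF nz'(3)] by linarith
  qed
  thus ?thesis unfolding 1 2 by simp
qed

lemma one_minus_inverse_square_powr:
  assumes "Im z \<noteq> 0"
  shows "(1 - 1 / z\<^sup>2) powr \<mu> = (z - 1) powr \<mu> * (z + 1) powr \<mu> * z powr (- 2 * \<mu>)"
proof -
  have nz: "z \<noteq> 0" "z - 1 \<noteq> 0" "z + 1 \<noteq> 0" using assms by (auto simp: complex_eq_iff)
  have "1 - 1 / z\<^sup>2 \<noteq> 0"
  proof
    assume "1 - 1 / z\<^sup>2 = 0"
    hence "1 / z\<^sup>2 = 1" by simp
    thus False using inverse_square_in_slit_plane[OF assms] by (simp add: slit_plane_iff)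
  qed
  thus ?thesis using nz by (simp add: powr_def Ln_one_minus_inverse_square[OF assms] exp_add[symmetric] algebra_simps)
qed

lemma nontangential_path:
  fixes \<eta> \<sigma> :: real
  assumes "\<eta> > 0" "\<sigma>\<^sup>2 = 1"
  defines "z \<equiv> Complex (1 + \<eta>) (\<sigma> * \<eta>)"
  shows "norm (1 / z\<^sup>2) < 1" "norm (1 - 1 / z\<^sup>2) \<le> 2 * (1 - norm (1 / z\<^sup>2))"
proof -
  have s: "(\<sigma> * \<eta>)\<^sup>2 = \<eta>\<^sup>2" using assms by (simp add: power_mult_distrib)
  have n2: "(norm z)\<^sup>2 = 1 + 2 * \<eta> * (1 + \<eta>)"
    unfolding z_def cmod_power2 by (simp add: s) (simp add: power2_eq_square algebra_simps)
  have gt: "(norm z)\<^sup>2 > 1" unfolding n2 using assms by (simp add: add_pos_pos)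
  hence z0: "norm z > 0" by (metis less_numeral_extra(3) norm_ge_zero order_le_less power_zero_numeral zero_less_one order.strict_trans less_irrefl)
  show "norm (1 / z\<^sup>2) < 1" using gt z0 by (simp add: norm_divide norm_power divide_less_eq)
  have "norm (z - 1) \<le> 2 * \<eta>"
  proof (rule power2_le_imp_le)
    have "(norm (z - 1))\<^sup>2 = 2 * \<eta>\<^sup>2" unfolding z_def cmod_power2 by (simp add: s)
    thus "(norm (z - 1))\<^sup>2 \<le> (2 * \<eta>)\<^sup>2" by (simp add: power_mult_distrib)
  qed (use assms in auto)
  moreover have "norm (z + 1) \<le> 2 * (1 + \<eta>)"
  proof (rule power2_le_imp_le)
    have "(norm (z + 1))\<^sup>2 = (2 + \<eta>)\<^sup>2 + \<eta>\<^sup>2" unfolding z_def cmod_power2 by (simp add: s)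
    also have "\<dots> \<le> (2 * (1 + \<eta>))\<^sup>2" using assms by (simp add: power2_eq_square algebra_simps)
    finally show "(norm (z + 1))\<^sup>2 \<le> (2 * (1 + \<eta>))\<^sup>2" .
  qed (use assms in auto)
  ultimately have "norm ((z - 1) * (z + 1)) \<le> (2 * \<eta>) * (2 * (1 + \<eta>))"
    unfolding norm_mult by (intro mult_mono) (use assms in auto)
  also have "(z - 1) * (z + 1) = z\<^sup>2 - 1" by (simp add: power2_eq_square algebra_simps)
  also have "(2 * \<eta>) * (2 * (1 + \<eta>)) = 2 * ((norm z)\<^sup>2 - 1)" unfolding n2 by simp
  finally have "norm (z\<^sup>2 - 1) / (norm z)\<^sup>2 \<le> 2 * ((norm z)\<^sup>2 - 1) / (norm z)\<^sup>2" by (intro divide_right_mono) auto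
  moreover have "1 - 1 / z\<^sup>2 = (z\<^sup>2 - 1) / z\<^sup>2" using z0 by (simp add: field_simps)
  hence "norm (1 - 1 / z\<^sup>2) = norm (z\<^sup>2 - 1) / (norm z)\<^sup>2" by (simp only: norm_divide norm_power)
  moreover have "2 * ((norm z)\<^sup>2 - 1) / (norm z)\<^sup>2 = 2 * (1 - norm (1 / z\<^sup>2))"
    using z0 by (simp add: norm_divide norm_power field_simps)
  ultimately show "norm (1 - 1 / z\<^sup>2) \<le> 2 * (1 - norm (1 / z\<^sup>2))" by simp
qed

text \<open>The points w = 0 and w = 1, that is z = 1 and z = -1, both give 1/z^2 = 1, so one
  Abelian limit serves for both coefficients. They differ only by the phase that the power of z
  acquires at z = -1, which depends on the half-plane, here the sign \<open>s\<close>.\<close>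

lemma hyperF_reg_Q_connection:
  fixes \<nu> \<mu> w :: complex and s :: real
  assumes reg: "legE_regular \<nu> \<mu>" and s: "s = 1 \<or> s = - 1" and w: "s * Im w > 0"
  defines "z \<equiv> 1 - 2 * w"
  shows "(z - 1) powr \<mu> * z powr (- (\<nu> + \<mu> + 1)) * hyperF_reg ((\<nu> + \<mu> + 2) / 2) ((\<nu> + \<mu> + 1) / 2) (\<nu> + 3 / 2) (1 / z\<^sup>2)
    = 2 powr (- \<mu>) * rGamma ((\<nu> + \<mu> + 2) / 2) * rGamma ((\<nu> + \<mu> + 1) / 2) *
       (legE \<nu> \<mu> w + exp (- (of_real s * \<i> * of_real pi * (\<mu> - \<nu> - 1))) * (w powr \<mu> * (1 - w) powr (- \<mu>) * legE \<nu> \<mu> (1 - w)))"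
proof -
  define \<kappa> where "\<kappa> = \<nu> + \<mu> + 1"
  define \<Phi> where "\<Phi> = hyperF_reg ((\<nu> + \<mu> + 2) / 2) ((\<nu> + \<mu> + 1) / 2) (\<nu> + 3 / 2)"
  define C where "C = rGamma ((\<nu> + \<mu> + 2) / 2) * rGamma ((\<nu> + \<mu> + 1) / 2)"
  define \<Omega> where "\<Omega> = {w. s * Im w > 0}"
  define y where "y w = ((1 - 2 * w) - 1) powr \<mu> * (1 - 2 * w) powr (- \<kappa>) * \<Phi> (1 / (1 - 2 * w)\<^sup>2)" for w
  have \<mu>: "Re \<mu> \<ge> 1" using reg by (simp add: legE_regular_def)
  have s2: "s\<^sup>2 = 1" "s * s = 1" using s by auto
  have "\<Omega> = {w. Im w > 0} \<or> \<Omega> = {w. Im w < 0}" using s by (auto simp: \<Omega>_def)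
  hence \<Omega>: "open \<Omega>" "connected \<Omega>"
    by (auto simp: open_halfspace_Im_gt open_halfspace_Im_lt convex_connected convex_halfspace_Im_gt convex_halfspace_Im_lt)
  have sub: "\<Omega> \<subseteq> double_slit_plane" by (auto simp: \<Omega>_def double_slit_plane_iff)
  obtain y1 where sol: "leg_sol \<Omega> \<mu> (\<nu> * (\<nu> + 1)) y y1"
  proof -
    have "Im w \<noteq> 0" if "w \<in> \<Omega>" for w using that by (auto simp: \<Omega>_def)
    from leg_sol_Q[of \<Omega> \<mu> \<nu>, OF this] show ?thesis using that unfolding y_def \<kappa>_def \<Phi>_def by blast
  qed
  \<comment> \<open>Isolates (1 - 1/z^2)^\<mu> times \<Phi>(1/z^2), the quantity with a known limit.
    The remaining power of 2(1 - w) = z + 1 is the source of the constant 2^(-\<mu>).\<close>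
  have yform: "y x = (1 - 2 * x) powr (2 * \<mu> - \<kappa>) * (2 * (1 - x)) powr (- \<mu>) * ((1 - 1 / (1 - 2 * x)\<^sup>2) powr \<mu> * \<Phi> (1 / (1 - 2 * x)\<^sup>2))"
    if "x \<in> \<Omega>" for x
  proof -
    let ?z = "1 - 2 * x"
    have Im: "Im ?z \<noteq> 0" using that by (auto simp: \<Omega>_def)
    have nz: "?z \<noteq> 0" "?z + 1 \<noteq> 0" using Im by (auto simp: complex_eq_iff)
    have e: "2 * (1 - x) = ?z + 1" by simp
    have "?z powr (2 * \<mu> - \<kappa>) = ?z powr (- \<kappa>) * ?z powr (2 * \<mu>)" by (simp add: powr_add[symmetric])
    moreover have "?z powr (2 * \<mu>) * ?z powr (- 2 * \<mu>) = 1" using nz(1) by (simp add: powr_minus)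
    moreover have "(?z + 1) powr (- \<mu>) * (?z + 1) powr \<mu> = 1" using nz(2) by (simp add: powr_minus)
    ultimately have "?z powr (2 * \<mu> - \<kappa>) * (?z + 1) powr (- \<mu>) * ((?z - 1) powr \<mu> * (?z + 1) powr \<mu> * ?z powr (- 2 * \<mu>)) = (?z - 1) powr \<mu> * ?z powr (- \<kappa>)"
      by algebra
    thus ?thesis unfolding y_def e one_minus_inverse_square_powr[OF Im] by (simp only: mult.assoc[symmetric])
  qed
  let ?\<eta> = "\<lambda>j. 1 / (real j + 2)"
  have \<eta>: "?\<eta> j > 0" for j by simp
  have \<eta>lim: "?\<eta> \<longlonglongrightarrow> 0" using tendsto_Re[OF LIMSEQ_of_real_inverse_Suc] by (simp only: Re_complex_of_real zero_complex.sel)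
  \<comment> \<open>As z = 1 - 2w reverses the sign of the imaginary part, \<open>z0\<close> carries
    -s; near w = 1 the value of z is -z1, so \<open>z1\<close> carries s.\<close>
  define z0 where "z0 j = Complex (1 + ?\<eta> j) (- s * ?\<eta> j)" for j
  define z1 where "z1 j = Complex (1 + ?\<eta> j) (s * ?\<eta> j)" for j
  have zl: "z0 \<longlonglongrightarrow> 1" "z1 \<longlonglongrightarrow> 1"
  proof -
    have "(\<lambda>j. Complex (1 + ?\<eta> j) (t * ?\<eta> j)) \<longlonglongrightarrow> Complex (1 + 0) (t * 0)" for t
      by (intro tendsto_Complex tendsto_intros \<eta>lim)
    moreover have "Complex (1 + 0) (t * 0) = 1" for t by (simp add: complex_eq_iff)
    ultimately have L: "(\<lambda>j. Complex (1 + ?\<eta> j) (t * ?\<eta> j)) \<longlonglongrightarrow> 1" for t by (simp only:)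
    show "z0 \<longlonglongrightarrow> 1" "z1 \<longlonglongrightarrow> 1" unfolding z0_def z1_def by (rule L)+
  qed
  have abel: "(\<lambda>j. (1 - 1 / (u j)\<^sup>2) powr \<mu> * \<Phi> (1 / (u j)\<^sup>2)) \<longlonglongrightarrow> Gamma \<mu> * C"
    if u: "u \<longlonglongrightarrow> 1" "\<And>j. norm (1 / (u j)\<^sup>2) < 1" "\<And>j. norm (1 - 1 / (u j)\<^sup>2) \<le> 2 * (1 - norm (1 / (u j)\<^sup>2))" for u :: "nat \<Rightarrow> complex"
  proof -
    have "(\<lambda>j. 1 / (u j)\<^sup>2) \<longlonglongrightarrow> 1 / 1\<^sup>2" by (intro tendsto_intros u) auto
    moreover have "\<mu> = (\<nu> + \<mu> + 2) / 2 + (\<nu> + \<mu> + 1) / 2 - (\<nu> + 3 / 2)" by (simp add: field_simps)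
    ultimately show ?thesis unfolding \<Phi>_def C_def mult.assoc[symmetric]
      by (intro hyperF_reg_tendsto_at_1[OF \<mu> _ u(2,3)]) auto
  qed
  have ms2: "(- s)\<^sup>2 = 1" using s2 by simp
  have lim0: "(\<lambda>j. (1 - 1 / (z0 j)\<^sup>2) powr \<mu> * \<Phi> (1 / (z0 j)\<^sup>2)) \<longlonglongrightarrow> Gamma \<mu> * C"
  proof (rule abel[OF zl(1)])
    fix j
    show "norm (1 / (z0 j)\<^sup>2) < 1" "norm (1 - 1 / (z0 j)\<^sup>2) \<le> 2 * (1 - norm (1 / (z0 j)\<^sup>2))"
      unfolding z0_def by (rule nontangential_path[OF \<eta> ms2])+
  qed
  have lim1: "(\<lambda>j. (1 - 1 / (z1 j)\<^sup>2) powr \<mu> * \<Phi> (1 / (z1 j)\<^sup>2)) \<longlonglongrightarrow> Gamma \<mu> * C"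
  proof (rule abel[OF zl(2)])
    fix j
    show "norm (1 / (z1 j)\<^sup>2) < 1" "norm (1 - 1 / (z1 j)\<^sup>2) \<le> 2 * (1 - norm (1 / (z1 j)\<^sup>2))"
      unfolding z1_def by (rule nontangential_path[OF \<eta> s2(1)])+
  qed
  define q0 where "q0 j = (1 - z0 j) / 2" for j
  define q1 where "q1 j = (1 + z1 j) / 2" for j
  have q0: "q0 j \<in> \<Omega>" "1 - 2 * q0 j = z0 j" for j
  proof -
    have "s * Im (q0 j) = (s * s) * ?\<eta> j / 2" by (simp add: q0_def z0_def)
    thus "q0 j \<in> \<Omega>" using \<eta>[of j] by (simp add: s2 \<Omega>_def)
  qed (simp add: q0_def field_simps)
  have q1: "q1 j \<in> \<Omega>" "1 - 2 * q1 j = - z1 j" for j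
  proof -
    have "s * Im (q1 j) = (s * s) * ?\<eta> j / 2" by (simp add: q1_def z1_def)
    thus "q1 j \<in> \<Omega>" using \<eta>[of j] by (simp add: s2 \<Omega>_def)
  qed (simp add: q1_def field_simps)
  have q0l: "q0 \<longlonglongrightarrow> 0" unfolding q0_def using tendsto_divide[OF tendsto_diff[OF tendsto_const zl(1), of 1] tendsto_const, of 2] by simp
  have q1l: "q1 \<longlonglongrightarrow> 1" unfolding q1_def using tendsto_divide[OF tendsto_add[OF tendsto_const zl(2), of 1] tendsto_const, of 2] by simp
  define \<phi> where "\<phi> = exp (- (of_real s * \<i> * of_real pi * (\<mu> - \<nu> - 1)))"
  have "y w = (2 powr (- \<mu>) * C) * legE \<nu> \<mu> w + (2 powr (- \<mu>) * C * \<phi>) * (w powr \<mu> * (1 - w) powr (- \<mu>) * legE \<nu> \<mu> (1 - w))"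
  proof (rule leg_sol_double_slit_plane_eq_legE[OF reg \<Omega> sub sol q0(1) q0l q1(1) q1l])
    have "(\<lambda>j. z0 j powr (2 * \<mu> - \<kappa>) * (2 * (1 - q0 j)) powr (- \<mu>) * ((1 - 1 / (z0 j)\<^sup>2) powr \<mu> * \<Phi> (1 / (z0 j)\<^sup>2)))
        \<longlonglongrightarrow> 1 powr (2 * \<mu> - \<kappa>) * (2 * (1 - 0)) powr (- \<mu>) * (Gamma \<mu> * C)"
      by (intro tendsto_mult[OF tendsto_mult[OF tendsto_powr_complex tendsto_powr_complex] lim0] tendsto_intros zl q0l) auto
    thus "(\<lambda>j. y (q0 j)) \<longlonglongrightarrow> 2 powr (- \<mu>) * C * Gamma \<mu>"
      unfolding yform[OF q0(1)] q0(2) by (simp add: mult_ac)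
    \<comment> \<open>The phase: -z1 lies in the half-plane opposite to z1, and its principal
      logarithm is that of z1 minus s\<pi>i.\<close>
    have m1: "(- z1 j) powr m = z1 j powr m * exp (- (of_real s * \<i> * of_real pi * m))" for j m
    proof -
      have "z1 j \<noteq> 0" using s \<eta>[of j] by (auto simp: z1_def complex_eq_iff)
      have L: "Ln (- z1 j) = Ln (z1 j) - of_real s * \<i> * of_real pi"
        using s \<eta>[of j] \<open>z1 j \<noteq> 0\<close> by (subst Ln_minus) (auto simp: z1_def)
      show ?thesis unfolding powr_def L using \<open>z1 j \<noteq> 0\<close> by (simp add: exp_add[symmetric] algebra_simps)
    qed
    have "(1 - q1 j) powr \<mu> * y (q1 j) = z1 j powr (2 * \<mu> - \<kappa>) * \<phi> * 2 powr (- \<mu>) * ((1 - 1 / (z1 j)\<^sup>2) powr \<mu> * \<Phi> (1 / (z1 j)\<^sup>2))" for j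
    proof -
      have nz: "1 - q1 j \<noteq> 0" using q1(1)[of j] sub by (auto simp: double_slit_plane_def)
      have "(2 * (1 - q1 j)) powr (- \<mu>) = 2 powr (- \<mu>) * (1 - q1 j) powr (- \<mu>)"
        using powr_times_real_left[of "complex_of_real 2" "1 - q1 j" "- \<mu>"] by simp
      moreover have "(1 - q1 j) powr \<mu> * (1 - q1 j) powr (- \<mu>) = 1" using nz by (simp add: powr_minus)
      moreover have k: "2 * \<mu> - \<kappa> = \<mu> - \<nu> - 1" by (simp add: \<kappa>_def)
      have "(- z1 j) powr (2 * \<mu> - \<kappa>) = z1 j powr (2 * \<mu> - \<kappa>) * \<phi>" unfolding m1 \<phi>_def k ..
      ultimately show ?thesis unfolding yform[OF q1(1)] q1(2) power2_minus by algebra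
    qed
    moreover have "(\<lambda>j. z1 j powr (2 * \<mu> - \<kappa>) * \<phi> * 2 powr (- \<mu>) * ((1 - 1 / (z1 j)\<^sup>2) powr \<mu> * \<Phi> (1 / (z1 j)\<^sup>2)))
        \<longlonglongrightarrow> 1 powr (2 * \<mu> - \<kappa>) * \<phi> * 2 powr (- \<mu>) * (Gamma \<mu> * C)"
      by (intro tendsto_mult[OF tendsto_mult[OF tendsto_mult[OF tendsto_powr_complex tendsto_const] tendsto_const] lim1] tendsto_intros zl) auto
    ultimately show "(\<lambda>j. (1 - q1 j) powr \<mu> * y (q1 j)) \<longlonglongrightarrow> 2 powr (- \<mu>) * C * \<phi> * Gamma \<mu>"
      by (simp add: mult_ac)
    show "w \<in> \<Omega>" using w by (simp add: \<Omega>_def)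
  qed
  thus ?thesis unfolding y_def z_def \<kappa>_def \<Phi>_def C_def \<phi>_def by (simp add: algebra_simps)
qed

section \<open>The expansions\<close>

text \<open>\<open>wvar \<xi>\<close> is \<open>(1 - coth \<xi>) / 2\<close>, so that the two expansion variables are \<open>2 * wvar \<xi>\<close> and
  \<open>2 * (1 - wvar \<xi>)\<close>.\<close>

definition wvar :: "complex \<Rightarrow> complex" where
  "wvar \<xi> = - 1 / (exp (2 * \<xi>) - 1)"

section \<open>The change of variable and its branches\<close>

lemma D_half_exp_neq_1:
  assumes "\<xi> \<in> D_half" shows "exp (2 * \<xi>) - 1 \<noteq> 0"
proof
  assume "exp (2 * \<xi>) - 1 = 0"
  hence "norm (exp (2 * \<xi>)) = 1" by simp
  thus False using assms by (simp add: D_half_def)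
qed

lemma sinh_conv_exp: "2 * sinh \<xi> = (exp (2 * \<xi>) - 1) * exp (- \<xi>)" for \<xi> :: complex
proof -
  have "exp (2 * \<xi>) * exp (- \<xi>) = exp \<xi>" by (simp add: exp_add[symmetric])
  thus ?thesis unfolding left_diff_distrib by (simp add: sinh_field_def)
qed

lemma cosh_conv_exp: "2 * cosh \<xi> = (exp (2 * \<xi>) + 1) * exp (- \<xi>)" for \<xi> :: complex
proof -
  have "exp (2 * \<xi>) * exp (- \<xi>) = exp \<xi>" by (simp add: exp_add[symmetric])
  thus ?thesis unfolding distrib_right by (simp add: cosh_field_def)
qed

lemma wvar_facts:
  assumes "\<xi> \<in> D_half"
  shows "coth \<xi> = 1 - 2 * wvar \<xi>" "- exp (- \<xi>) / sinh \<xi> = 2 * wvar \<xi>" "exp \<xi> / sinh \<xi> = 2 * (1 - wvar \<xi>)"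
    "wvar \<xi> \<noteq> 0" "1 - wvar \<xi> \<noteq> 0" "exp (- 2 * \<xi>) = wvar \<xi> / (wvar \<xi> - 1)"
proof -
  define Z where "Z = exp (2 * \<xi>)"
  have Z: "Z - 1 \<noteq> 0" "Z \<noteq> 0" using D_half_exp_neq_1[OF assms] by (auto simp: Z_def)
  have w: "wvar \<xi> = - 1 / (Z - 1)" by (simp add: wvar_def Z_def)
  have w1: "1 - wvar \<xi> = Z / (Z - 1)" unfolding w using Z by (simp add: field_simps)
  have "coth \<xi> = (2 * cosh \<xi>) / (2 * sinh \<xi>)" by (simp add: coth_def)
  also have "\<dots> = (Z + 1) / (Z - 1)" unfolding sinh_conv_exp cosh_conv_exp Z_def[symmetric] by simp
  finally show "coth \<xi> = 1 - 2 * wvar \<xi>" unfolding w using Z by (simp add: field_simps)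
  have "- exp (- \<xi>) / sinh \<xi> = 2 * (- exp (- \<xi>) / (2 * sinh \<xi>))" by simp
  also have "\<dots> = 2 * wvar \<xi>" unfolding sinh_conv_exp Z_def[symmetric] w by simp
  finally show "- exp (- \<xi>) / sinh \<xi> = 2 * wvar \<xi>" .
  have ez: "Z * exp (- \<xi>) = exp \<xi>" by (simp add: Z_def exp_add[symmetric])
  have "exp \<xi> / sinh \<xi> = 2 * (Z * exp (- \<xi>) / (2 * sinh \<xi>))" unfolding ez by simp
  also have "2 * (Z * exp (- \<xi>) / (2 * sinh \<xi>)) = 2 * (1 - wvar \<xi>)" unfolding sinh_conv_exp Z_def[symmetric] w1 by simp
  finally show "exp \<xi> / sinh \<xi> = 2 * (1 - wvar \<xi>)" .
  show "wvar \<xi> \<noteq> 0" "1 - wvar \<xi> \<noteq> 0" unfolding w1 using Z by (auto simp: w)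
  have "exp (- 2 * \<xi>) = 1 / Z" by (simp add: Z_def exp_minus field_simps)
  also have "\<dots> = wvar \<xi> / (- (1 - wvar \<xi>))" unfolding w1 unfolding w using Z by (simp add: field_simps)
  finally show "exp (- 2 * \<xi>) = wvar \<xi> / (wvar \<xi> - 1)" by simp
qed

text \<open>The assumption |sinh \<xi>| \<ge> \<epsilon> enters here: it bounds the expansion
  variable, because |exp(-\<xi>)| \<le> 1.\<close>

lemma norm_wvar_le:
  assumes "\<xi> \<in> D_half" "\<epsilon> \<le> norm (sinh \<xi>)" "\<epsilon> > 0"
  shows "norm (wvar \<xi>) \<le> 1 / (2 * \<epsilon>)"
proof -
  have "norm (2 * wvar \<xi>) = norm (exp (- \<xi>)) / norm (sinh \<xi>)" unfolding wvar_facts(2)[OF assms(1), symmetric] by (simp add: norm_divide)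
  also have "\<dots> \<le> 1 / \<epsilon>" using assms by (intro frac_le) (auto simp: D_half_def)
  finally show ?thesis by (simp add: norm_mult field_simps)
qed

lemma Im_wvar: "Im (wvar \<xi>) = Im (exp (2 * \<xi>)) / (norm (exp (2 * \<xi>) - 1))\<^sup>2"
  by (simp add: wvar_def Im_divide cmod_power2)

lemma sgn_Im_wvar:
  assumes \<xi>: "\<xi> \<in> D_half" and s: "s = 1 \<or> s = - 1" "s * Im \<xi> > 0"
  shows "s * Im (wvar \<xi>) > 0"
proof -
  have "s * sin (2 * Im \<xi>) = sin (2 * (s * Im \<xi>))" using s(1) by auto
  moreover have "sin (2 * (s * Im \<xi>)) > 0" using s \<xi> by (intro sin_gt_zero) (auto simp: D_half_def)
  moreover have "s * Im (exp (2 * \<xi>)) = exp (2 * Re \<xi>) * (s * sin (2 * Im \<xi>))" by (simp add: Im_exp)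
  ultimately have "s * Im (exp (2 * \<xi>)) > 0" by simp
  moreover have "(norm (exp (2 * \<xi>) - 1))\<^sup>2 > 0" using D_half_exp_neq_1[OF \<xi>] by simp
  ultimately show ?thesis unfolding Im_wvar by (metis divide_pos_pos times_divide_eq_right)
qed

lemma Im_Ln_sgn:
  assumes "s = 1 \<or> s = - 1" "s * Im x > 0"
  shows "0 < s * Im (Ln x) \<and> s * Im (Ln x) < pi"
proof -
  have x: "x \<noteq> 0" using assms by auto
  consider "s = 1" "Im x > 0" | "s = - 1" "Im x < 0" using assms by force
  thus ?thesis
  proof cases
    case 1 thus ?thesis using Im_Ln_pos_lt[OF x] by simp
  next
    case 2
    hence "\<not> (0 \<le> Im (Ln x) \<and> Im (Ln x) \<le> pi)" using Im_Ln_pos_le[OF x] by simp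
    thus ?thesis using 2 mpi_less_Im_Ln[OF x] Im_Ln_le_pi[OF x] by auto
  qed
qed

text \<open>w/(1 - w) = -exp(-2\<xi>), and the signs of the imaginary parts select the logarithm
  -2\<xi> + s\<pi>i. The resulting phase is the one that appears in the coefficient
  \<open>C_coeff\<close> of P.\<close>

lemma wvar_powr:
  assumes \<xi>: "\<xi> \<in> D_half" and s: "s = 1 \<or> s = - 1" "s * Im \<xi> > 0"
  shows "wvar \<xi> powr \<mu> * (1 - wvar \<xi>) powr (- \<mu>) = exp (- 2 * \<mu> * \<xi>) * exp (of_real s * \<i> * of_real pi * \<mu>)"
proof -
  note f = wvar_facts[OF \<xi>]
  have "Ln (wvar \<xi>) - Ln (1 - wvar \<xi>) = - 2 * \<xi> + of_real s * \<i> * of_real pi"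
  proof (rule complex_eq_if_exp_eq)
    have "exp (of_real s * \<i> * of_real pi) = -1" using s(1) by (auto simp: exp_minus mult.commute)
    hence "exp (- 2 * \<xi> + of_real s * \<i> * of_real pi) = - (wvar \<xi> / (wvar \<xi> - 1))" unfolding exp_add f(6) by simp
    also have "\<dots> = wvar \<xi> / (1 - wvar \<xi>)" by (metis minus_diff_eq minus_divide_right)
    finally show "exp (Ln (wvar \<xi>) - Ln (1 - wvar \<xi>)) = exp (- 2 * \<xi> + of_real s * \<i> * of_real pi)"
      using f(4,5) by (simp add: exp_diff)
    have "0 < s * Im (Ln (wvar \<xi>)) \<and> s * Im (Ln (wvar \<xi>)) < pi"
      using sgn_Im_wvar[OF \<xi> s] by (intro Im_Ln_sgn[OF s(1)])
    moreover have "0 < (- s) * Im (Ln (1 - wvar \<xi>)) \<and> (- s) * Im (Ln (1 - wvar \<xi>)) < pi"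
      using sgn_Im_wvar[OF \<xi> s] s(1) by (intro Im_Ln_sgn) auto
    moreover have "0 < s * Im \<xi>" "s * Im \<xi> < pi / 2" using s \<xi> by (auto simp: D_half_def)
    ultimately show "\<bar>Im (Ln (wvar \<xi>) - Ln (1 - wvar \<xi>)) - Im (- 2 * \<xi> + of_real s * \<i> * of_real pi)\<bar> < 2 * pi"
      using s(1) by auto
  qed
  hence "exp (\<mu> * (Ln (wvar \<xi>) - Ln (1 - wvar \<xi>))) = exp (\<mu> * (- 2 * \<xi> + of_real s * \<i> * of_real pi))" by simp
  thus ?thesis using f(4,5) by (simp add: powr_def exp_add[symmetric] exp_diff[symmetric] algebra_simps)
qed

text \<open>|Im (2\<xi>)| < \<pi> on \<open>D_half\<close>, so 2\<xi> is the principal logarithm of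
  its exponential.\<close>

lemma coth_powr_P:
  assumes \<xi>: "\<xi> \<in> D_half"
  shows "((coth \<xi> + 1) / (coth \<xi> - 1)) powr (\<mu> / 2) = exp (\<mu> * \<xi>)"
proof -
  note f = wvar_facts[OF \<xi>]
  have "(coth \<xi> + 1) / (coth \<xi> - 1) = (1 - wvar \<xi>) / (- wvar \<xi>)" unfolding f(1)
    using f(4) by (simp add: field_simps)
  also have "\<dots> = 1 / exp (- 2 * \<xi>)" unfolding f(6) using f(4,5) by (simp add: field_simps)
  also have "\<dots> = exp (2 * \<xi>)" by (simp add: exp_minus field_simps)
  finally have e: "(coth \<xi> + 1) / (coth \<xi> - 1) = exp (2 * \<xi>)" .
  have "Ln (exp (2 * \<xi>)) = 2 * \<xi>" using \<xi> by (intro Ln_exp) (auto simp: D_half_def)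
  thus ?thesis unfolding e by (simp add: powr_def)
qed

text \<open>z + 1 and z - 1 lie in the same half-plane, so the difference of their principal
  logarithms is exactly 2\<xi>. This brings Q into the form whose differential equation was
  verified.\<close>

lemma coth_powr_Q:
  assumes \<xi>: "\<xi> \<in> D_half" and s: "s = 1 \<or> s = - 1" "s * Im \<xi> > 0"
  shows "(coth \<xi> - 1) powr (\<mu> / 2) * (coth \<xi> + 1) powr (\<mu> / 2) = exp (\<mu> * \<xi>) * (coth \<xi> - 1) powr \<mu>"
proof -
  note f = wvar_facts[OF \<xi>]
  have nz: "coth \<xi> - 1 \<noteq> 0" "coth \<xi> + 1 \<noteq> 0" unfolding f(1) using f(4,5) by (auto simp: algebra_simps)
  have "Ln (coth \<xi> + 1) - Ln (coth \<xi> - 1) = 2 * \<xi>"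
  proof (rule complex_eq_if_exp_eq)
    have "(coth \<xi> + 1) / (coth \<xi> - 1) = (1 - wvar \<xi>) / (- wvar \<xi>)" unfolding f(1)
      using f(4) by (simp add: field_simps)
    also have "\<dots> = 1 / exp (- 2 * \<xi>)" unfolding f(6) using f(4,5) by (simp add: field_simps)
    also have "\<dots> = exp (2 * \<xi>)" by (simp add: exp_minus field_simps)
    finally show "exp (Ln (coth \<xi> + 1) - Ln (coth \<xi> - 1)) = exp (2 * \<xi>)" using nz by (simp add: exp_diff)
    have "0 < (- s) * Im (Ln (coth \<xi> + 1)) \<and> (- s) * Im (Ln (coth \<xi> + 1)) < pi"
      using sgn_Im_wvar[OF \<xi> s] s(1) by (intro Im_Ln_sgn) (auto simp: f(1))
    moreover have "0 < (- s) * Im (Ln (coth \<xi> - 1)) \<and> (- s) * Im (Ln (coth \<xi> - 1)) < pi"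
      using sgn_Im_wvar[OF \<xi> s] s(1) by (intro Im_Ln_sgn) (auto simp: f(1))
    moreover have "0 < s * Im \<xi>" "s * Im \<xi> < pi / 2" using s \<xi> by (auto simp: D_half_def)
    ultimately show "\<bar>Im (Ln (coth \<xi> + 1) - Ln (coth \<xi> - 1)) - Im (2 * \<xi>)\<bar> < 2 * pi"
      using s(1) by auto
  qed
  hence "Ln (coth \<xi> + 1) = Ln (coth \<xi> - 1) + 2 * \<xi>" by (simp add: algebra_simps)
  thus ?thesis using nz by (simp add: powr_def exp_add[symmetric] algebra_simps)
qed

section \<open>The connection formulas in the variable \<xi>\<close>

lemma C_coeff_half:
  assumes s: "s = 1 \<or> s = - 1" "s * Im \<xi> > 0"
  shows "C_coeff \<xi> (- m - 1 / 2) = - exp (of_real s * \<i> * of_real pi * m)"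
proof -
  have h: "exp (\<i> * of_real pi / 2) = \<i>" "exp (- (\<i> * of_real pi / 2)) = - \<i>"
    using cis_pi_half unfolding cis_conv_exp by (simp_all add: exp_minus mult.commute)
  consider "s = 1" "Im \<xi> > 0" | "s = - 1" "Im \<xi> < 0" using s by force
  thus ?thesis
  proof cases
    case 1
    have "exp (- (of_real pi * \<i> * (- m - 1 / 2))) = exp (\<i> * of_real pi / 2) * exp (\<i> * of_real pi * m)"
      by (simp add: exp_add[symmetric] algebra_simps)
    thus ?thesis using 1 by (simp add: C_coeff_def h)
  next
    case 2
    have "exp (of_real pi * \<i> * (- m - 1 / 2)) = exp (- (\<i> * of_real pi / 2)) * exp (- (\<i> * of_real pi * m))"
      by (simp add: exp_add[symmetric] algebra_simps)
    thus ?thesis using 2 by (simp add: C_coeff_def h)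
  qed
qed

lemma C_coeff_real:
  assumes "Im \<xi> = 0"
  shows "C_coeff \<xi> (- m - 1 / 2) = (- exp (\<i> * of_real pi * m) + - exp (- (\<i> * of_real pi * m))) / 2"
proof -
  have "C_coeff \<xi> (- m - 1 / 2) = sin (of_real pi * (- m - 1 / 2))" using assms by (simp add: C_coeff_def)
  also have "\<dots> = - sin (of_real pi * m + of_real pi / 2)" by (simp add: algebra_simps flip: sin_minus)
  also have "\<dots> = - cos (of_real pi * m)" by (simp add: sin_add)
  finally show ?thesis by (simp add: cos_exp_eq mult_ac diff_divide_distrib add_divide_distrib)
qed

text \<open>Restricted to nonreal \<xi> because \<open>wvar \<xi>\<close> lies on the cut of
  \<open>legE\<close> otherwise. The factor exp(-2\<mu>\<xi>) of the reflected solution turns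
  exp(\<mu>\<xi>) into exp(-\<mu>\<xi>), and the minus sign of the second coefficient is absorbed by
  \<open>C_coeff\<close>.\<close>

lemma legendre_P_connection:
  assumes \<xi>: "\<xi> \<in> D_half" and im: "Im \<xi> \<noteq> 0" and reg: "legE_regular \<nu> \<mu>"
  shows "legendre_P \<nu> \<mu> (coth \<xi>) = sin (of_real pi * \<mu>) / of_real pi * exp (\<mu> * \<xi>) * legE \<nu> \<mu> (wvar \<xi>)
     + C_coeff \<xi> (- \<mu> - 1 / 2) * (sin (of_real pi * \<nu>) / of_real pi) * exp (- \<mu> * \<xi>) * legE \<nu> \<mu> (1 - wvar \<xi>)"
proof -
  define s :: real where "s = sgn (Im \<xi>)"
  have s: "s = 1 \<or> s = - 1" "s * Im \<xi> > 0" using im by (auto simp: s_def sgn_if)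
  have w: "wvar \<xi> \<in> double_slit_plane" using sgn_Im_wvar[OF \<xi> s] by (auto simp: double_slit_plane_iff)
  have e: "(1 - coth \<xi>) / 2 = wvar \<xi>" by (simp add: wvar_facts(1)[OF \<xi>])
  have x: "exp (- \<mu> * \<xi>) = exp (\<mu> * \<xi>) * exp (- 2 * \<mu> * \<xi>)" by (simp add: exp_add[symmetric] algebra_simps)
  show ?thesis unfolding legendre_P_def coth_powr_P[OF \<xi>] e hyperF_reg_P_connection[OF reg w] wvar_powr[OF \<xi> s] C_coeff_half[OF s] x
    by (simp add: algebra_simps)
qed

text \<open>The duplication formula reduces the constants to 1/2; positivity of the real part keeps
  its arguments away from the poles. In the phase, \<mu> cancels between the branch of z near -1 and
  that of w/(1 - w), leaving -exp(s\<pi>i\<nu>), so here \<open>C_coeff\<close> depends on \<nu>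
  only.\<close>

lemma legendre_Q_connection:
  assumes \<xi>: "\<xi> \<in> D_half" and im: "Im \<xi> \<noteq> 0" and reg: "legE_regular \<nu> \<mu>" and \<kappa>: "Re (\<nu> + \<mu> + 1) > 0"
  shows "exp (- (of_real pi * \<i> * \<mu>)) * legendre_Q \<nu> \<mu> (coth \<xi>) = 1 / 2 * exp (\<mu> * \<xi>) * legE \<nu> \<mu> (wvar \<xi>)
     + C_coeff \<xi> (- \<nu> - 1 / 2) * (1 / 2) * exp (- \<mu> * \<xi>) * legE \<nu> \<mu> (1 - wvar \<xi>)"
proof -
  define s :: real where "s = sgn (Im \<xi>)"
  have s: "s = 1 \<or> s = - 1" "s * Im \<xi> > 0" using im by (auto simp: s_def sgn_if)
  define k where "k = \<nu> + \<mu> + 1"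
  define z where "z = coth \<xi>"
  have z: "z = 1 - 2 * wvar \<xi>" by (simp add: z_def wvar_facts(1)[OF \<xi>])
  define \<Phi> where "\<Phi> = hyperF_reg ((\<nu> + \<mu> + 2) / 2) ((\<nu> + \<mu> + 1) / 2) (\<nu> + 3 / 2) (1 / z\<^sup>2)"
  define E0 E1 where "E0 = legE \<nu> \<mu> (wvar \<xi>)" and "E1 = legE \<nu> \<mu> (1 - wvar \<xi>)"
  have conn: "(z - 1) powr \<mu> * z powr (- k) * \<Phi> = 2 powr (- \<mu>) * rGamma ((k + 1) / 2) * rGamma (k / 2) *
     (E0 + exp (- (of_real s * \<i> * of_real pi * (\<mu> - \<nu> - 1))) * (exp (- 2 * \<mu> * \<xi>) * exp (of_real s * \<i> * of_real pi * \<mu>) * E1))"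
    using hyperF_reg_Q_connection[OF reg s(1) sgn_Im_wvar[OF \<xi> s]]
    unfolding z[symmetric] \<Phi>_def E0_def E1_def wvar_powr[OF \<xi> s] k_def by (simp add: add.assoc)
  have G: "of_real (sqrt pi) * Gamma k * (2 powr (- \<mu>) * rGamma ((k + 1) / 2) * rGamma (k / 2)) / 2 powr (\<nu> + 1) = 1 / 2"
  proof -
    have Rek: "Re k > 0" using \<kappa> by (simp add: k_def)
    have np: "k / 2 \<notin> \<int>\<^sub>\<le>\<^sub>0" "k / 2 + 1 / 2 \<notin> \<int>\<^sub>\<le>\<^sub>0" "k \<notin> \<int>\<^sub>\<le>\<^sub>0"
      using Rek by (auto intro!: notin_nonpos_Ints_if_Re_pos)
    have "Gamma (k / 2) * Gamma (k / 2 + 1 / 2) = exp ((1 - 2 * (k / 2)) * of_real (ln 2)) * of_real (sqrt pi) * Gamma (2 * (k / 2))"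
      by (rule Gamma_legendre_duplication[OF np(1,2)])
    moreover have "exp ((1 - 2 * (k / 2)) * of_real (ln 2)) = (2 :: complex) powr (1 - k)"
      by (simp add: powr_def Ln_of_real[of 2, simplified])
    ultimately have d: "Gamma (k / 2) * Gamma ((k + 1) / 2) = 2 powr (1 - k) * of_real (sqrt pi) * Gamma k" by (simp add: add_divide_distrib)
    have nz: "Gamma k \<noteq> 0" using np by (simp add: Gamma_eq_zero_iff)
    have "rGamma ((k + 1) / 2) * rGamma (k / 2) = 1 / (Gamma (k / 2) * Gamma ((k + 1) / 2))"
      by (simp add: rGamma_inverse_Gamma field_simps)
    also have "\<dots> = 1 / (2 powr (1 - k) * of_real (sqrt pi) * Gamma k)" unfolding d ..
    finally have r: "rGamma ((k + 1) / 2) * rGamma (k / 2) = 1 / (2 powr (1 - k) * of_real (sqrt pi) * Gamma k)" .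
    have "(2 :: complex) powr (- \<mu>) / 2 powr (\<nu> + 1) = 2 powr (- k)" 
    proof -
      have e: "- \<mu> - (\<nu> + 1) = - k" by (simp add: k_def)
      show ?thesis unfolding powr_diff[symmetric] e ..
    qed
    also have "\<dots> = 2 powr (1 - k) / 2" by (simp add: powr_diff powr_minus field_simps)
    finally have p: "(2 :: complex) powr (- \<mu>) / 2 powr (\<nu> + 1) = 2 powr (1 - k) / 2" .
    have "of_real (sqrt pi) * Gamma k * (2 powr (- \<mu>) * rGamma ((k + 1) / 2) * rGamma (k / 2)) / 2 powr (\<nu> + 1)
      = of_real (sqrt pi) * Gamma k * (2 powr (- \<mu>) / 2 powr (\<nu> + 1)) * (rGamma ((k + 1) / 2) * rGamma (k / 2))" by simp
    also have "\<dots> = 1 / 2" unfolding p r using nz by simp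
    finally show ?thesis .
  qed
  have "exp (- (of_real pi * \<i> * \<mu>)) * legendre_Q \<nu> \<mu> z =
      of_real (sqrt pi) * Gamma k * (exp (\<mu> * \<xi>) * (z - 1) powr \<mu>) / (2 powr (\<nu> + 1) * z powr k) * \<Phi>"
    unfolding legendre_Q_def \<Phi>_def[symmetric] unfolding k_def[symmetric] coth_powr_Q[OF \<xi> s, folded z_def]
    by (simp add: exp_minus field_simps)
  also have "\<dots> = of_real (sqrt pi) * Gamma k / 2 powr (\<nu> + 1) * exp (\<mu> * \<xi>) * ((z - 1) powr \<mu> * z powr (- k) * \<Phi>)"
    by (simp add: powr_minus field_simps)
  also have "\<dots> = (of_real (sqrt pi) * Gamma k * (2 powr (- \<mu>) * rGamma ((k + 1) / 2) * rGamma (k / 2)) / 2 powr (\<nu> + 1)) * exp (\<mu> * \<xi>) *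
     (E0 + exp (- (of_real s * \<i> * of_real pi * (\<mu> - \<nu> - 1))) * (exp (- 2 * \<mu> * \<xi>) * exp (of_real s * \<i> * of_real pi * \<mu>) * E1))"
    unfolding conn by simp
  also have "\<dots> = 1 / 2 * exp (\<mu> * \<xi>) * E0 + 1 / 2 * (exp (\<mu> * \<xi>) * exp (- (of_real s * \<i> * of_real pi * (\<mu> - \<nu> - 1))) * exp (- 2 * \<mu> * \<xi>) * exp (of_real s * \<i> * of_real pi * \<mu>)) * E1"
    unfolding G by (simp add: algebra_simps)
  also have "exp (\<mu> * \<xi>) * exp (- (of_real s * \<i> * of_real pi * (\<mu> - \<nu> - 1))) * exp (- 2 * \<mu> * \<xi>) * exp (of_real s * \<i> * of_real pi * \<mu>)
    = exp (of_real s * \<i> * of_real pi) * exp (of_real s * \<i> * of_real pi * \<nu>) * exp (- \<mu> * \<xi>)"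
    by (simp add: exp_add[symmetric] algebra_simps)
  also have "exp (of_real s * \<i> * of_real pi) = -1" using s(1) by (auto simp: exp_minus mult.commute)
  finally show ?thesis unfolding C_coeff_half[OF s] E0_def E1_def z_def by simp
qed

text \<open>The expansion with N = 1 and |p| \<le> 1, whose only term is \<Gamma>(\<mu>).\<close>

lemma legE_regular_eventually:
  assumes "B \<ge> 0" "Y \<ge> 0"
  obtains R where "\<And>\<nu> \<mu>. norm \<nu> \<le> B \<Longrightarrow> \<bar>Im \<mu>\<bar> \<le> Y \<Longrightarrow> R \<le> Re \<mu> \<Longrightarrow> legE_regular \<nu> \<mu>"
proof -
  obtain K R where K: "K \<ge> 0" and bound:
    "\<And>\<nu> \<mu> p. norm \<nu> \<le> B \<Longrightarrow> \<bar>Im \<mu>\<bar> \<le> Y \<Longrightarrow> R \<le> Re \<mu> \<Longrightarrow> p \<notin> \<real>\<^sub>\<le>\<^sub>0 \<Longrightarrow> norm p \<le> 1 \<Longrightarrow>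
       norm (legE \<nu> \<mu> p - (\<Sum>n<1. a_coeff n (\<nu> + 1/2) * Gamma (\<mu> - of_nat n) * (2 * p) ^ n)) \<le> K * (norm (Gamma (\<mu> - of_nat 1)) * norm p ^ 1)"
    and hol: "\<And>\<nu> \<mu>. norm \<nu> \<le> B \<Longrightarrow> R \<le> Re \<mu> \<Longrightarrow> legE \<nu> \<mu> holomorphic_on - \<real>\<^sub>\<le>\<^sub>0"
    and ode: "\<And>\<nu> \<mu> p. norm \<nu> \<le> B \<Longrightarrow> R \<le> Re \<mu> \<Longrightarrow> p \<notin> \<real>\<^sub>\<le>\<^sub>0 \<Longrightarrow>
        p * (1 - p) * deriv (deriv (legE \<nu> \<mu>)) p + (1 - \<mu> - 2 * p) * deriv (legE \<nu> \<mu>) p + \<nu> * (\<nu> + 1) * legE \<nu> \<mu> p = 0"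
    by (rule legE_expansion[of B 1 Y 1]) (use assms in auto)
  have "legE_regular \<nu> \<mu>" if "norm \<nu> \<le> B" "\<bar>Im \<mu>\<bar> \<le> Y" "max R 1 \<le> Re \<mu>" for \<nu> \<mu>
    unfolding legE_regular_def
  proof (intro conjI allI impI exI)
    fix p :: complex assume "p \<notin> \<real>\<^sub>\<le>\<^sub>0" "norm p \<le> 1"
    from bound[of \<nu> \<mu> p, OF that(1,2) _ this] that(3)
    show "norm (legE \<nu> \<mu> p - Gamma \<mu>) \<le> (K * norm (Gamma (\<mu> - 1))) * norm p"
      by (simp add: a_coeff_def mult_ac)
  qed (use that hol ode in auto)
  thus ?thesis using that by blast
qed

text \<open>For real \<open>\<xi>\<close> the point \<open>wvar \<xi>\<close> lies on the cut of \<open>legE\<close>. The remainders approaching from above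
  and from below have limit points with the same bound, and their mean is the required one, since the
  coefficient \<open>C(\<xi>, \<cdot>)\<close> for real \<open>\<xi>\<close> is the mean of its two one-sided values.\<close>

lemma inverse_factorial_expansion_if_connection:
  fixes f A :: "complex \<Rightarrow> complex \<Rightarrow> complex \<Rightarrow> complex" and b m :: "complex \<Rightarrow> complex \<Rightarrow> complex" and V :: "complex set" and W :: "real set"
  assumes \<epsilon>: "\<epsilon> > 0" and V: "bounded V" and W: "bounded W"
  defines "S \<equiv> {(\<xi>, \<nu>, \<mu>). \<xi> \<in> D_half \<and> \<epsilon> \<le> norm (sinh \<xi>) \<and> \<nu> \<in> V \<and> Im \<mu> \<in> W}"
  assumes conn: "\<And>\<xi> \<nu> \<mu>. \<xi> \<in> D_half \<Longrightarrow> Im \<xi> \<noteq> 0 \<Longrightarrow> \<nu> \<in> V \<Longrightarrow> Im \<mu> \<in> W \<Longrightarrow> R0 \<le> Re \<mu> \<Longrightarrow>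
      f \<xi> \<nu> \<mu> = A \<xi> \<nu> \<mu> * legE \<nu> \<mu> (wvar \<xi>) + C_coeff \<xi> (- m \<nu> \<mu> - 1 / 2) * b \<nu> \<mu> * exp (- \<mu> * \<xi>) * legE \<nu> \<mu> (1 - wvar \<xi>)"
    and contf: "\<And>\<xi> \<nu> \<mu>. \<xi> \<in> D_half \<Longrightarrow> Im \<xi> = 0 \<Longrightarrow> isCont (\<lambda>\<xi>. f \<xi> \<nu> \<mu>) \<xi>"
    and contA: "\<And>\<xi> \<nu> \<mu>. isCont (\<lambda>\<xi>. A \<xi> \<nu> \<mu>) \<xi>"
  shows "inverse_factorial_expansion S f A (\<lambda>\<xi>. - exp (- \<xi>) / sinh \<xi>)
     (\<lambda>\<xi> \<nu> \<mu>. C_coeff \<xi> (- m \<nu> \<mu> - 1 / 2) * b \<nu> \<mu> * exp (- \<mu> * \<xi>)) (\<lambda>\<xi>. exp \<xi> / sinh \<xi>)"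
  unfolding inverse_factorial_expansion_def
proof (intro allI)
  fix N M :: nat
  obtain B where B: "B \<ge> 0" "\<And>\<nu>. \<nu> \<in> V \<Longrightarrow> norm \<nu> \<le> B"
    using V unfolding bounded_iff by (metis abs_ge_zero order.trans abs_ge_self)
  obtain Y where Y: "Y \<ge> 0" "\<And>y. y \<in> W \<Longrightarrow> \<bar>y\<bar> \<le> Y"
    using W unfolding bounded_iff real_norm_def by (metis abs_ge_zero order.trans abs_ge_self)
  \<comment> \<open>Bounds both |w| and |1 - w| when |sinh \<xi>| \<ge> \<epsilon>.\<close>
  define C where "C = 1 + 1 / (2 * \<epsilon>)"
  have C: "C \<ge> 0" using \<epsilon> by (simp add: C_def)
  define T where "T n \<nu> \<mu> p = (\<Sum>k<n. a_coeff k (\<nu> + 1/2) * Gamma (\<mu> - of_nat k) * (2 * p) ^ k)" for n and \<nu> \<mu> p :: complex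
  obtain K1 R1 where K1: "K1 \<ge> 0" and bound1: "\<And>\<nu> \<mu> p. norm \<nu> \<le> B \<Longrightarrow> \<bar>Im \<mu>\<bar> \<le> Y \<Longrightarrow> R1 \<le> Re \<mu> \<Longrightarrow> p \<notin> \<real>\<^sub>\<le>\<^sub>0 \<Longrightarrow> norm p \<le> C \<Longrightarrow>
       norm (legE \<nu> \<mu> p - T N \<nu> \<mu> p) \<le> K1 * (norm (Gamma (\<mu> - of_nat N)) * norm p ^ N)"
    and hol: "\<And>\<nu> \<mu>. norm \<nu> \<le> B \<Longrightarrow> R1 \<le> Re \<mu> \<Longrightarrow> legE \<nu> \<mu> holomorphic_on - \<real>\<^sub>\<le>\<^sub>0"
    unfolding T_def by (rule legE_expansion[OF B(1) C Y(1), of N]) blast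
  obtain K2 R2 where K2: "K2 \<ge> 0" and bound2: "\<And>\<nu> \<mu> p. norm \<nu> \<le> B \<Longrightarrow> \<bar>Im \<mu>\<bar> \<le> Y \<Longrightarrow> R2 \<le> Re \<mu> \<Longrightarrow> p \<notin> \<real>\<^sub>\<le>\<^sub>0 \<Longrightarrow> norm p \<le> C \<Longrightarrow>
       norm (legE \<nu> \<mu> p - T M \<nu> \<mu> p) \<le> K2 * (norm (Gamma (\<mu> - of_nat M)) * norm p ^ M)"
    unfolding T_def by (rule legE_expansion[OF B(1) C Y(1), of M]) blast
  define K where "K = max K1 K2"
  have le: "Ki * (g * norm p ^ n) \<le> K * (g * norm (2 * p) ^ n)" if "Ki \<le> K" "g \<ge> 0" for Ki g n and p :: complex
  proof -
    have "norm p ^ n \<le> norm (2 * p) ^ n" by (intro power_mono) (auto simp: norm_mult)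
    moreover have "K \<ge> 0" using K1 by (simp add: K_def)
    ultimately show ?thesis using that by (intro mult_mono) auto
  qed
  show "\<exists>K R::real. \<forall>\<xi> \<nu> \<mu>. (\<xi>, \<nu>, \<mu>) \<in> S \<longrightarrow> R \<le> Re \<mu> \<longrightarrow>
        (\<exists>r s. norm r \<le> K * (norm (Gamma (\<mu> - of_nat N)) * norm (- exp (- \<xi>) / sinh \<xi>) ^ N) \<and>
               norm s \<le> K * (norm (Gamma (\<mu> - of_nat M)) * norm (exp \<xi> / sinh \<xi>) ^ M) \<and>
               f \<xi> \<nu> \<mu> =
                 A \<xi> \<nu> \<mu> * ((\<Sum>n<N. a_coeff n (\<nu> + 1 / 2) * Gamma (\<mu> - of_nat n) * (- exp (- \<xi>) / sinh \<xi>) ^ n) + r) +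
                 C_coeff \<xi> (- m \<nu> \<mu> - 1 / 2) * b \<nu> \<mu> * exp (- \<mu> * \<xi>) * ((\<Sum>m<M. a_coeff m (\<nu> + 1 / 2) * Gamma (\<mu> - of_nat m) * (exp \<xi> / sinh \<xi>) ^ m) + s))"
  proof (rule exI[of _ K], rule exI[of _ "max R0 (max R1 R2)"], intro allI impI)
    fix \<xi> \<nu> \<mu> assume S: "(\<xi>, \<nu>, \<mu>) \<in> S" and R: "max R0 (max R1 R2) \<le> Re \<mu>"
    have \<xi>: "\<xi> \<in> D_half" "\<epsilon> \<le> norm (sinh \<xi>)" and \<nu>V: "\<nu> \<in> V" and \<mu>W: "Im \<mu> \<in> W" using S by (auto simp: S_def)
    have \<nu>: "norm \<nu> \<le> B" and \<mu>: "\<bar>Im \<mu>\<bar> \<le> Y" using B(2)[OF \<nu>V] Y(2)[OF \<mu>W] .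
    note f = wvar_facts[OF \<xi>(1)]
    have nw: "norm (wvar x) \<le> C" "norm (1 - wvar x) \<le> C" if "x \<in> D_half" "\<epsilon> \<le> norm (sinh x)" for x
    proof -
      note n = norm_wvar_le[OF that \<epsilon>]
      show "norm (wvar x) \<le> C" using n by (simp add: C_def)
      show "norm (1 - wvar x) \<le> C" using n norm_triangle_ineq4[of 1 "wvar x"] by (simp add: C_def)
    qed
    let ?w = "wvar \<xi>"
    let ?E = "legE \<nu> \<mu>"
    define \<beta> where "\<beta> x = C_coeff x (- m \<nu> \<mu> - 1 / 2) * b \<nu> \<mu> * exp (- \<mu> * x)" for x
    have "\<exists>r s. norm r \<le> K1 * (norm (Gamma (\<mu> - of_nat N)) * norm ?w ^ N) \<and>
               norm s \<le> K2 * (norm (Gamma (\<mu> - of_nat M)) * norm (1 - ?w) ^ M) \<and>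
               f \<xi> \<nu> \<mu> = A \<xi> \<nu> \<mu> * (T N \<nu> \<mu> ?w + r) + \<beta> \<xi> * (T M \<nu> \<mu> (1 - ?w) + s)"
    proof (cases "Im \<xi> = 0")
      case False
      have "Im ?w \<noteq> 0" using sgn_Im_wvar[OF \<xi>(1), of 1] sgn_Im_wvar[OF \<xi>(1), of "- 1"] False by (cases "Im \<xi> > 0") auto
      hence wn: "?w \<notin> \<real>\<^sub>\<le>\<^sub>0" "1 - ?w \<notin> \<real>\<^sub>\<le>\<^sub>0" by (auto simp: complex_nonpos_Reals_iff)
      show ?thesis
      proof (rule exI[of _ "?E ?w - T N \<nu> \<mu> ?w"], rule exI[of _ "?E (1 - ?w) - T M \<nu> \<mu> (1 - ?w)"], intro conjI)
        show "norm (?E ?w - T N \<nu> \<mu> ?w) \<le> K1 * (norm (Gamma (\<mu> - of_nat N)) * norm ?w ^ N)"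
          using R by (intro bound1 \<nu> \<mu> wn nw \<xi>) auto
        show "norm (?E (1 - ?w) - T M \<nu> \<mu> (1 - ?w)) \<le> K2 * (norm (Gamma (\<mu> - of_nat M)) * norm (1 - ?w) ^ M)"
          using R by (intro bound2 \<nu> \<mu> wn nw \<xi>) auto
        show "f \<xi> \<nu> \<mu> = A \<xi> \<nu> \<mu> * (T N \<nu> \<mu> ?w + (?E ?w - T N \<nu> \<mu> ?w)) + \<beta> \<xi> * (T M \<nu> \<mu> (1 - ?w) + (?E (1 - ?w) - T M \<nu> \<mu> (1 - ?w)))"
          using conn[OF \<xi>(1) False \<nu>V \<mu>W] R by (simp add: \<beta>_def)
      qed
    next
      case True
      have Im0: "Im ?w = 0" using True by (simp add: Im_wvar Im_exp)
      have Rew: "Re ?w < 0"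
      proof -
        have xr: "\<xi> = of_real (Re \<xi>)" using True by (simp add: complex_eq_iff)
        have "exp (2 * Re \<xi>) > 1" using \<xi>(1) by (simp add: D_half_def)
        moreover have "?w = of_real (- 1 / (exp (2 * Re \<xi>) - 1))"
          unfolding wvar_def by (subst xr) (simp add: exp_of_real[symmetric])
        ultimately show ?thesis by (simp only: Re_complex_of_real) simp
      qed
      have w1: "1 - ?w \<notin> \<real>\<^sub>\<le>\<^sub>0" using Rew by (auto simp: complex_nonpos_Reals_iff)
      have contw: "isCont wvar \<xi>" unfolding wvar_def using D_half_exp_neq_1[OF \<xi>(1)] by (intro continuous_intros) auto
      have contE: "isCont ?E (1 - ?w)"
        using holomorphic_on_imp_continuous_on[OF hol[OF \<nu>, of \<mu>]] R open_Compl_nonpos_Reals w1 by (simp add: continuous_on_eq_continuous_at)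
      define \<gamma> where "\<gamma> s = - exp (of_real s * \<i> * of_real pi * m \<nu> \<mu>) * b \<nu> \<mu> * exp (- \<mu> * \<xi>)" for s :: real
      \<comment> \<open>A representation from one side of the real axis. Only the first remainder is
        obtained as a limit; 1 - w > 1 is away from the cut, so the second solution is simply
        continuous there.\<close>
      have side: "\<exists>r. norm r \<le> K1 * (norm (Gamma (\<mu> - of_nat N)) * norm ?w ^ N) \<and>
          f \<xi> \<nu> \<mu> = A \<xi> \<nu> \<mu> * (T N \<nu> \<mu> ?w + r) + \<gamma> s * ?E (1 - ?w)" if s: "s = 1 \<or> s = - 1" for s :: real
      proof -
        \<comment> \<open>The imaginary part is at most 1/2 in modulus, which keeps the sequence
          inside the strip.\<close>
        define x where "x j = \<xi> + of_real (s / (real j + 2)) * \<i>" for j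
        have ImRe: "Im (x j) = s / (real j + 2)" "Re (x j) = Re \<xi>" for j using True by (simp_all add: x_def del: of_real_divide)
        have sIm: "s * Im (x j) > 0" "Im (x j) \<noteq> 0" for j using s by (auto simp: ImRe)
        have xD: "x j \<in> D_half" for j
        proof -
          have "\<bar>Im (x j)\<bar> = 1 / (real j + 2)" using s by (auto simp: ImRe)
          also have "\<dots> \<le> 1 / 2" by (intro divide_left_mono) auto
          also have "\<dots> < pi / 2" using pi_gt3 by simp
          finally show ?thesis using \<xi>(1) by (simp add: D_half_def ImRe)
        qed
        have xsinh: "\<epsilon> \<le> norm (sinh (x j))" for j
        proof -
          \<comment> \<open>|sinh|^2 is the sum of sinh^2 of the real part and sin^2 of the
            imaginary part, so leaving the real axis vertically preserves the lower bound
            \<epsilon>.\<close>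
          have n2: "(norm (sinh y))\<^sup>2 = (sinh (Re y))\<^sup>2 + (sin (Im y))\<^sup>2" for y :: complex
          proof -
            have "Re (sinh y) = sinh (Re y) * cos (Im y)" "Im (sinh y) = cosh (Re y) * sin (Im y)"
              by (simp_all add: cosh_def sinh_def Re_exp Im_exp algebra_simps)
            hence "(norm (sinh y))\<^sup>2 = (sinh (Re y))\<^sup>2 * (cos (Im y))\<^sup>2 + ((sinh (Re y))\<^sup>2 + 1) * (sin (Im y))\<^sup>2"
              by (simp add: cmod_power2 power_mult_distrib cosh_square_eq)
            also have "\<dots> = (sinh (Re y))\<^sup>2 * ((sin (Im y))\<^sup>2 + (cos (Im y))\<^sup>2) + (sin (Im y))\<^sup>2" by algebra
            finally show ?thesis by simp
          qed
          have "(norm (sinh \<xi>))\<^sup>2 \<le> (norm (sinh (x j)))\<^sup>2" unfolding n2 using True by (simp add: ImRe)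
          hence "norm (sinh \<xi>) \<le> norm (sinh (x j))" by (rule power2_le_imp_le) auto
          thus ?thesis using \<xi>(2) by linarith
        qed
        have xl: "x \<longlonglongrightarrow> \<xi>"
        proof -
          have "(\<lambda>j. \<xi> + of_real s * complex_of_real (1 / (real j + 2)) * \<i>) \<longlonglongrightarrow> \<xi> + of_real s * 0 * \<i>"
            by (intro tendsto_intros LIMSEQ_of_real_inverse_Suc)
          thus ?thesis by (simp add: x_def[abs_def])
        qed
        define r where "r j = ?E (wvar (x j)) - T N \<nu> \<mu> (wvar (x j))" for j
        have wn: "wvar (x j) \<notin> \<real>\<^sub>\<le>\<^sub>0" for j
          using sgn_Im_wvar[OF xD s sIm(1), of j] by (auto simp: complex_nonpos_Reals_iff)
        have rb: "norm (r j) \<le> K1 * (norm (Gamma (\<mu> - of_nat N)) * norm (wvar (x j)) ^ N)" for j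
          unfolding r_def using R by (intro bound1 \<nu> \<mu> wn nw xD xsinh) auto
        \<comment> \<open>Boundedness and a convergent subsequence suffice; boundary values of
          \<open>legE\<close> on the cut need not be discussed, and the remainder bound survives the
          limit.\<close>
        have "bounded (range r)"
        proof (rule boundedI)
          fix y assume "y \<in> range r"
          then obtain j where "y = r j" by auto
          moreover have "norm (wvar (x j)) ^ N \<le> C ^ N" using nw(1)[OF xD xsinh] by (intro power_mono) auto
          hence "K1 * (norm (Gamma (\<mu> - of_nat N)) * norm (wvar (x j)) ^ N) \<le> K1 * (norm (Gamma (\<mu> - of_nat N)) * C ^ N)"
            using K1 by (intro mult_left_mono) auto
          ultimately show "norm y \<le> K1 * (norm (Gamma (\<mu> - of_nat N)) * C ^ N)" using rb[of j] by simp
        qed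
        then obtain l g where g: "strict_mono (g :: nat \<Rightarrow> nat)" "(r \<circ> g) \<longlonglongrightarrow> l"
          using bounded_imp_convergent_subsequence by blast
        have xg: "(\<lambda>j. x (g j)) \<longlonglongrightarrow> \<xi>" using LIMSEQ_subseq_LIMSEQ[OF xl g(1)] by (simp add: o_def)
        have rg: "(\<lambda>j. r (g j)) \<longlonglongrightarrow> l" using g(2) by (simp add: o_def)
        have wg: "(\<lambda>j. wvar (x (g j))) \<longlonglongrightarrow> ?w" using contw xg by (rule isCont_tendsto_compose)
        have Ag: "(\<lambda>j. A (x (g j)) \<nu> \<mu>) \<longlonglongrightarrow> A \<xi> \<nu> \<mu>" by (rule isCont_tendsto_compose[OF contA xg])
        have fg: "(\<lambda>j. f (x (g j)) \<nu> \<mu>) \<longlonglongrightarrow> f \<xi> \<nu> \<mu>" by (rule isCont_tendsto_compose[OF contf[OF \<xi>(1) True] xg])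
        have Eg: "(\<lambda>j. ?E (1 - wvar (x (g j)))) \<longlonglongrightarrow> ?E (1 - ?w)"
          by (rule isCont_tendsto_compose[OF contE]) (intro tendsto_intros wg)
        have Tg: "(\<lambda>j. T N \<nu> \<mu> (wvar (x (g j)))) \<longlonglongrightarrow> T N \<nu> \<mu> ?w" unfolding T_def by (intro tendsto_intros wg)
        have "(\<lambda>j. A (x (g j)) \<nu> \<mu> * (T N \<nu> \<mu> (wvar (x (g j))) + r (g j)) +
             - exp (of_real s * \<i> * of_real pi * m \<nu> \<mu>) * b \<nu> \<mu> * exp (- \<mu> * x (g j)) * ?E (1 - wvar (x (g j))))
          \<longlonglongrightarrow> A \<xi> \<nu> \<mu> * (T N \<nu> \<mu> ?w + l) + \<gamma> s * ?E (1 - ?w)"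
          unfolding \<gamma>_def by (intro tendsto_intros Ag Tg rg Eg xg)
        moreover have "A (x (g j)) \<nu> \<mu> * (T N \<nu> \<mu> (wvar (x (g j))) + r (g j)) +
             - exp (of_real s * \<i> * of_real pi * m \<nu> \<mu>) * b \<nu> \<mu> * exp (- \<mu> * x (g j)) * ?E (1 - wvar (x (g j))) = f (x (g j)) \<nu> \<mu>" for j
          using conn[OF xD sIm(2) \<nu>V \<mu>W, of "g j"] R unfolding C_coeff_half[OF s sIm(1)] r_def by simp
        ultimately have "(\<lambda>j. f (x (g j)) \<nu> \<mu>) \<longlonglongrightarrow> A \<xi> \<nu> \<mu> * (T N \<nu> \<mu> ?w + l) + \<gamma> s * ?E (1 - ?w)" by (simp only:)
        with fg have "f \<xi> \<nu> \<mu> = A \<xi> \<nu> \<mu> * (T N \<nu> \<mu> ?w + l) + \<gamma> s * ?E (1 - ?w)" by (rule LIMSEQ_unique)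
        moreover have "norm l \<le> K1 * (norm (Gamma (\<mu> - of_nat N)) * norm ?w ^ N)"
        proof (rule LIMSEQ_le)
          show "(\<lambda>j. norm (r (g j))) \<longlonglongrightarrow> norm l" by (intro tendsto_intros rg)
          show "(\<lambda>j. K1 * (norm (Gamma (\<mu> - of_nat N)) * norm (wvar (x (g j))) ^ N)) \<longlonglongrightarrow> K1 * (norm (Gamma (\<mu> - of_nat N)) * norm ?w ^ N)"
            by (intro tendsto_intros wg)
        qed (use rb in blast)
        ultimately show ?thesis by blast
      qed
      obtain r1 where r1: "norm r1 \<le> K1 * (norm (Gamma (\<mu> - of_nat N)) * norm ?w ^ N)"
        "f \<xi> \<nu> \<mu> = A \<xi> \<nu> \<mu> * (T N \<nu> \<mu> ?w + r1) + \<gamma> 1 * ?E (1 - ?w)" using side[of 1] by blast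
      obtain r2 where r2: "norm r2 \<le> K1 * (norm (Gamma (\<mu> - of_nat N)) * norm ?w ^ N)"
        "f \<xi> \<nu> \<mu> = A \<xi> \<nu> \<mu> * (T N \<nu> \<mu> ?w + r2) + \<gamma> (- 1) * ?E (1 - ?w)" using side[of "- 1"] by blast
      have \<beta>: "\<beta> \<xi> = (\<gamma> 1 + \<gamma> (- 1)) / 2" unfolding \<beta>_def \<gamma>_def C_coeff_real[OF True] by (simp add: field_simps)
      show ?thesis
      proof (rule exI[of _ "(r1 + r2) / 2"], rule exI[of _ "?E (1 - ?w) - T M \<nu> \<mu> (1 - ?w)"], intro conjI)
        have "norm (r1 + r2) \<le> 2 * (K1 * (norm (Gamma (\<mu> - of_nat N)) * norm ?w ^ N))" using norm_triangle_ineq[of r1 r2] r1(1) r2(1) by linarith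
        thus "norm ((r1 + r2) / 2) \<le> K1 * (norm (Gamma (\<mu> - of_nat N)) * norm ?w ^ N)" by (simp add: norm_divide)
        show "norm (?E (1 - ?w) - T M \<nu> \<mu> (1 - ?w)) \<le> K2 * (norm (Gamma (\<mu> - of_nat M)) * norm (1 - ?w) ^ M)"
          using R by (intro bound2 \<nu> \<mu> w1 nw \<xi>) auto
        have "2 * f \<xi> \<nu> \<mu> = (A \<xi> \<nu> \<mu> * (T N \<nu> \<mu> ?w + r1) + \<gamma> 1 * ?E (1 - ?w)) + (A \<xi> \<nu> \<mu> * (T N \<nu> \<mu> ?w + r2) + \<gamma> (- 1) * ?E (1 - ?w))"
          using r1(2) r2(2) by (metis mult_2)
        also have "\<dots> = 2 * (A \<xi> \<nu> \<mu> * (T N \<nu> \<mu> ?w + (r1 + r2) / 2) + \<beta> \<xi> * (T M \<nu> \<mu> (1 - ?w) + (?E (1 - ?w) - T M \<nu> \<mu> (1 - ?w))))"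
          unfolding \<beta> by (simp add: field_simps)
        finally show "f \<xi> \<nu> \<mu> = A \<xi> \<nu> \<mu> * (T N \<nu> \<mu> ?w + (r1 + r2) / 2) + \<beta> \<xi> * (T M \<nu> \<mu> (1 - ?w) + (?E (1 - ?w) - T M \<nu> \<mu> (1 - ?w)))" by (subst (asm) mult_cancel_left) simp
      qed
    qed
    then obtain r s where rs: "norm r \<le> K1 * (norm (Gamma (\<mu> - of_nat N)) * norm ?w ^ N)"
      "norm s \<le> K2 * (norm (Gamma (\<mu> - of_nat M)) * norm (1 - ?w) ^ M)"
      and eq: "f \<xi> \<nu> \<mu> = A \<xi> \<nu> \<mu> * (T N \<nu> \<mu> ?w + r) + \<beta> \<xi> * (T M \<nu> \<mu> (1 - ?w) + s)" by blast
    have "K1 \<le> K" "K2 \<le> K" by (auto simp: K_def)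
    from order.trans[OF rs(1) le[OF this(1) norm_ge_zero]] order.trans[OF rs(2) le[OF this(2) norm_ge_zero]]
    have "norm r \<le> K * (norm (Gamma (\<mu> - of_nat N)) * norm (2 * ?w) ^ N)" "norm s \<le> K * (norm (Gamma (\<mu> - of_nat M)) * norm (2 * (1 - ?w)) ^ M)"
      by blast+
    thus "\<exists>r s. norm r \<le> K * (norm (Gamma (\<mu> - of_nat N)) * norm (- exp (- \<xi>) / sinh \<xi>) ^ N) \<and>
               norm s \<le> K * (norm (Gamma (\<mu> - of_nat M)) * norm (exp \<xi> / sinh \<xi>) ^ M) \<and>
               f \<xi> \<nu> \<mu> =
                 A \<xi> \<nu> \<mu> * ((\<Sum>n<N. a_coeff n (\<nu> + 1 / 2) * Gamma (\<mu> - of_nat n) * (- exp (- \<xi>) / sinh \<xi>) ^ n) + r) +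
                 C_coeff \<xi> (- m \<nu> \<mu> - 1 / 2) * b \<nu> \<mu> * exp (- \<mu> * \<xi>) * ((\<Sum>m<M. a_coeff m (\<nu> + 1 / 2) * Gamma (\<mu> - of_nat m) * (exp \<xi> / sinh \<xi>) ^ m) + s)"
      using eq unfolding f(2,3) T_def \<beta>_def by blast
  qed
qed

section \<open>Continuity on the real ray and the conclusion\<close>

lemma isCont_coth:
  assumes "\<xi> \<in> D_half" shows "isCont coth \<xi>"
proof -
  have "sinh \<xi> \<noteq> 0" using sinh_conv_exp[of \<xi>] D_half_exp_neq_1[OF assms] by auto
  moreover have "isCont (sinh :: complex \<Rightarrow> complex) \<xi>" "isCont (cosh :: complex \<Rightarrow> complex) \<xi>"
    by (auto intro!: continuous_intros)
  ultimately show ?thesis unfolding coth_def by (intro continuous_divide) auto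
qed

lemma coth_real_gt_1:
  assumes "\<xi> \<in> D_half" "Im \<xi> = 0"
  shows "Im (coth \<xi>) = 0" "Re (coth \<xi>) > 1"
proof -
  have xr: "\<xi> = of_real (Re \<xi>)" using assms by (simp add: complex_eq_iff)
  have "exp (2 * Re \<xi>) > 1" using assms(1) by (simp add: D_half_def)
  moreover have "wvar \<xi> = of_real (- 1 / (exp (2 * Re \<xi>) - 1))"
    unfolding wvar_def by (subst xr) (simp add: exp_of_real[symmetric])
  ultimately show "Im (coth \<xi>) = 0" "Re (coth \<xi>) > 1" unfolding wvar_facts(1)[OF assms(1)] by auto
qed

lemma isCont_hyperF_reg: "w \<in> slit_plane \<Longrightarrow> isCont (hyperF_reg a b c) w"
  using holomorphic_on_imp_continuous_on[OF holomorphic_on_hyperF_reg] open_slit_plane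
  by (simp add: continuous_on_eq_continuous_at)

lemma isCont_legendre_P:
  assumes "Im z = 0" "Re z > 1"
  shows "isCont (legendre_P \<nu> \<mu>) z"
proof -
  have z: "z - 1 \<noteq> 0" using assms by (auto simp: complex_eq_iff)
  have "(z + 1) / (z - 1) = of_real ((Re z + 1) / (Re z - 1))" using assms by (simp add: complex_eq_iff Re_divide Im_divide power2_eq_square)
  hence "(z + 1) / (z - 1) \<notin> \<real>\<^sub>\<le>\<^sub>0" using assms by (auto simp: complex_nonpos_Reals_iff divide_le_0_iff)
  moreover have "isCont (\<lambda>z. hyperF_reg (\<nu> + 1) (- \<nu>) (1 - \<mu>) ((1 - z) / 2)) z"
    by (rule isCont_o2[OF _ isCont_hyperF_reg]) (use assms in \<open>auto intro!: continuous_intros simp: slit_plane_iff\<close>)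
  moreover have "isCont (\<lambda>z. (z + 1) / (z - 1)) z" using z by (intro continuous_intros) auto
  ultimately show ?thesis unfolding legendre_P_def[abs_def]
    by (intro continuous_mult isCont_powr_complex continuous_const)
qed

lemma isCont_legendre_Q:
  assumes "Im z = 0" "Re z > 1"
  shows "isCont (legendre_Q \<nu> \<mu>) z"
proof -
  have z: "z \<noteq> 0" "z \<notin> \<real>\<^sub>\<le>\<^sub>0" "z - 1 \<notin> \<real>\<^sub>\<le>\<^sub>0" "z + 1 \<notin> \<real>\<^sub>\<le>\<^sub>0" using assms by (auto simp: complex_nonpos_Reals_iff)
  have zr: "z = of_real (Re z)" using assms by (simp add: complex_eq_iff)
  have "1 / z\<^sup>2 = of_real (1 / (Re z)\<^sup>2)" by (subst zr) simp
  moreover have "1 / (Re z)\<^sup>2 < 1" using assms by (simp add: one_less_power)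
  ultimately have "1 / z\<^sup>2 \<in> slit_plane" by (simp only: slit_plane_iff Re_complex_of_real) simp
  hence "isCont (\<lambda>z. hyperF_reg ((\<nu> + \<mu> + 2) / 2) ((\<nu> + \<mu> + 1) / 2) (\<nu> + 3 / 2) (1 / z\<^sup>2)) z"
    using z(1) by (intro isCont_o2[OF _ isCont_hyperF_reg] continuous_intros) auto
  moreover have "isCont (\<lambda>z. z powr (\<nu> + \<mu> + 1)) z" "isCont (\<lambda>z. (z - 1) powr (\<mu> / 2)) z" "isCont (\<lambda>z. (z + 1) powr (\<mu> / 2)) z"
    using z by (auto intro!: continuous_intros)
  ultimately show ?thesis unfolding legendre_Q_def[abs_def] using z
    by (intro continuous_mult continuous_divide continuous_const) (auto simp: powr_eq_0_iff)
qed

theorem mainTheorem14: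
  fixes \<epsilon> :: real and V :: "complex set" and W :: "real set"
  assumes "\<epsilon> > 0" and "bounded V" and "bounded W"
  defines "S \<equiv> {(\<xi>, \<nu>, \<mu>). \<xi> \<in> D_half \<and> \<epsilon> \<le> norm (sinh \<xi>) \<and> \<nu> \<in> V \<and> Im \<mu> \<in> W}"
  shows "inverse_factorial_expansion S
           (\<lambda>\<xi> \<nu> \<mu>. legendre_P \<nu> \<mu> (coth \<xi>))
           (\<lambda>\<xi> \<nu> \<mu>. sin (of_real pi * \<mu>) / of_real pi * exp (\<mu> * \<xi>))
           (\<lambda>\<xi>. - exp (- \<xi>) / sinh \<xi>)
           (\<lambda>\<xi> \<nu> \<mu>. C_coeff \<xi> (- \<mu> - 1 / 2) * (sin (of_real pi * \<nu>) / of_real pi) * exp (- \<mu> * \<xi>))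
           (\<lambda>\<xi>. exp \<xi> / sinh \<xi>) \<and>
         inverse_factorial_expansion S
           (\<lambda>\<xi> \<nu> \<mu>. exp (- (of_real pi * \<i> * \<mu>)) * legendre_Q \<nu> \<mu> (coth \<xi>))
           (\<lambda>\<xi> \<nu> \<mu>. 1 / 2 * exp (\<mu> * \<xi>))
           (\<lambda>\<xi>. - exp (- \<xi>) / sinh \<xi>)
           (\<lambda>\<xi> \<nu> \<mu>. C_coeff \<xi> (- \<nu> - 1 / 2) * (1 / 2) * exp (- \<mu> * \<xi>))
           (\<lambda>\<xi>. exp \<xi> / sinh \<xi>)"
proof -
  obtain B where B: "B \<ge> 0" "\<And>\<nu>. \<nu> \<in> V \<Longrightarrow> norm \<nu> \<le> B"
    using assms(2) unfolding bounded_iff by (metis abs_ge_zero order.trans abs_ge_self)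
  obtain Y where Y: "Y \<ge> 0" "\<And>y. y \<in> W \<Longrightarrow> \<bar>y\<bar> \<le> Y"
    using assms(3) unfolding bounded_iff real_norm_def by (metis abs_ge_zero order.trans abs_ge_self)
  obtain R where R: "\<And>\<nu> \<mu>. norm \<nu> \<le> B \<Longrightarrow> \<bar>Im \<mu>\<bar> \<le> Y \<Longrightarrow> R \<le> Re \<mu> \<Longrightarrow> legE_regular \<nu> \<mu>"
    using legE_regular_eventually[OF B(1) Y(1)] by blast
  have contP: "isCont (\<lambda>\<xi>. legendre_P \<nu> \<mu> (coth \<xi>)) \<xi>" if "\<xi> \<in> D_half" "Im \<xi> = 0" for \<xi> \<nu> \<mu>
    by (rule isCont_o2[OF isCont_coth[OF that(1)] isCont_legendre_P[OF coth_real_gt_1[OF that]]])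
  have contQ: "isCont (\<lambda>\<xi>. legendre_Q \<nu> \<mu> (coth \<xi>)) \<xi>" if "\<xi> \<in> D_half" "Im \<xi> = 0" for \<xi> \<nu> \<mu>
    by (rule isCont_o2[OF isCont_coth[OF that(1)] isCont_legendre_Q[OF coth_real_gt_1[OF that]]])
  show ?thesis unfolding S_def
  proof (intro conjI, goal_cases)
    case 1
    show ?case
    proof (rule inverse_factorial_expansion_if_connection[OF assms(1-3), where m = "\<lambda>\<nu> \<mu>. \<mu>" and b = "\<lambda>\<nu> \<mu>. sin (of_real pi * \<nu>) / of_real pi"])
      fix \<xi> \<nu> \<mu> assume "\<xi> \<in> D_half" "Im \<xi> \<noteq> 0" "\<nu> \<in> V" "Im \<mu> \<in> W" "R \<le> Re \<mu>"
      thus "legendre_P \<nu> \<mu> (coth \<xi>) = sin (of_real pi * \<mu>) / of_real pi * exp (\<mu> * \<xi>) * legE \<nu> \<mu> (wvar \<xi>)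
        + C_coeff \<xi> (- \<mu> - 1 / 2) * (sin (of_real pi * \<nu>) / of_real pi) * exp (- \<mu> * \<xi>) * legE \<nu> \<mu> (1 - wvar \<xi>)"
        by (intro legendre_P_connection R B(2) Y(2))
    qed (auto intro!: contP continuous_intros)
  next
    case 2
    show ?case
    proof (rule inverse_factorial_expansion_if_connection[OF assms(1-3), where m = "\<lambda>\<nu> \<mu>. \<nu>" and b = "\<lambda>\<nu> \<mu>. 1 / 2"])
      \<comment> \<open>The threshold is raised to \<open>B\<close>, the bound on |\<nu>|, so that
        Re (\<nu> + \<mu> + 1) > 0, as the formula for Q requires.\<close>
      fix \<xi> \<nu> \<mu> assume *: "\<xi> \<in> D_half" "Im \<xi> \<noteq> 0" "\<nu> \<in> V" "Im \<mu> \<in> W" "max R B \<le> Re \<mu>"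
      have "- Re \<nu> \<le> B" using B(2)[OF *(3)] abs_Re_le_cmod[of \<nu>] by linarith
      hence "Re (\<nu> + \<mu> + 1) > 0" using *(5) by simp
      moreover have "legE_regular \<nu> \<mu>" using * by (intro R B(2) Y(2)) auto
      ultimately show "exp (- (of_real pi * \<i> * \<mu>)) * legendre_Q \<nu> \<mu> (coth \<xi>) = 1 / 2 * exp (\<mu> * \<xi>) * legE \<nu> \<mu> (wvar \<xi>)
        + C_coeff \<xi> (- \<nu> - 1 / 2) * (1 / 2) * exp (- \<mu> * \<xi>) * legE \<nu> \<mu> (1 - wvar \<xi>)"
        using * by (intro legendre_Q_connection)
    qed (auto intro!: contQ continuous_intros)
  qed
qed

end
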